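(* Let $\mathbf X$ be an $\alpha$-rough path, let $\sigma_\mu\in C^N(\mathbb R^k,\mathbb R^k)$ for $\mu\in[d]$, and suppose the tree path $\mathbf Y$ is coherent. Then there is a constant $C<\infty$ depending only on $d,k,\alpha$ such that for any $\mu\in[d]$, $f\in\mathcal F_{\le N-1}$ and $s,t\in(0,1]$, $$\begin{aligned}|R^{\sigma_\mu(\mathbf Y),f}_{s,t}|\le{}& C\sup\Big\{\big|D\Upsilon_\mu[f](Y_s+a)\big|\cdot|R^{\mathbf Y,\mathbf 1}_{s,t}|:\ a\in\mathbb R^k,\ |a|\le E^{\mathbf Y}_{s,t}+|Y_t-Y_s|\Big\}\\&+C\sup\Big\{\Big|D^{\#\tilde f}\Upsilon_\mu[f](Y_s+z)\prod_{h\in\tilde f}\Upsilon[h](Y_s)\langle\mathbf X_{s,t},h\rangle\Big|:\ \tilde f\in\partial\mathcal F_{\le N-|f|-1},\ z\in\mathbb R^k,\ |z|\le E^{\mathbf Y}_{s,t}\Big\},\end{aligned}$$ where $$E^{\mathbf Y}_{s,t}=\sum_{h\in\mathring{\mathcal T}_{\le N-1}}|\Upsilon[h](Y_s)\langle\mathbf X_{s,t},h\rangle| .$$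
   Context: Fix integers $d,k\ge 1$ and $\alpha\in(0,1)$; $N$ is the unique natural number with $N\alpha\le 1<(N+1)\alpha$; $[d]=\{1,\dots,d\}$. Trees and forests. Consider finite rooted trees (non-planar) with vertices decorated by elements of $[d]$. A forest is a finite, possibly empty, multiset of such trees, written as a commutative product; $\mathbf 1$ is the empty forest. For a forest $f$ and $\mu\in[d]$, $[f]_\mu$ is the tree obtained by joining the roots of all trees of $f$ to a new root decorated by $\mu$; every tree is uniquely of this form. $|f|$ is the number of vertices, $\#f$ the number of trees in $f$ (with multiplicity), $f_h$ the multiplicity of the tree $h$ in $f$; products over $h\in f$ are with multiplicity. $\mathring{\mathcal T}_{\le j}$ is the set of trees $h$ with $|h|\le j$, $\mathcal T_{\le j}=\mathring{\mathcal T}_{\le j}\cup\{\mathbf 1\}$, $\mathcal F$ is the set of forests all of whose trees lie in $\mathring{\mathcal T}_{\le N}$, $\mathcal F_{\le j}=\{f\in\mathcal F:|f|\le j\}$. $\mathrm{Span}(\mathcal F)$ is the free real vector space on $\mathcal F$, a commutative unital algebra under the forest product; $\langle\cdot,\cdot\rangle$ denotes the inner product making forests orthonormal, its tensor version, and duality pairings (applied componentwise to vectors). $P_{\le n}$ is the linear projection annihilating forests $f$ with $|f|>n$ and fixing the others. Boundary. Fix an arbitrary total order on $\mathring{\mathcal T}_{\le N-1}$. For a set $A$ of forests, $\partial A$ is the set of non-empty forests $f\notin A$, with all trees in $\mathring{\mathcal T}_{\le N-1}$, such that removing from $f$ one copy of its minimal tree $\min\{h:f_h\ne0\}$ yields a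 forest in $A$. The supremum over an empty set is $0$. Coproduct. $\Delta$ is the multiplicative linear map with $\Delta\mathbf 1=\mathbf 1\otimes\mathbf 1$ and $\Delta[f]_\mu=[f]_\mu\otimes\mathbf 1+(\mathrm{id}\otimes[\,\cdot\,]_\mu)\Delta f$. Rough paths. An $\alpha$-rough path is a map $\mathbf X:[0,1]^2\to\mathrm{Char}$, where $\mathrm{Char}$ is the set of unital algebra homomorphisms $\mathrm{Span}(\mathcal F)\to\mathbb R$, such that $\langle\mathbf X_{s,u}\otimes\mathbf X_{u,t},\Delta h\rangle=\langle\mathbf X_{s,t},h\rangle$ for all $s,u,t\in[0,1]$, $h\in\mathcal T_{\le N}$, and $\sup_{s\ne t}|\langle\mathbf X_{s,t},h\rangle||s-t|^{-\alpha|h|}<\infty$ for all $h\in\mathring{\mathcal T}_{\le N}$. Tree and forest paths. A tree path (resp. forest path) is a map $\mathbf Y:[0,1]\to\mathrm{Span}(\mathcal T_{\le N-1})^k$ (resp. $\mathrm{Span}(\mathcal F_{\le N-1})^k$). Write $Y_s=\langle\mathbf 1,\mathbf Y_s\rangle\in\mathbb R^k$. The remainder of a tree or forest path $\mathbf Y$ at $f\in\mathcal F_{\le N-1}$ is $R^{\mathbf Y,f}_{s,t}=\langle f,\mathbf Y_t\rangle-\langle\mathbf X_{s,t}\otimes f,\Delta\mathbf Y_s\rangle\in\mathbb R^k$. For a tree path $\mathbf Y$ and $g\in C^{N-1}(\mathbb R^k,\mathbb R^k)$, $g(\mathbf Y)$ is the forest path $$g(\mathbf Y)_s=g(Y_s)\mathbf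 1+P_{\le N-1}\sum_{p=1}^{N-1}\frac1{p!}\sum_{h_1,\dots,h_p\in\mathring{\mathcal T}_{\le N-1}}D^pg(Y_s)[\langle\mathbf Y_s,h_1\rangle,\dots,\langle\mathbf Y_s,h_p\rangle]\;h_1\cdots h_p .$$ A tree path $\mathbf Y$ is coherent if $\langle f,\sigma_\mu(\mathbf Y)_s\rangle=\langle[f]_\mu,\mathbf Y_s\rangle$ for all $[f]_\mu\in\mathring{\mathcal T}_{\le N-1}$ and $s\in(0,1]$. Elementary differentials. For $\mu\in[d]$ and $f=\prod_{i\in I}[f_i]_{\mu_i}\in\mathcal F_{\le N-1}$ define $\Upsilon_\mu[f]:\mathbb R^k\to\mathbb R^k$ inductively by $\Upsilon_\mu[f](y)=D^{|I|}\sigma_\mu(y)[(\Upsilon_{\mu_i}[f_i](y))_{i\in I}]$ (so $\Upsilon_\mu[\mathbf 1]=\sigma_\mu$), and $\Upsilon[[f]_\mu]=\Upsilon_\mu[f]$. The expression $D^{\#\tilde f}\Upsilon_\mu[f](y)\prod_{h\in\tilde f}v_h$ means the $\#\tilde f$-linear form $D^{\#\tilde f}\Upsilon_\mu[f](y)$ applied to the vectors $(v_h)_{h\in\tilde f}$. *)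

theory Defs
  imports "HOL-Analysis.Analysis" "HOL-Library.Multiset" "HOL-Library.Poly_Mapping"
begin

text \<open>
  The decoration alphabet is a finite type \<^typ>\<open>'d\<close>, playing the role of $[d]$ with
  $d$ the cardinality of \<^typ>\<open>'d\<close>.  Forests are multisets of trees, so the
  commutative forest product is \<open>+\<close> and the empty forest is \<open>{#}\<close> (equal to \<open>0\<close>);
  \<open>Node \<mu> f\<close> is the tree $[f]_\mu$.
\<close>

datatype 'd rtree = Node 'd "'d rtree multiset"

type_synonym 'd forest = "'d rtree multiset"

primrec nvert :: "'d rtree \<Rightarrow> nat" where
  "nvert (Node \<mu> f) = Suc (\<Sum>\<^sub># (image_mset nvert f))"

definition fvert :: "'d forest \<Rightarrow> nat" where
  "fvert f = \<Sum>\<^sub># (image_mset nvert f)"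

definition trees_le :: "nat \<Rightarrow> 'd rtree set" where
  "trees_le j = {h. nvert h \<le> j}"

definition trees1_le :: "nat \<Rightarrow> 'd forest set" where
  "trees1_le j = insert {#} ((\<lambda>h. {#h#}) ` trees_le j)"

definition forests :: "nat \<Rightarrow> 'd forest set" where
  "forests N = {f. set_mset f \<subseteq> trees_le N}"

definition forests_le :: "nat \<Rightarrow> nat \<Rightarrow> 'd forest set" where
  "forests_le N j = {f \<in> forests N. fvert f \<le> j}"

text \<open>
  Well defined for non-empty \<open>f\<close> when \<open>r\<close> is a (reflexive) total order, \<open>(h, h') \<in> r\<close> meaning
  $h \le h'$, on a set containing all trees of \<open>f\<close>.
\<close>

definition min_tree :: "('d rtree \<times> 'd rtree) set \<Rightarrow> 'd forest \<Rightarrow> 'd rtree" where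
  "min_tree r f = (THE h. h \<in># f \<and> (\<forall>h'\<in>#f. (h, h') \<in> r))"

definition bdry :: "nat \<Rightarrow> ('d rtree \<times> 'd rtree) set \<Rightarrow> 'd forest set \<Rightarrow> 'd forest set" where
  "bdry N r A = {f. f \<noteq> {#} \<and> f \<notin> A \<and> set_mset f \<subseteq> trees_le (N - 1) \<and>
                    f - {#min_tree r f#} \<in> A}"

text \<open>
  The free vector space on all forests is \<^typ>\<open>'d forest \<Rightarrow>\<^sub>0 real\<close>; its library
  multiplication (convolution over the monoid of forests) is the linear extension of the
  forest product, with unit \<open>Poly_Mapping.single {#} 1 = 1\<close>.  In the same way
  \<^typ>\<open>('d forest \<times> 'd forest) \<Rightarrow>\<^sub>0 real\<close> is the algebraic tensor square with its
  componentwise product, the key \<open>(f, g)\<close> standing for $f \otimes g$.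
\<close>

definition span_of :: "'a set \<Rightarrow> ('a \<Rightarrow>\<^sub>0 real) set" where
  "span_of A = {x. Poly_Mapping.keys x \<subseteq> A}"

definition pscale :: "real \<Rightarrow> ('a \<Rightarrow>\<^sub>0 real) \<Rightarrow> ('a \<Rightarrow>\<^sub>0 real)" where
  "pscale c x = Poly_Mapping.map (\<lambda>b. c * b) x"

definition lin_ext :: "('a \<Rightarrow> ('b \<Rightarrow>\<^sub>0 real)) \<Rightarrow> ('a \<Rightarrow>\<^sub>0 real) \<Rightarrow> ('b \<Rightarrow>\<^sub>0 real)" where
  "lin_ext \<phi> x = (\<Sum>a\<in>Poly_Mapping.keys x. pscale (Poly_Mapping.lookup x a) (\<phi> a))"

definition of_forest :: "'d forest \<Rightarrow> ('d forest \<Rightarrow>\<^sub>0 real)" where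
  "of_forest f = Poly_Mapping.single f 1"

definition coeff :: "'d forest \<Rightarrow> ('d forest \<Rightarrow>\<^sub>0 real) \<Rightarrow> real" where
  "coeff f x = Poly_Mapping.lookup x f"

definition vcoeff :: "'d forest \<Rightarrow> ('d forest \<Rightarrow>\<^sub>0 real) ^ 'k \<Rightarrow> real ^ 'k" where
  "vcoeff f x = (\<chi> i. coeff f (x $ i))"

definition proj_le :: "nat \<Rightarrow> ('d forest \<Rightarrow>\<^sub>0 real) \<Rightarrow> ('d forest \<Rightarrow>\<^sub>0 real)" where
  "proj_le n = lin_ext (\<lambda>f. if fvert f \<le> n then of_forest f else 0)"

definition id_graft ::
    "'d \<Rightarrow> (('d forest \<times> 'd forest) \<Rightarrow>\<^sub>0 real) \<Rightarrow> (('d forest \<times> 'd forest) \<Rightarrow>\<^sub>0 real)" where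
  "id_graft \<mu> = lin_ext (\<lambda>(f, g). Poly_Mapping.single (f, {#Node \<mu> g#}) 1)"

primrec coprod_tree :: "'d rtree \<Rightarrow> (('d forest \<times> 'd forest) \<Rightarrow>\<^sub>0 real)" where
  "coprod_tree (Node \<mu> f) =
     Poly_Mapping.single ({#Node \<mu> f#}, {#}) 1 +
     id_graft \<mu> (\<Prod>\<^sub># (image_mset coprod_tree f))"

definition coprod :: "('d forest \<Rightarrow>\<^sub>0 real) \<Rightarrow> (('d forest \<times> 'd forest) \<Rightarrow>\<^sub>0 real)" where
  "coprod = lin_ext (\<lambda>f. \<Prod>\<^sub># (image_mset coprod_tree f))"

text \<open>The pairing $\langle \phi\otimes\psi, z\rangle$ for functionals $\phi,\psi$.\<close>

definition tensor_pair ::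
    "(('d forest \<Rightarrow>\<^sub>0 real) \<Rightarrow> real) \<Rightarrow> (('d forest \<Rightarrow>\<^sub>0 real) \<Rightarrow> real) \<Rightarrow>
     (('d forest \<times> 'd forest) \<Rightarrow>\<^sub>0 real) \<Rightarrow> real" where
  "tensor_pair \<phi> \<psi> z = (\<Sum>(f, g)\<in>Poly_Mapping.keys z.
      Poly_Mapping.lookup z (f, g) * \<phi> (of_forest f) * \<psi> (of_forest g))"

text \<open>
  Characters live on the subalgebra \<open>span_of (forests N)\<close>; values of a function outside
  this subalgebra are unconstrained.
\<close>

definition characters :: "nat \<Rightarrow> (('d forest \<Rightarrow>\<^sub>0 real) \<Rightarrow> real) set" where
  "characters N = {\<phi>. \<phi> 1 = 1 \<and>
     (\<forall>c. \<forall>x\<in>span_of (forests N). \<phi> (pscale c x) = c * \<phi> x) \<and>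
     (\<forall>x\<in>span_of (forests N). \<forall>y\<in>span_of (forests N).
        \<phi> (x + y) = \<phi> x + \<phi> y \<and> \<phi> (x * y) = \<phi> x * \<phi> y)}"

definition rough_path ::
    "real \<Rightarrow> nat \<Rightarrow> (real \<Rightarrow> real \<Rightarrow> ('d forest \<Rightarrow>\<^sub>0 real) \<Rightarrow> real) \<Rightarrow> bool" where
  "rough_path \<alpha> N X \<longleftrightarrow>
     (\<forall>s\<in>{0..1}. \<forall>t\<in>{0..1}. X s t \<in> characters N) \<and>
     (\<forall>s\<in>{0..1}. \<forall>u\<in>{0..1}. \<forall>t\<in>{0..1}. \<forall>h\<in>trees1_le N.
        tensor_pair (X s u) (X u t) (coprod (of_forest h)) = X s t (of_forest h)) \<and>
     (\<forall>h\<in>trees_le N. bdd_above {\<bar>X s t (of_forest {#h#})\<bar> * \<bar>s - t\<bar> powr (- \<alpha> * real (nvert h))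
        | s t. s \<in> {0..1} \<and> t \<in> {0..1} \<and> s \<noteq> t})"

text \<open>
  \<open>nderiv g [v\<^sub>1, \<dots>, v\<^sub>p] y\<close> is $D^p g(y)[v_1,\dots,v_p]$.
\<close>

primrec nderiv ::
    "('a::real_normed_vector \<Rightarrow> 'b::real_normed_vector) \<Rightarrow> 'a list \<Rightarrow> 'a \<Rightarrow> 'b" where
  "nderiv g [] = g"
| "nderiv g (v # vs) = (\<lambda>y. frechet_derivative (nderiv g vs) (at y) v)"

text \<open>
  $D^{p} g(y)$ applied to a family of $p$ vectors, given as a multiset.  The enumeration
  chosen is irrelevant whenever $g$ is of class $C^p$, because $D^pg(y)$ is then symmetric.
\<close>

definition mderiv ::
    "('a::real_normed_vector \<Rightarrow> 'b::real_normed_vector) \<Rightarrow> 'a multiset \<Rightarrow> 'a \<Rightarrow> 'b" where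
  "mderiv g V y = nderiv g (SOME vs. mset vs = V) y"

text \<open>
  Class $C^n$ on the whole (finite-dimensional) space.  Continuity of $y \mapsto Dg(y)v$ for
  each $v$ is, in finite dimension, the same as continuity of $Dg$ in operator norm.
\<close>

primrec C_class ::
    "nat \<Rightarrow> ('a::euclidean_space \<Rightarrow> 'b::real_normed_vector) \<Rightarrow> bool" where
  "C_class 0 g \<longleftrightarrow> continuous_on UNIV g"
| "C_class (Suc n) g \<longleftrightarrow> (\<forall>y. g differentiable (at y)) \<and>
     (\<forall>v. C_class n (\<lambda>y. frechet_derivative g (at y) v))"

definition tree_path :: "nat \<Rightarrow> (real \<Rightarrow> ('d forest \<Rightarrow>\<^sub>0 real) ^ 'k) \<Rightarrow> bool" where
  "tree_path N Y \<longleftrightarrow> (\<forall>s\<in>{0..1}. \<forall>i. Y s $ i \<in> span_of (trees1_le (N - 1)))"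

definition base :: "(real \<Rightarrow> ('d forest \<Rightarrow>\<^sub>0 real) ^ 'k) \<Rightarrow> real \<Rightarrow> real ^ 'k" where
  "base Y s = vcoeff {#} (Y s)"

definition remainder ::
    "(real \<Rightarrow> real \<Rightarrow> ('d forest \<Rightarrow>\<^sub>0 real) \<Rightarrow> real) \<Rightarrow> (real \<Rightarrow> ('d forest \<Rightarrow>\<^sub>0 real) ^ 'k) \<Rightarrow>
     'd forest \<Rightarrow> real \<Rightarrow> real \<Rightarrow> real ^ 'k" where
  "remainder X Y f s t =
     vcoeff f (Y t) - (\<chi> i. tensor_pair (X s t) (coeff f) (coprod (Y s $ i)))"

definition compose_path ::
    "nat \<Rightarrow> (real ^ 'k \<Rightarrow> real ^ 'k) \<Rightarrow> (real \<Rightarrow> ('d forest \<Rightarrow>\<^sub>0 real) ^ 'k) \<Rightarrow>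
     (real \<Rightarrow> ('d forest \<Rightarrow>\<^sub>0 real) ^ 'k)" where
  "compose_path N g Y s = (\<chi> i.
     pscale (g (base Y s) $ i) 1 +
     proj_le (N - 1)
       (\<Sum>p = 1..N - 1. pscale (1 / fact p)
         (\<Sum>hs\<in>{hs. set hs \<subseteq> trees_le (N - 1) \<and> length hs = p}.
           pscale (nderiv g (map (\<lambda>h. vcoeff {#h#} (Y s)) hs) (base Y s) $ i)
             (of_forest (mset hs)))))"

definition coherent ::
    "nat \<Rightarrow> ('d \<Rightarrow> real ^ 'k \<Rightarrow> real ^ 'k) \<Rightarrow> (real \<Rightarrow> ('d forest \<Rightarrow>\<^sub>0 real) ^ 'k) \<Rightarrow> bool" where
  "coherent N \<sigma> Y \<longleftrightarrow> (\<forall>\<mu> f. Node \<mu> f \<in> trees_le (N - 1) \<longrightarrow>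
     (\<forall>s\<in>{0<..1}. vcoeff f (compose_path N (\<sigma> \<mu>) Y s) = vcoeff {#Node \<mu> f#} (Y s)))"

text \<open>\<open>elem_diff \<sigma> (Node \<mu> f)\<close> is $\Upsilon[[f]_\mu] = \Upsilon_\mu[f]$.\<close>

primrec elem_diff ::
    "('d \<Rightarrow> 'a::real_normed_vector \<Rightarrow> 'a) \<Rightarrow> 'd rtree \<Rightarrow> 'a \<Rightarrow> 'a" where
  "elem_diff \<sigma> (Node \<mu> f) =
     (\<lambda>y. mderiv (\<sigma> \<mu>) (image_mset (\<lambda>F. F y) (image_mset (elem_diff \<sigma>) f)) y)"

definition err ::
    "nat \<Rightarrow> ('d \<Rightarrow> real ^ 'k \<Rightarrow> real ^ 'k) \<Rightarrow> (real \<Rightarrow> real \<Rightarrow> ('d forest \<Rightarrow>\<^sub>0 real) \<Rightarrow> real) \<Rightarrow>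
     (real \<Rightarrow> ('d forest \<Rightarrow>\<^sub>0 real) ^ 'k) \<Rightarrow> real \<Rightarrow> real \<Rightarrow> real" where
  "err N \<sigma> X Y s t =
     (\<Sum>h\<in>trees_le (N - 1). norm (X s t (of_forest {#h#}) *\<^sub>R elem_diff \<sigma> h (base Y s)))"

text \<open>The supremum over the empty set is 0; only used for sets of nonnegative reals.\<close>

definition sup0 :: "real set \<Rightarrow> real" where
  "sup0 S = (if S = {} then 0 else Sup S)"

end

theory Submission
  imports Defs "HOL-Combinatorics.Multiset_Permutations"
begin

text \<open>
  Write \<open>W\<^sub>h\<close> for the elementary differential of the tree \<open>h\<close> divided by the symmetry factor of \<open>h\<close>.
  Coherence forces the coefficient of \<open>Y\<^sub>s\<close> at \<open>h\<close> to be \<open>W\<^sub>h(Y\<^sub>s)\<close>, and the coefficient of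
  \<open>\<sigma>\<^sub>\<mu>(Y)\<^sub>s\<close> at \<open>f\<close> to be \<open>W(Y\<^sub>s)\<close>, where \<open>W\<close> belongs to the tree \<open>[f]\<^sub>\<mu>\<close>
  (\<open>coherent_coeff\<close>, \<open>vcoeff_compose_coherent\<close>).

  The algebraic heart is the lemma \<open>grafting\<close>: summing, over all forests \<open>g\<close>, the coefficient of
  \<open>\<sigma>\<^sub>\<mu>(Y)\<^sub>s\<close> at \<open>g\<close> times the coefficient of \<open>m \<otimes> f\<close> in the coproduct of \<open>g\<close> gives the term
  of index \<open>m\<close> in the Taylor series of \<open>W\<close> at \<open>Y\<^sub>s\<close>, taken in the directions \<open>W\<^sub>h(Y\<^sub>s)\<close>.  A
  character is multiplicative on forests, so its values can be absorbed into the directions.  The remainder at \<open>f\<close>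
  therefore is \<open>W(Y\<^sub>t)\<close> minus a Taylor polynomial of \<open>W\<close> at \<open>Y\<^sub>s\<close> in the displacement
  \<open>\<Sum>\<^sub>h \<langle>X\<^sub>s\<^sub>,\<^sub>t, h\<rangle> W\<^sub>h(Y\<^sub>s)\<close>, truncated to the multi-indices \<open>m\<close> with fewer than
  \<open>N - |f|\<close> vertices (\<open>remainder_compose_coherent\<close>).

  The rest is calculus.  If \<open>z\<close> is the end point of this displacement, then \<open>Y\<^sub>t - z\<close> is the remainder of
  \<open>Y\<close> at the empty forest, which accounts for \<open>W(Y\<^sub>t) - W(z)\<close>.  The multi-indices of the
  polynomial form a lower set, so by \<open>taylor_lower_set\<close> its distance from \<open>W(z)\<close> is controlled by the
  derivatives of \<open>W\<close> on the boundary of that set.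

  Throughout, iterated derivatives are treated as symmetric multilinear forms.  Their symmetry, which rests on
  the equality of mixed second derivatives, is proved first.
\<close>

section \<open>Iterated directional derivatives\<close>

definition dirder :: "('a::real_normed_vector \<Rightarrow> 'b::real_normed_vector) \<Rightarrow> 'a \<Rightarrow> 'a \<Rightarrow> 'b" where
  "dirder g v y = frechet_derivative g (at y) v"

lemma has_derivative_dirder:
  "g differentiable (at y) \<Longrightarrow> (g has_derivative (\<lambda>v. dirder g v y)) (at y)"
  unfolding dirder_def using frechet_derivative_works by blast

lemma dirder_eq: "(g has_derivative g') (at y) \<Longrightarrow> dirder g v y = g' v"
  by (simp add: dirder_def frechet_derivative_at[symmetric])

lemma linear_dirder: "g differentiable (at y) \<Longrightarrow> linear (\<lambda>v. dirder g v y)"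
  using has_derivative_dirder has_derivative_linear by blast

lemma dirder_scale: "g differentiable (at y) \<Longrightarrow> dirder g (c *\<^sub>R v) y = c *\<^sub>R dirder g v y"
  using linear_cmul[OF linear_dirder] .

lemma dirder_sum_direction:
  "g differentiable (at y) \<Longrightarrow> dirder g (\<Sum>i\<in>I. v i) y = (\<Sum>i\<in>I. dirder g (v i) y)"
  using linear_sum[OF linear_dirder] .

lemma mean_value_along_line:
  fixes G :: "'a::real_normed_vector \<Rightarrow> real"
  assumes "\<And>y. G differentiable (at y)" and "0 < h"
  obtains \<xi> where "0 < \<xi>" "\<xi> < h" "G (y + h *\<^sub>R v) - G y = h * dirder G v (y + \<xi> *\<^sub>R v)"
proof -
  have der: "((\<lambda>s. G (y + s *\<^sub>R v)) has_derivative (\<lambda>r. r * dirder G v (y + s *\<^sub>R v))) (at s)" for s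
  proof -
    have "((\<lambda>s. y + s *\<^sub>R v) has_derivative (\<lambda>r. r *\<^sub>R v)) (at s)"
      by (auto intro!: derivative_eq_intros)
    from has_derivative_compose[OF this has_derivative_dirder[OF assms(1)]]
    show ?thesis by (simp add: dirder_scale[OF assms(1)])
  qed
  have "\<exists>x\<in>{0<..<h}. G (y + h *\<^sub>R v) - G (y + 0 *\<^sub>R v) = (h - 0) * dirder G v (y + x *\<^sub>R v)"
    by (rule mvt_simple[OF assms(2)]) (rule has_derivative_at_withinI[OF der])
  then show ?thesis using that by auto
qed

lemma dirder_inner:
  fixes g :: "'a::real_normed_vector \<Rightarrow> 'b::real_inner"
  assumes "g differentiable (at y)"
  shows "(\<lambda>y. g y \<bullet> b) differentiable (at y)"
    and "dirder (\<lambda>y. g y \<bullet> b) v y = dirder g v y \<bullet> b"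
proof -
  have "((\<lambda>y. g y \<bullet> b) has_derivative (\<lambda>v. dirder g v y \<bullet> b)) (at y)"
    using has_derivative_inner_left[OF has_derivative_dirder[OF assms]] .
  then show "(\<lambda>y. g y \<bullet> b) differentiable (at y)"
    and "dirder (\<lambda>y. g y \<bullet> b) v y = dirder g v y \<bullet> b"
    by (auto simp: differentiable_def dirder_eq)
qed

text \<open>The second difference of \<open>G\<close> over a parallelogram is, by two applications of the mean value
  theorem, a value of the mixed derivative nearby; its symmetry in the two sides is what
  makes the mixed derivatives agree.\<close>

lemma second_difference:
  fixes G :: "'a::real_normed_vector \<Rightarrow> real"
  assumes "\<And>y. G differentiable (at y)" "\<And>y. dirder G v differentiable (at y)" and h: "0 < h"
  obtains z where "norm (z - y) \<le> h * (norm v + norm w)"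
    "G (y + h *\<^sub>R v + h *\<^sub>R w) - G (y + h *\<^sub>R v) - G (y + h *\<^sub>R w) + G y = h * h * dirder (dirder G v) w z"
proof -
  define K where "K = (\<lambda>z. G (z + h *\<^sub>R w) - G z)"
  have sh: "((\<lambda>z. G (z + h *\<^sub>R w)) has_derivative (\<lambda>u. dirder G u (z + h *\<^sub>R w))) (at z)" for z
  proof -
    have "((\<lambda>z. z + h *\<^sub>R w) has_derivative (\<lambda>u. u)) (at z)" by (auto intro!: derivative_eq_intros)
    from has_derivative_compose[OF this] show ?thesis using has_derivative_dirder[OF assms(1)] .
  qed
  have Kd: "(K has_derivative (\<lambda>u. dirder G u (z + h *\<^sub>R w) - dirder G u z)) (at z)" for z
    unfolding K_def using has_derivative_diff[OF sh has_derivative_dirder[OF assms(1)]] .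
  then have "K differentiable (at z)" for z using differentiable_def by blast
  from mean_value_along_line[OF this h, of y v] obtain \<xi> where \<xi>: "0 < \<xi>" "\<xi> < h"
    "K (y + h *\<^sub>R v) - K y = h * dirder K v (y + \<xi> *\<^sub>R v)" by blast
  have Kv: "dirder K v (y + \<xi> *\<^sub>R v) = dirder G v (y + \<xi> *\<^sub>R v + h *\<^sub>R w) - dirder G v (y + \<xi> *\<^sub>R v)"
    by (simp add: dirder_eq[OF Kd])
  from mean_value_along_line[OF assms(2) h, of "y + \<xi> *\<^sub>R v" w] obtain \<eta> where \<eta>: "0 < \<eta>" "\<eta> < h"
    "dirder G v (y + \<xi> *\<^sub>R v + h *\<^sub>R w) - dirder G v (y + \<xi> *\<^sub>R v)
      = h * dirder (dirder G v) w (y + \<xi> *\<^sub>R v + \<eta> *\<^sub>R w)" by blast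
  have "norm (y + \<xi> *\<^sub>R v + \<eta> *\<^sub>R w - y) \<le> \<xi> * norm v + \<eta> * norm w"
    using norm_triangle_ineq[of "\<xi> *\<^sub>R v" "\<eta> *\<^sub>R w"] \<xi> \<eta> by simp
  also have "\<dots> \<le> h * norm v + h * norm w"
    using \<xi> \<eta> by (intro add_mono mult_right_mono) auto
  finally have "norm (y + \<xi> *\<^sub>R v + \<eta> *\<^sub>R w - y) \<le> h * (norm v + norm w)" by (simp add: algebra_simps)
  moreover have "G (y + h *\<^sub>R v + h *\<^sub>R w) - G (y + h *\<^sub>R v) - G (y + h *\<^sub>R w) + G y
      = h * h * dirder (dirder G v) w (y + \<xi> *\<^sub>R v + \<eta> *\<^sub>R w)"
    using \<xi>(3) Kv \<eta>(3) by (simp add: K_def)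
  ultimately show ?thesis using that by blast
qed

text \<open>Two distinct mixed derivatives at \<open>y\<close> would, by continuity, still differ near \<open>y\<close>, whereas the
  second difference over a small parallelogram is a nearby value of each of them.\<close>

lemma dirder_commute_real:
  fixes G :: "'a::real_normed_vector \<Rightarrow> real"
  assumes "\<And>y. G differentiable (at y)"
    and "\<And>v y. dirder G v differentiable (at y)"
    and "\<And>v w. continuous_on UNIV (dirder (dirder G v) w)"
  shows "dirder (dirder G v) w y = dirder (dirder G w) v y"
proof (rule ccontr)
  define a where "a = dirder (dirder G v) w y"
  define b where "b = dirder (dirder G w) v y"
  assume "dirder (dirder G v) w y \<noteq> dirder (dirder G w) v y"
  then have e: "0 < \<bar>a - b\<bar> / 2" by (simp add: a_def b_def)
  have near: "\<exists>d>0. \<forall>z. norm (z - y) < d \<longrightarrow> \<bar>dirder (dirder G v) w z - dirder (dirder G v) w y\<bar> < \<bar>a - b\<bar> / 2" for v w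
    using assms(3)[of v w, unfolded continuous_on_iff dist_norm real_norm_def, rule_format, OF UNIV_I e]
    by simp
  obtain d1 where d1: "d1 > 0" "\<And>z. norm (z - y) < d1 \<Longrightarrow> \<bar>dirder (dirder G v) w z - a\<bar> < \<bar>a - b\<bar> / 2"
    using near[of v w] a_def by blast
  obtain d2 where d2: "d2 > 0" "\<And>z. norm (z - y) < d2 \<Longrightarrow> \<bar>dirder (dirder G w) v z - b\<bar> < \<bar>a - b\<bar> / 2"
    using near[of w v] b_def by blast
  \<comment> \<open>a scale at which every point given by the mean value theorem is within \<open>d1\<close> and \<open>d2\<close> of \<open>y\<close>\<close>
  define h where "h = min d1 d2 / (norm v + norm w + 1)"
  have pos: "0 < norm v + norm w + 1" using norm_ge_zero[of v] norm_ge_zero[of w] by linarith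
  have h: "0 < h" unfolding h_def using d1 d2 pos by simp
  have "h * (norm v + norm w + 1) = min d1 d2" unfolding h_def using pos by simp
  then have hh: "h * (norm v + norm w) < d1" "h * (norm v + norm w) < d2"
    using h by (auto simp: algebra_simps)
  obtain z1 where z1: "norm (z1 - y) \<le> h * (norm v + norm w)"
    "G (y + h *\<^sub>R v + h *\<^sub>R w) - G (y + h *\<^sub>R v) - G (y + h *\<^sub>R w) + G y = h * h * dirder (dirder G v) w z1"
    using second_difference[OF assms(1,2) h, of y v w] by blast
  obtain z2 where z2: "norm (z2 - y) \<le> h * (norm w + norm v)"
    "G (y + h *\<^sub>R w + h *\<^sub>R v) - G (y + h *\<^sub>R w) - G (y + h *\<^sub>R v) + G y = h * h * dirder (dirder G w) v z2"
    using second_difference[OF assms(1,2) h, of y w v] by blast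
  have "h * h * dirder (dirder G v) w z1 = h * h * dirder (dirder G w) v z2"
    using z1(2) z2(2) by (simp add: algebra_simps)
  then have "dirder (dirder G v) w z1 = dirder (dirder G w) v z2" using h by simp
  moreover have "\<bar>dirder (dirder G v) w z1 - a\<bar> < \<bar>a - b\<bar> / 2"
    using d1(2) z1(1) hh by simp
  moreover have "\<bar>dirder (dirder G w) v z2 - b\<bar> < \<bar>a - b\<bar> / 2"
    using d2(2) z2(1) hh by (simp add: add.commute)
  moreover have "\<bar>a - b\<bar> \<le> \<bar>x - a\<bar> + \<bar>x - b\<bar>" for x :: real
    using abs_triangle_ineq4[of "x - b" "x - a"] by simp
  from this[of "dirder (dirder G v) w z1"]
  have "\<bar>a - b\<bar> \<le> \<bar>dirder (dirder G v) w z1 - a\<bar> + \<bar>dirder (dirder G v) w z1 - b\<bar>" .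
  ultimately show False by simp
qed

lemma C_class_Suc:
  "C_class (Suc n) g \<longleftrightarrow> (\<forall>y. g differentiable (at y)) \<and> (\<forall>v. C_class n (dirder g v))"
  by (simp add: dirder_def[abs_def])

declare C_class.simps(2)[simp del]

lemma C_class_imp_differentiable: "C_class (Suc n) g \<Longrightarrow> g differentiable (at y)"
  by (simp add: C_class_Suc)

lemma C_class_dirder: "C_class (Suc n) g \<Longrightarrow> C_class n (dirder g v)"
  by (simp add: C_class_Suc)

lemma nderiv_Cons: "nderiv g (v # vs) = dirder (nderiv g vs) v"
  by (simp add: dirder_def[abs_def])

declare nderiv.simps(2)[simp del]

lemma C_class_0I: "C_class (Suc n) g \<Longrightarrow> C_class 0 g"
  by (simp add: C_class_Suc continuous_on_eq_continuous_within differentiable_imp_continuous_within)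

lemma C_class_SucD: "C_class (Suc n) g \<Longrightarrow> C_class n g"
proof (induction n arbitrary: g)
  case 0
  then show ?case using C_class_0I by blast
next
  case (Suc n)
  then show ?case by (subst C_class_Suc) (simp add: C_class_dirder C_class_imp_differentiable)
qed

lemma C_class_mono: "m \<le> n \<Longrightarrow> C_class n g \<Longrightarrow> C_class m g"
  by (induction n rule: dec_induct) (auto dest: C_class_SucD)

lemma C_class_continuous: "C_class n g \<Longrightarrow> continuous_on UNIV g"
  using C_class_mono[of 0 n g] by simp

lemma dirder_commute:
  fixes g :: "'a::euclidean_space \<Rightarrow> 'b::euclidean_space"
  assumes "C_class (Suc (Suc n)) g"
  shows "dirder (dirder g v) w = dirder (dirder g w) v"
proof (rule ext, rule euclidean_eqI)
  fix y and b :: 'b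
  note d1 = C_class_imp_differentiable[OF assms]
  note d2 = C_class_imp_differentiable[OF C_class_dirder[OF assms]]
  note c = C_class_continuous[OF C_class_dirder[OF C_class_dirder[OF assms]]]
  have 1: "dirder (\<lambda>y. g y \<bullet> b) u = (\<lambda>y. dirder g u y \<bullet> b)" for u
    by (rule ext) (rule dirder_inner(2)[OF d1])
  have 2: "dirder (dirder (\<lambda>y. g y \<bullet> b) u) u' = (\<lambda>y. dirder (dirder g u) u' y \<bullet> b)" for u u'
    unfolding 1 by (rule ext) (rule dirder_inner(2)[OF d2])
  have "dirder (dirder (\<lambda>y. g y \<bullet> b) v) w y = dirder (dirder (\<lambda>y. g y \<bullet> b) w) v y"
  proof (rule dirder_commute_real)
    show "(\<lambda>y. g y \<bullet> b) differentiable (at y)" for y using dirder_inner(1)[OF d1] .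
    show "dirder (\<lambda>y. g y \<bullet> b) v differentiable (at y)" for v y
      unfolding 1 using dirder_inner(1)[OF d2] .
    show "continuous_on UNIV (dirder (dirder (\<lambda>y. g y \<bullet> b) v) w)" for v w
      unfolding 2 by (intro continuous_intros c)
  qed
  then show "dirder (dirder g v) w y \<bullet> b = dirder (dirder g w) v y \<bullet> b" unfolding 2 by simp
qed


lemma nderiv_append: "nderiv g (us @ vs) = nderiv (nderiv g vs) us"
  by (induction us) (auto simp: nderiv_Cons)

lemma C_class_nderiv: "C_class (n + length vs) g \<Longrightarrow> C_class n (nderiv g vs)"
proof (induction vs arbitrary: n)
  case (Cons v vs)
  then have "C_class (Suc n) (nderiv g vs)" using Cons.IH[of "Suc n"] by simp
  then show ?case by (simp add: nderiv_Cons C_class_dirder)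
qed simp

lemma nderiv_differentiable:
  "C_class (Suc (length vs)) g \<Longrightarrow> nderiv g vs differentiable (at y)"
  using C_class_nderiv[of "Suc 0" vs g] C_class_imp_differentiable by simp

text \<open>Adjacent directions commute by the symmetry of second derivatives, so that a direction can be
  moved past all the others.  This is what makes \<^const>\<open>mderiv\<close> independent of the enumeration
  it chooses.\<close>

lemma nderiv_move_front:
  fixes g :: "'a::euclidean_space \<Rightarrow> 'b::euclidean_space"
  assumes "C_class (Suc (length us + length vs)) g"
  shows "nderiv g (us @ v # vs) = nderiv g (v # us @ vs)"
  using assms
proof (induction us)
  case (Cons u us)
  have "C_class (Suc (length us + length vs)) g" using Cons.prems C_class_SucD by simp
  from Cons.IH[OF this] have "nderiv g ((u # us) @ v # vs) = dirder (dirder (nderiv g (us @ vs)) v) u"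
    by (simp add: nderiv_Cons)
  moreover have "C_class (Suc (Suc 0)) (nderiv g (us @ vs))"
    using Cons.prems by (intro C_class_nderiv) simp
  ultimately show ?case by (simp add: nderiv_Cons dirder_commute)
qed simp

lemma nderiv_cong_mset:
  fixes g :: "'a::euclidean_space \<Rightarrow> 'b::euclidean_space"
  assumes "C_class (length vs) g" "mset vs = mset vs'"
  shows "nderiv g vs = nderiv g vs'"
  using assms
proof (induction vs arbitrary: vs')
  case (Cons v vs)
  then have "v \<in> set vs'" by (metis list.set_intros(1) mset_eq_setD)
  then obtain us ws where vs': "vs' = us @ v # ws" using split_list by metis
  then have "mset vs = mset (us @ ws)" using Cons.prems(2) by simp
  moreover have "C_class (length vs) g" using Cons.prems(1) C_class_SucD by simp
  ultimately have "nderiv g vs = nderiv g (us @ ws)" using Cons.IH by blast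
  then have "nderiv g (v # vs) = nderiv g (v # us @ ws)" by (simp add: nderiv_Cons)
  also have "length (v # vs) = Suc (length us + length ws)"
    using \<open>mset vs = mset (us @ ws)\<close> mset_eq_length by fastforce
  then have "nderiv g (v # us @ ws) = nderiv g vs'"
    unfolding vs' using nderiv_move_front Cons.prems(1) by metis
  finally show ?case .
qed simp

lemma mderiv_mset:
  fixes g :: "'a::euclidean_space \<Rightarrow> 'b::euclidean_space"
  assumes "C_class (length vs) g"
  shows "mderiv g (mset vs) y = nderiv g vs y"
proof -
  have "mset (SOME us. mset us = mset vs) = mset vs" by (rule someI[of _ vs]) simp
  then show ?thesis
    unfolding mderiv_def by (metis nderiv_cong_mset assms)
qed

lemma mderiv_empty [simp]: "mderiv g {#} = g"
  by (rule ext) (simp add: mderiv_def)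

lemma mderiv_add_mset:
  fixes g :: "'a::euclidean_space \<Rightarrow> 'b::euclidean_space"
  assumes "C_class (Suc (size V)) g"
  shows "mderiv g (add_mset v V) = dirder (mderiv g V) v"
proof -
  obtain vs where V: "V = mset vs" by (metis ex_mset)
  have "mderiv g (mset (v # vs)) = nderiv g (v # vs)"
    by (rule ext) (rule mderiv_mset, use assms V in simp)
  moreover have "mderiv g (mset vs) = nderiv g vs"
    by (rule ext) (rule mderiv_mset, use assms V C_class_SucD in simp)
  ultimately show ?thesis by (simp add: V nderiv_Cons)
qed

lemma C_class_mderiv:
  fixes g :: "'a::euclidean_space \<Rightarrow> 'b::euclidean_space"
  assumes "C_class (n + size V) g"
  shows "C_class n (mderiv g V)"
proof -
  obtain vs where V: "V = mset vs" by (metis ex_mset)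
  have "mderiv g (mset vs) = nderiv g vs"
    by (rule ext) (rule mderiv_mset, use assms V C_class_mono[of "length vs" "n + length vs" g] in simp)
  then show ?thesis using C_class_nderiv[of n vs g] assms by (simp add: V)
qed

lemma mderiv_differentiable:
  fixes g :: "'a::euclidean_space \<Rightarrow> 'b::euclidean_space"
  assumes "C_class (Suc (size V)) g"
  shows "mderiv g V differentiable (at y)"
  using C_class_mderiv[of "Suc 0" V g] C_class_imp_differentiable assms by simp

section \<open>Closure properties of the classes of continuously differentiable functions\<close>

lemma dirder_add:
  assumes "f differentiable (at y)" "g differentiable (at y)"
  shows "dirder (\<lambda>y. f y + g y) v y = dirder f v y + dirder g v y"
  using dirder_eq[OF has_derivative_add[OF has_derivative_dirder has_derivative_dirder]] assms by blast

lemma dirder_scaleR: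
  fixes f :: "'a::real_normed_vector \<Rightarrow> real"
  assumes "f differentiable (at y)" "g differentiable (at y)"
  shows "dirder (\<lambda>y. f y *\<^sub>R g y) v y = f y *\<^sub>R dirder g v y + dirder f v y *\<^sub>R g y"
  using dirder_eq[OF has_derivative_scaleR[OF has_derivative_dirder has_derivative_dirder]] assms by blast

lemma dirder_const [simp]: "dirder (\<lambda>y. c) v = (\<lambda>y. 0)"
  by (rule ext) (simp add: dirder_eq[OF has_derivative_const])

lemma dirder_sum:
  assumes "\<And>i. i \<in> I \<Longrightarrow> f i differentiable (at y)"
  shows "dirder (\<lambda>y. \<Sum>i\<in>I. f i y) v y = (\<Sum>i\<in>I. dirder (f i) v y)"
  by (rule dirder_eq, rule has_derivative_sum) (use assms has_derivative_dirder in blast)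

lemma C_class_const [simp]: "C_class n (\<lambda>y. c)"
proof (induction n arbitrary: c)
  case (Suc n)
  then show ?case by (simp add: C_class_Suc)
qed simp

lemma C_class_add: "C_class n f \<Longrightarrow> C_class n g \<Longrightarrow> C_class n (\<lambda>y. f y + g y)"
proof (induction n arbitrary: f g)
  case 0
  then show ?case by (simp add: continuous_on_add)
next
  case (Suc n)
  then have "dirder (\<lambda>y. f y + g y) v = (\<lambda>y. dirder f v y + dirder g v y)" for v
    by (intro ext dirder_add) (auto simp: C_class_Suc)
  then show ?case using Suc by (simp add: C_class_Suc)
qed

lemma C_class_sum: "(\<And>i. i \<in> I \<Longrightarrow> C_class n (f i)) \<Longrightarrow> C_class n (\<lambda>y. \<Sum>i\<in>I. f i y)"
  by (induction I rule: infinite_finite_induct) (auto intro: C_class_add)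

lemma C_class_scaleR:
  fixes f :: "'a::euclidean_space \<Rightarrow> real"
  shows "C_class n f \<Longrightarrow> C_class n g \<Longrightarrow> C_class n (\<lambda>y. f y *\<^sub>R g y)"
proof (induction n arbitrary: f g)
  case 0
  then show ?case by (simp add: continuous_on_scaleR)
next
  case (Suc n)
  then have "dirder (\<lambda>y. f y *\<^sub>R g y) v = (\<lambda>y. f y *\<^sub>R dirder g v y + dirder f v y *\<^sub>R g y)" for v
    by (intro ext dirder_scaleR) (auto simp: C_class_Suc)
  moreover have "C_class n (\<lambda>y. f y *\<^sub>R dirder g v y + dirder f v y *\<^sub>R g y)" for v
    using Suc.prems by (intro C_class_add Suc.IH) (auto intro: C_class_dirder C_class_SucD)
  moreover have "(\<lambda>y. f y *\<^sub>R g y) differentiable (at y)" for y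
    using Suc.prems by (simp add: C_class_Suc)
  ultimately show ?case by (simp add: C_class_Suc)
qed

lemma C_class_inner:
  fixes g :: "'a::euclidean_space \<Rightarrow> 'b::real_inner"
  shows "C_class n g \<Longrightarrow> C_class n (\<lambda>y. g y \<bullet> b)"
proof (induction n arbitrary: g)
  case 0
  then show ?case by (simp add: continuous_on_inner)
next
  case (Suc n)
  then have "dirder (\<lambda>y. g y \<bullet> b) v = (\<lambda>y. dirder g v y \<bullet> b)" for v
    by (intro ext dirder_inner) (auto simp: C_class_Suc)
  moreover have "(\<lambda>y. g y \<bullet> b) differentiable (at y)" for y
    using Suc.prems by (intro dirder_inner) (simp add: C_class_Suc)
  ultimately show ?case using Suc by (simp add: C_class_Suc)
qed

section \<open>Multilinearity and the Leibniz rule\<close>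

lemma dirder_cmul:
  "g differentiable (at y) \<Longrightarrow> dirder (\<lambda>y. c *\<^sub>R g y) v y = c *\<^sub>R dirder g v y"
  using dirder_scaleR[of "\<lambda>y. c" y g v] by simp

text \<open>The linear change of directions that turns a sum over lists of trees into a sum over lists of
  cuts, with the coefficients of the coproduct as its matrix.\<close>

lemma nderiv_multilinear:
  fixes g :: "'a::real_normed_vector \<Rightarrow> 'b::real_normed_vector"
  assumes "finite T"
  shows "(\<And>us y. length us \<le> length cs \<Longrightarrow> nderiv g us differentiable (at y)) \<Longrightarrow>
    nderiv g (map (\<lambda>c. \<Sum>h\<in>T. a h c *\<^sub>R w h) cs) y =
      (\<Sum>hs\<in>{hs. set hs \<subseteq> T \<and> length hs = length cs}.
        prod_list (map2 a hs cs) *\<^sub>R nderiv g (map w hs) y)"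
proof (induction cs arbitrary: y)
  case Nil
  have "{hs :: 'c list. set hs \<subseteq> T \<and> hs = []} = {[]}" by auto
  then show ?case by simp
next
  case (Cons c cs)
  let ?L = "\<lambda>n. {hs. set hs \<subseteq> T \<and> length hs = n}"
  have diff: "nderiv g us differentiable (at y)" if "length us \<le> length cs" for us y
    using Cons.prems[of us] that by simp
  have IH: "nderiv g (map (\<lambda>c. \<Sum>h\<in>T. a h c *\<^sub>R w h) cs) =
      (\<lambda>y. \<Sum>hs\<in>?L (length cs). prod_list (map2 a hs cs) *\<^sub>R nderiv g (map w hs) y)"
    by (rule ext, rule Cons.IH) (rule diff)
  have fin: "finite (?L n)" for n using assms by (rule finite_lists_length_eq)
  have "nderiv g (map (\<lambda>c. \<Sum>h\<in>T. a h c *\<^sub>R w h) (c # cs)) y =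
      (\<Sum>h\<in>T. a h c *\<^sub>R dirder (nderiv g (map (\<lambda>c. \<Sum>h\<in>T. a h c *\<^sub>R w h) cs)) (w h) y)"
    by (simp add: nderiv_Cons dirder_sum_direction dirder_scale diff)
  also have "\<dots> = (\<Sum>h\<in>T. a h c *\<^sub>R (\<Sum>hs\<in>?L (length cs). prod_list (map2 a hs cs) *\<^sub>R nderiv g (w h # map w hs) y))"
    unfolding IH nderiv_Cons
    by (intro sum.cong arg_cong2[where f = scaleR] refl)
      (subst dirder_sum, auto intro!: sum.cong dirder_cmul diff differentiable_scaleR)
  also have "\<dots> = (\<Sum>(h, hs)\<in>T \<times> ?L (length cs). prod_list (map2 a (h # hs) (c # cs)) *\<^sub>R nderiv g (map w (h # hs)) y)"
    by (simp add: scaleR_sum_right sum.cartesian_product)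
  also have "\<dots> = (\<Sum>hs\<in>?L (length (c # cs)). prod_list (map2 a hs (c # cs)) *\<^sub>R nderiv g (map w hs) y)"
  proof (rule sum.reindex_bij_witness[where i = "\<lambda>hs. (hd hs, tl hs)" and j = "\<lambda>(h, hs). h # hs"])
    fix hs assume hs: "hs \<in> ?L (length (c # cs))"
    then obtain h hs' where "hs = h # hs'" by (cases hs) auto
    then show "(case (hd hs, tl hs) of (h, hs) \<Rightarrow> h # hs) = hs" "(hd hs, tl hs) \<in> T \<times> ?L (length cs)"
      using hs by auto
  qed auto
  finally show ?case .
qed

text \<open>Since the order is irrelevant, a direction may also be differentiated first.  Then it becomes
  part of the function, which the induction for the chain rule below needs.\<close>

lemma mderiv_add_mset':
  fixes g :: "'a::euclidean_space \<Rightarrow> 'b::euclidean_space"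
  assumes "C_class (Suc (size V)) g"
  shows "mderiv g (add_mset v V) = mderiv (dirder g v) V"
proof -
  obtain vs where V: "V = mset vs" by (metis ex_mset)
  have "mderiv g (mset (vs @ [v])) = nderiv g (vs @ [v])"
    by (rule ext) (rule mderiv_mset, use assms V in simp)
  also have "\<dots> = nderiv (dirder g v) vs" by (simp add: nderiv_append nderiv_Cons)
  also have "\<dots> = mderiv (dirder g v) (mset vs)"
    by (rule ext) (rule mderiv_mset[symmetric], use assms V C_class_dirder in simp)
  finally show ?thesis by (simp add: V)
qed

lemma mderiv_scale:
  fixes g :: "'a::euclidean_space \<Rightarrow> 'b::euclidean_space"
  assumes "C_class (size I) g"
  shows "mderiv g (image_mset (\<lambda>i. c i *\<^sub>R v i) I) y
    = (\<Prod>i\<in>#I. c i) *\<^sub>R mderiv g (image_mset v I) y"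
  using assms
proof (induction I arbitrary: y)
  case (add i I)
  have C: "C_class (Suc (size I)) g" using add.prems by simp
  have IH: "mderiv g (image_mset (\<lambda>i. c i *\<^sub>R v i) I)
      = (\<lambda>y. (\<Prod>i\<in>#I. c i) *\<^sub>R mderiv g (image_mset v I) y)"
    using add.IH C_class_SucD[OF C] by blast
  have d: "mderiv g (image_mset u I) differentiable (at y)" for u y
    using C by (intro mderiv_differentiable) simp
  show ?case
    using C d by (simp add: mderiv_add_mset dirder_scale IH[symmetric])
      (simp add: IH dirder_cmul mult.commute)
qed simp

lemma mderiv_add_mset_Basis:
  fixes g :: "'a::euclidean_space \<Rightarrow> 'b::euclidean_space"
  assumes "C_class (Suc (size V)) g"
  shows "mderiv g (add_mset v V) y = (\<Sum>b\<in>Basis. (v \<bullet> b) *\<^sub>R mderiv (dirder g b) V y)"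
proof -
  have d: "mderiv g V differentiable (at y)" by (rule mderiv_differentiable[OF assms])
  have "mderiv g (add_mset v V) y = dirder (mderiv g V) (\<Sum>b\<in>Basis. (v \<bullet> b) *\<^sub>R b) y"
    by (simp add: mderiv_add_mset[OF assms] euclidean_representation)
  also have "\<dots> = (\<Sum>b\<in>Basis. (v \<bullet> b) *\<^sub>R mderiv g (add_mset b V) y)"
    by (simp add: mderiv_add_mset[OF assms] dirder_sum_direction dirder_scale d)
  finally show ?thesis by (simp add: mderiv_add_mset'[OF assms])
qed

lemma C_class_mderiv_compose:
  fixes g :: "'a::euclidean_space \<Rightarrow> 'b::euclidean_space"
  assumes "C_class (n + size P) g" "\<And>i. i \<in># P \<Longrightarrow> C_class n (V i)"
  shows "C_class n (\<lambda>y. mderiv g (image_mset (\<lambda>i. V i y) P) y)"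
  using assms
proof (induction P arbitrary: g)
  case (add i P)
  have C: "C_class (Suc (size P)) g" using add.prems C_class_mono[of "Suc (size P)" "n + size (add_mset i P)" g] by auto
  have "C_class n (\<lambda>y. mderiv (dirder g b) (image_mset (\<lambda>i. V i y) P) y)" for b
    using add.prems by (intro add.IH C_class_dirder) auto
  then show ?case
    using C add.prems by (auto simp: mderiv_add_mset_Basis intro!: C_class_sum C_class_scaleR C_class_inner)
qed simp

text \<open>Expanding one of the arguments of \<open>D\<^sup>p g(y)[V\<^sub>1(y), \<dots>, V\<^sub>p(y)]\<close> in a basis moves it into the
  function \<open>g\<close>, so that the ordinary product rule suffices for the induction.\<close>

lemma dirder_mderiv_compose:
  fixes g :: "'a::euclidean_space \<Rightarrow> 'b::euclidean_space"
  assumes "C_class (Suc (size P)) g" "\<And>i. i \<in># P \<Longrightarrow> C_class (Suc 0) (V i)"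
  shows "dirder (\<lambda>y. mderiv g (image_mset (\<lambda>i. V i y) P) y) w y =
    mderiv g (add_mset w (image_mset (\<lambda>i. V i y) P)) y +
    (\<Sum>i\<in>#P. mderiv g (add_mset (dirder (V i) w y) (image_mset (\<lambda>i. V i y) (P - {#i#}))) y)"
  using assms
proof (induction P arbitrary: g)
  case empty
  then show ?case by (simp add: mderiv_add_mset[where V = "{#}"])
next
  case (add i P)
  let ?M = "\<lambda>g P y. mderiv g (image_mset (\<lambda>i. V i y) P) y"
  let ?D = "\<lambda>j. dirder (V j) w y"
  have C: "C_class (Suc (size (add_mset i P))) g" by (rule add.prems)
  have C': "C_class (Suc (size P)) g" using C C_class_SucD by simp
  have Cb: "C_class (Suc (size P)) (dirder g b)" for b using C C_class_dirder by simp
  have V: "C_class (Suc 0) (V j)" if "j = i \<or> j \<in># P" for j using add.prems that by auto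
  have Mexp: "?M g (add_mset i P) = (\<lambda>y. \<Sum>b\<in>Basis. (V i y \<bullet> b) *\<^sub>R ?M (dirder g b) P y)"
    using C' by (simp add: mderiv_add_mset_Basis)
  have dV: "(\<lambda>y. V i y \<bullet> b) differentiable (at y)" for b y
    using C_class_inner[OF V[of i]] C_class_imp_differentiable by blast
  have dM: "?M (dirder g b) P differentiable (at y)" for b y
  proof (rule C_class_imp_differentiable[OF C_class_mderiv_compose])
    show "C_class (Suc 0 + size P) (dirder g b)" using Cb[of b] by simp
  qed (use V in blast)
  have 1: "dirder (\<lambda>y. (V i y \<bullet> b) *\<^sub>R ?M (dirder g b) P y) w y
    = (V i y \<bullet> b) *\<^sub>R (mderiv (dirder g b) (add_mset w (image_mset (\<lambda>i. V i y) P)) y +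
        (\<Sum>j\<in>#P. mderiv (dirder g b) (add_mset (?D j) (image_mset (\<lambda>i. V i y) (P - {#j#}))) y))
      + (?D i \<bullet> b) *\<^sub>R ?M (dirder g b) P y" for b
  proof -
    have "dirder (?M (dirder g b) P) w y = mderiv (dirder g b) (add_mset w (image_mset (\<lambda>i. V i y) P)) y +
        (\<Sum>j\<in>#P. mderiv (dirder g b) (add_mset (?D j) (image_mset (\<lambda>i. V i y) (P - {#j#}))) y)"
      using V by (intro add.IH Cb) blast
    then show ?thesis
      using dirder_scaleR[OF dV dM] dirder_inner(2)[OF C_class_imp_differentiable[OF V]] by simp
  qed
  have expand: "(\<Sum>b\<in>Basis. (v \<bullet> b) *\<^sub>R mderiv (dirder g b) U y) = mderiv g (add_mset v U) y"
    if "size U \<le> size P + 1" for v U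
    using that C_class_mono[OF _ C, of "Suc (size U)"] by (intro mderiv_add_mset_Basis[symmetric]) simp
  have "dirder (?M g (add_mset i P)) w y = (\<Sum>b\<in>Basis. dirder (\<lambda>y. (V i y \<bullet> b) *\<^sub>R ?M (dirder g b) P y) w y)"
    unfolding Mexp by (rule dirder_sum) (intro differentiable_scaleR dV dM)
  also have "\<dots> = mderiv g (add_mset (V i y) (add_mset w (image_mset (\<lambda>i. V i y) P))) y
      + (\<Sum>b\<in>Basis. (V i y \<bullet> b) *\<^sub>R (\<Sum>j\<in>#P. mderiv (dirder g b) (add_mset (?D j) (image_mset (\<lambda>i. V i y) (P - {#j#}))) y))
      + mderiv g (add_mset (?D i) (image_mset (\<lambda>i. V i y) P)) y"
    by (simp add: 1 scaleR_add_right sum.distrib expand)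
  also have "(\<Sum>b\<in>Basis. (V i y \<bullet> b) *\<^sub>R (\<Sum>j\<in>#P. mderiv (dirder g b) (add_mset (?D j) (image_mset (\<lambda>i. V i y) (P - {#j#}))) y))
     = (\<Sum>j\<in>#P. mderiv g (add_mset (V i y) (add_mset (?D j) (image_mset (\<lambda>i. V i y) (P - {#j#})))) y)"
  proof -
    have *: "(\<Sum>b\<in>Basis. (V i y \<bullet> b) *\<^sub>R (\<Sum>j\<in>#Q. mderiv (dirder g b) (F j) y))
       = (\<Sum>j\<in>#Q. mderiv g (add_mset (V i y) (F j)) y)"
      if "\<And>j. j \<in># Q \<Longrightarrow> size (F j) \<le> size P + 1" for Q F
      using that by (induction Q) (auto simp: scaleR_add_right sum.distrib expand)
    show ?thesis by (rule *) (simp add: size_Diff_singleton)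
  qed
  also have "\<dots> = (\<Sum>j\<in>#P. mderiv g (add_mset (?D j) (image_mset (\<lambda>i. V i y) (add_mset i P - {#j#}))) y)"
    by (rule arg_cong[where f = sum_mset], rule image_mset_cong)
      (auto simp: add_mset_commute multiset_eq_iff simp flip: insert_DiffM2)
  finally show ?case by (simp add: add_mset_commute add_ac)
qed

section \<open>Multiset factorials\<close>

definition mfact :: "'a multiset \<Rightarrow> real" where
  "mfact m = (\<Prod>x\<in>set_mset m. fact (count m x))"

lemma mfact_empty [simp]: "mfact {#} = 1"
  by (simp add: mfact_def)

lemma mfact_ge_1: "1 \<le> mfact m"
  unfolding mfact_def by (intro prod_ge_1) simp

lemma mfact_superset: "finite S \<Longrightarrow> set_mset m \<subseteq> S \<Longrightarrow> mfact m = (\<Prod>x\<in>S. fact (count m x))"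
  unfolding mfact_def by (intro prod.mono_neutral_left) (auto simp: not_in_iff)

lemma mfact_add_mset: "mfact (add_mset x m) = real (Suc (count m x)) * mfact m"
proof -
  have "mfact (add_mset x m) = (\<Prod>y\<in>insert x (set_mset m). (if y = x then real (Suc (count m x)) else 1) * fact (count m y))"
    unfolding mfact_def by (intro prod.cong) auto
  also have "\<dots> = real (Suc (count m x)) * mfact m"
    using mfact_superset[of "insert x (set_mset m)" m] by (simp add: prod.distrib subset_insertI)
  finally show ?thesis .
qed

lemma mfact_add_replicate: "x \<notin># m \<Longrightarrow> mfact (m + replicate_mset k x) = mfact m * fact k"
proof (induction k)
  case (Suc k)
  then have "count (m + replicate_mset k x) x = k" by (simp add: not_in_iff)
  then show ?case using Suc by (simp add: mfact_add_mset)
qed simp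

lemma mfact_image_inj: "inj_on f (set_mset m) \<Longrightarrow> mfact (image_mset f m) = mfact m"
proof (induction m)
  case (add x m)
  have "count (image_mset f m) (f x) = count m x"
  proof (cases "x \<in># m")
    case True
    then have "f -` {f x} \<inter> set_mset m = {x}" using add.prems by (auto simp: inj_on_def)
    then show ?thesis by (simp add: count_image_mset)
  next
    case False
    then have "f x \<notin># image_mset f m" using add.prems by (auto simp: inj_on_def)
    then show ?thesis using False count_eq_zero_iff by metis
  qed
  then show ?case using add by (auto simp: mfact_add_mset intro: inj_on_subset)
qed simp

lemma card_permutations_mfact:
  "real (card (permutations_of_multiset m)) / fact (size m) = 1 / mfact m"
proof -
  have "real (card (permutations_of_multiset m) * (\<Prod>x\<in>set_mset m. fact (count m x))) = fact (size m)"
    by (simp only: card_permutations_of_multiset_aux of_nat_fact)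
  then have "real (card (permutations_of_multiset m)) * mfact m = fact (size m)"
    by (simp add: mfact_def)
  moreover have "mfact m \<noteq> 0" using mfact_ge_1[of m] by linarith
  ultimately show ?thesis by (simp add: field_simps)
qed

text \<open>A multiset \<open>P\<close> of size \<open>p\<close> has \<open>p! / mfact P\<close> arrangements.  This translates between the sums over
  lists with weight \<open>1 / p!\<close>, which suit multilinear expansions, and the sums over multisets, which
  suit differentiation.\<close>

lemma sum_lists_to_multisets:
  fixes F :: "'i multiset \<Rightarrow> 'b::real_vector"
  assumes "finite Q"
  shows "(\<Sum>cs\<in>{cs. mset cs \<in> Q}. (1 / fact (length cs)) *\<^sub>R F (mset cs)) = (\<Sum>P\<in>Q. (1 / mfact P) *\<^sub>R F P)"
proof -
  have eq: "{cs. mset cs \<in> Q} = (\<Union>P\<in>Q. permutations_of_multiset P)"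
    by (auto simp: permutations_of_multiset_def)
  have "(\<Sum>cs\<in>{cs. mset cs \<in> Q}. (1 / fact (length cs)) *\<^sub>R F (mset cs)) =
    (\<Sum>P\<in>Q. \<Sum>cs\<in>permutations_of_multiset P. (1 / fact (length cs)) *\<^sub>R F (mset cs))"
    unfolding eq using assms by (intro sum.UNION_disjoint) (auto dest: permutations_of_multisetD)
  also have "\<dots> = (\<Sum>P\<in>Q. \<Sum>cs\<in>permutations_of_multiset P. (1 / fact (size P)) *\<^sub>R F P)"
    by (intro sum.cong refl) (auto simp: permutations_of_multiset_def)
  also have "\<dots> = (\<Sum>P\<in>Q. (1 / mfact P) *\<^sub>R F P)"
    by (simp add: sum_constant_scaleR flip: card_permutations_mfact)
  finally show ?thesis .
qed

section \<open>Taylor expansion along a lower set of multisets\<close>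

text \<open>By induction on the order: the derivative of the remainder of order \<open>K + 1\<close> is the remainder of
  order \<open>K\<close> of the derivative.  The crude constant \<open>1\<close> in place of \<open>1 / K!\<close> suffices.\<close>

lemma taylor_line:
  fixes \<phi> :: "nat \<Rightarrow> real \<Rightarrow> 'b::real_normed_vector"
  assumes "\<And>k t. k < K \<Longrightarrow> 0 \<le> t \<Longrightarrow> t \<le> 1 \<Longrightarrow> (\<phi> k has_vector_derivative \<phi> (Suc k) t) (at t)"
    and "\<And>t. 0 \<le> t \<Longrightarrow> t \<le> 1 \<Longrightarrow> norm (\<phi> K t) \<le> M"
    and "0 \<le> t" "t \<le> 1"
  shows "norm (\<phi> 0 t - (\<Sum>k<K. (t ^ k / fact k) *\<^sub>R \<phi> k 0)) \<le> M"
  using assms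
proof (induction K arbitrary: \<phi> t)
  case (Suc K)
  define \<psi> where "\<psi> = (\<lambda>t. \<phi> 0 t - (\<Sum>k<Suc K. (t ^ k / fact k) *\<^sub>R \<phi> k 0))"
  define \<psi>' where "\<psi>' = (\<lambda>t. \<phi> 1 t - (\<Sum>k<K. (t ^ k / fact k) *\<^sub>R \<phi> (Suc k) 0))"
  have bound: "norm (\<psi>' t) \<le> M" if "0 \<le> t" "t \<le> 1" for t
    unfolding \<psi>'_def using Suc.IH[of "\<lambda>k. \<phi> (Suc k)" t] Suc.prems that by simp
  have M: "0 \<le> M" using bound[of 0] norm_ge_zero[of "\<psi>' 0"] by linarith
  have pow: "((\<lambda>t. (t ^ Suc k / fact (Suc k)) *\<^sub>R c) has_vector_derivative (t ^ k / fact k) *\<^sub>R c) (at t)"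
    for k t and c :: 'b
  proof -
    have "((\<lambda>t. t ^ Suc k / fact (Suc k)) has_real_derivative (t ^ k / fact k)) (at t)"
    proof (rule DERIV_cong)
      show "((\<lambda>t. t ^ Suc k / fact (Suc k)) has_real_derivative real (Suc k) * t ^ k / fact (Suc k)) (at t)"
        using DERIV_cdivide[OF DERIV_pow[of "Suc k" t], of "fact (Suc k)"] by simp
      show "real (Suc k) * t ^ k / fact (Suc k) = t ^ k / fact k"
        by (simp add: fact_Suc del: of_nat_Suc)
    qed
    then show ?thesis
      using has_vector_derivative_scaleR[of "\<lambda>t. t ^ Suc k / fact (Suc k)" "t ^ k / fact k" t UNIV "\<lambda>_. c" 0]
      by simp
  qed
  have \<psi>_alt: "\<psi> = (\<lambda>t. \<phi> 0 t - (\<phi> 0 0 + (\<Sum>k<K. (t ^ Suc k / fact (Suc k)) *\<^sub>R \<phi> (Suc k) 0)))"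
    unfolding \<psi>_def by (subst sum.lessThan_Suc_shift) simp
  have der: "(\<psi> has_vector_derivative \<psi>' t) (at t)" if "0 \<le> t" "t \<le> 1" for t
  proof -
    have "(\<psi> has_vector_derivative (\<phi> (Suc 0) t - (0 + (\<Sum>k<K. (t ^ k / fact k) *\<^sub>R \<phi> (Suc k) 0)))) (at t)"
      unfolding \<psi>_alt
      by (intro has_vector_derivative_diff has_vector_derivative_add has_vector_derivative_const
          has_vector_derivative_sum pow Suc.prems(1) that) simp
    then show ?thesis by (simp add: \<psi>'_def)
  qed
  show ?case
  proof (cases "t = 0")
    case True
    then have "\<psi> t = 0" by (simp add: \<psi>_alt)
    then show ?thesis using M by (simp add: \<psi>_def)
  next
    case False
    then have t: "0 < t" using Suc.prems by simp
    have "norm (\<psi> t - \<psi> 0) \<le> M * t - M * 0"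
    proof (rule differentiable_bound_general[OF t])
      show "continuous_on {0..t} \<psi>"
        using der Suc.prems(4)
        by (intro continuous_at_imp_continuous_on) (auto intro: has_vector_derivative_continuous[OF der])
      show "continuous_on {0..t} (\<lambda>x. M * x)" by (intro continuous_intros)
      show "(\<psi> has_vector_derivative \<psi>' x) (at x)" if "0 < x" "x < t" for x
        using der[of x] that Suc.prems by simp
      show "((\<lambda>x. M * x) has_vector_derivative M) (at x)" for x
        by (auto intro!: derivative_eq_intros simp flip: has_real_derivative_iff_has_vector_derivative)
      show "norm (\<psi>' x) \<le> M" if "0 < x" "x < t" for x
        using bound[of x] that Suc.prems by simp
    qed
    moreover have "\<psi> 0 = 0" by (simp add: \<psi>_alt)
    moreover have "M * t \<le> M" using M Suc.prems by (simp add: mult_left_le)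
    ultimately show ?thesis by (simp add: \<psi>_def)
  qed
qed simp

lemma taylor_line_mderiv:
  fixes G :: "'a::euclidean_space \<Rightarrow> 'b::euclidean_space"
  assumes "C_class (size V + K) G"
    and M: "\<And>t. 0 \<le> t \<Longrightarrow> t \<le> 1 \<Longrightarrow> norm (mderiv G (V + replicate_mset K u) (y + t *\<^sub>R u)) \<le> M"
  shows "norm (mderiv G V (y + u) - (\<Sum>k<K. (1 / fact k) *\<^sub>R mderiv G (V + replicate_mset k u) y)) \<le> M"
proof -
  define \<phi> where "\<phi> = (\<lambda>k t. mderiv G (V + replicate_mset k u) (y + t *\<^sub>R u))"
  have "(\<phi> k has_vector_derivative \<phi> (Suc k) t) (at t)" if "k < K" for k t
  proof -
    have C: "C_class (Suc (size (V + replicate_mset k u))) G"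
      using that C_class_mono[OF _ assms(1)] by simp
    have "((\<lambda>t. y + t *\<^sub>R u) has_derivative (\<lambda>r. r *\<^sub>R u)) (at t)"
      by (auto intro!: derivative_eq_intros)
    from has_derivative_compose[OF this has_derivative_dirder[OF mderiv_differentiable[OF C]]]
    show ?thesis
      unfolding \<phi>_def has_vector_derivative_def
      using mderiv_add_mset[OF C] mderiv_differentiable[OF C] by (simp add: dirder_scale)
  qed
  from taylor_line[of K \<phi> M 1, OF this] show ?thesis
    unfolding \<phi>_def using M by simp
qed

text \<open>The displacement is added one index at a time; \<open>hs\<close> lists the indices still
  to be expanded, largest first, and \<open>g\<close> collects the ones already used.  Expanding along the
  largest remaining index \<open>h\<close> stops at the first power with which \<open>g\<close> leaves \<open>A\<close>, so
  that \<open>h\<close> is then the minimum of a multiset on the boundary.  Such an expansion has at most \<open>n\<close> terms,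
  each of which is expanded further, and a remainder of its own; hence the factor \<open>n + 1\<close> for every index.\<close>

lemma taylor_lower_set:
  fixes G :: "'a::euclidean_space \<Rightarrow> 'b::euclidean_space" and v :: "'i \<Rightarrow> 'a"
  assumes C: "C_class n G"
    and fin: "finite A" and size: "\<And>f. f \<in> A \<Longrightarrow> size f < n"
    and lower: "\<And>f f'. f \<in> A \<Longrightarrow> f' \<subseteq># f \<Longrightarrow> f' \<in> A"
    and "finite H" and refl: "\<And>h. h \<in> H \<Longrightarrow> (h, h) \<in> r"
    and B: "\<And>g h. g \<in> A \<Longrightarrow> add_mset h g \<notin> A \<Longrightarrow> h \<in> H \<Longrightarrow> set_mset g \<subseteq> H \<Longrightarrow>
        (\<And>x. x \<in># g \<Longrightarrow> (h, x) \<in> r) \<Longrightarrow> add_mset h g \<in> B"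
    and M: "\<And>f z. f \<in> B \<Longrightarrow> norm (z - y) \<le> (\<Sum>h\<in>H. norm (v h)) \<Longrightarrow> norm (mderiv G (image_mset v f) z) \<le> M"
    and "0 \<le> M"
  shows "sorted_wrt (\<lambda>a b. (b, a) \<in> r) hs \<Longrightarrow> distinct hs \<Longrightarrow> set hs \<subseteq> H \<Longrightarrow>
    g \<in> A \<Longrightarrow> set_mset g \<subseteq> H \<Longrightarrow> (\<And>h x. h \<in> set hs \<Longrightarrow> x \<in># g \<Longrightarrow> (h, x) \<in> r) \<Longrightarrow>
    norm (mderiv G (image_mset v g) (y + (\<Sum>h\<in>set hs. v h)) -
      (\<Sum>f | set_mset f \<subseteq> set hs \<and> f + g \<in> A. (1 / mfact f) *\<^sub>R mderiv G (image_mset v (f + g)) y))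
    \<le> real (n + 1) ^ length hs * M"
proof (induction hs arbitrary: g)
  case Nil
  then have "{f. set_mset f \<subseteq> set [] \<and> f + g \<in> A} = {{#}}" by auto
  then show ?case using \<open>0 \<le> M\<close> by simp
next
  case (Cons h hs)
  define z where "z = y + (\<Sum>h\<in>set hs. v h)"
  define K where "K = (LEAST k. g + replicate_mset k h \<notin> A)"
  have n: "g + replicate_mset n h \<notin> A" using size[of "g + replicate_mset n h"] by auto
  have K: "g + replicate_mset K h \<notin> A" unfolding K_def by (rule LeastI[of _ n]) (rule n)
  have Kn: "K \<le> n" unfolding K_def by (rule Least_le) (rule n)
  have inA: "g + replicate_mset k h \<in> A" if "k < K" for k using not_less_Least that K_def by blast
  have K0: "0 < K" using K Cons.prems(4) by (cases K) auto
  have h: "h \<in> H" "h \<notin> set hs" using Cons.prems by auto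
  have order: "(h', x) \<in> r" if "h' = h \<or> h' \<in> set hs" "x \<in># g + replicate_mset k h" for h' x k
    using that Cons.prems refl by (auto split: if_splits)
  have gH: "set_mset (g + replicate_mset k h) \<subseteq> H" for k using Cons.prems h by (auto split: if_splits)
  define K' where "K' = K - 1"
  have K': "K = Suc K'" using K0 by (simp add: K'_def)
  have KB: "g + replicate_mset K h \<in> B"
    using B[of "g + replicate_mset K' h" h] inA[of K'] K gH[of K'] h order[of h _ K'] by (simp add: K')
  have CK: "C_class (size (image_mset v g) + K) G"
    using C_class_mono[OF _ C] size[OF inA[of K']] by (simp add: K')
  have line: "norm (mderiv G (image_mset v g) (z + v h) -
      (\<Sum>k<K. (1 / fact k) *\<^sub>R mderiv G (image_mset v (g + replicate_mset k h)) z)) \<le> M"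
    using taylor_line_mderiv[OF CK, of "v h" z M]
  proof (simp, elim meta_mp)
    fix t :: real assume t: "0 \<le> t" "t \<le> 1"
    have "norm (z + t *\<^sub>R v h - y) \<le> norm (\<Sum>h\<in>set hs. v h) + norm (t *\<^sub>R v h)"
      unfolding z_def by (metis add.assoc add_diff_cancel_left' norm_triangle_ineq)
    also have "\<dots> \<le> (\<Sum>h\<in>set hs. norm (v h)) + norm (v h)"
      using t by (intro add_mono norm_sum) (simp add: mult_left_le_one_le)
    also have "\<dots> = (\<Sum>h\<in>insert h (set hs). norm (v h))" using h by simp
    also have "\<dots> \<le> (\<Sum>h\<in>H. norm (v h))"
      using Cons.prems \<open>finite H\<close> by (intro sum_mono2) auto
    finally show "norm (mderiv G (image_mset v g + replicate_mset K (v h)) (z + t *\<^sub>R v h)) \<le> M"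
      using M[OF KB] by simp
  qed
  define T where "T = (\<lambda>k. \<Sum>f | set_mset f \<subseteq> set hs \<and> f + (g + replicate_mset k h) \<in> A.
    (1 / mfact f) *\<^sub>R mderiv G (image_mset v (f + (g + replicate_mset k h))) y)"
  have IH: "norm (mderiv G (image_mset v (g + replicate_mset k h)) z - T k) \<le> real (n + 1) ^ length hs * M"
    if "k < K" for k
    unfolding z_def T_def
    by (rule Cons.IH) (use Cons.prems inA[OF that] gH order in auto)
  have finT: "finite {f. set_mset f \<subseteq> set hs \<and> f + g' \<in> A}" for g'
    by (rule finite_subset[OF _ finite_vimageI[OF fin, of "\<lambda>f. f + g'"]]) (auto simp: inj_on_def)
  have split: "(\<Sum>f | set_mset f \<subseteq> set (h # hs) \<and> f + g \<in> A. (1 / mfact f) *\<^sub>R mderiv G (image_mset v (f + g)) y)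
     = (\<Sum>k<K. (1 / fact k) *\<^sub>R T k)"
  proof -
    have "(\<Sum>k<K. (1 / fact k) *\<^sub>R T k) =
      (\<Sum>(k, f)\<in>(SIGMA k:{..<K}. {f. set_mset f \<subseteq> set hs \<and> f + (g + replicate_mset k h) \<in> A}).
        (1 / fact k) *\<^sub>R (1 / mfact f) *\<^sub>R mderiv G (image_mset v (f + (g + replicate_mset k h))) y)"
      unfolding T_def scaleR_sum_right by (rule sum.Sigma) (use finT in auto)
    also have "\<dots> = (\<Sum>f | set_mset f \<subseteq> set (h # hs) \<and> f + g \<in> A. (1 / mfact f) *\<^sub>R mderiv G (image_mset v (f + g)) y)"
    proof (rule sum.reindex_bij_witness[where j = "\<lambda>(k, f). f + replicate_mset k h"
          and i = "\<lambda>f. (count f h, filter_mset (\<lambda>x. x \<noteq> h) f)"])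
      fix f assume f: "f \<in> {f. set_mset f \<subseteq> set (h # hs) \<and> f + g \<in> A}"
      have dec: "filter_mset (\<lambda>x. x \<noteq> h) f + replicate_mset (count f h) h = f"
        by (rule multiset_eqI) auto
      show "(case (count f h, filter_mset (\<lambda>x. x \<noteq> h) f) of (k, f) \<Rightarrow> f + replicate_mset k h) = f"
        using dec by simp
      have "g + replicate_mset (count f h) h \<subseteq># f + g"
        by (subst (2) dec[symmetric]) (simp add: subset_mset.add_increasing add_ac)
      then have "g + replicate_mset (count f h) h \<in> A" using lower f by blast
      have "count f h < K"
      proof (rule ccontr)
        assume "\<not> count f h < K"
        then have "g + replicate_mset K h \<subseteq># g + replicate_mset (count f h) h"
          by (simp add: subseteq_mset_def)
        then show False using lower K \<open>g + replicate_mset (count f h) h \<in> A\<close> by blast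
      qed
      moreover have eq: "f + g = filter_mset (\<lambda>x. x \<noteq> h) f + (g + replicate_mset (count f h) h)"
        by (subst dec[symmetric]) (simp only: add_ac)
      then have "filter_mset (\<lambda>x. x \<noteq> h) f + (g + replicate_mset (count f h) h) \<in> A"
        unfolding eq[symmetric] using f by simp
      ultimately show "(count f h, filter_mset (\<lambda>x. x \<noteq> h) f) \<in>
          (SIGMA k:{..<K}. {f. set_mset f \<subseteq> set hs \<and> f + (g + replicate_mset k h) \<in> A})"
        using f by auto
    next
      fix p assume "p \<in> (SIGMA k:{..<K}. {f. set_mset f \<subseteq> set hs \<and> f + (g + replicate_mset k h) \<in> A})"
      then obtain k f where p: "p = (k, f)" "k < K" "set_mset f \<subseteq> set hs" "f + (g + replicate_mset k h) \<in> A"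
        by auto
      have hf: "h \<notin># f" using p h by auto
      then show "(count (case p of (k, f) \<Rightarrow> f + replicate_mset k h) h,
          filter_mset (\<lambda>x. x \<noteq> h) (case p of (k, f) \<Rightarrow> f + replicate_mset k h)) = p"
        using p by (auto simp: not_in_iff multiset_eq_iff)
      show "(case p of (k, f) \<Rightarrow> f + replicate_mset k h) \<in> {f. set_mset f \<subseteq> set (h # hs) \<and> f + g \<in> A}"
        using p by (auto simp: add_ac split: if_splits)
      show "(1 / mfact (case p of (k, f) \<Rightarrow> f + replicate_mset k h)) *\<^sub>R
            mderiv G (image_mset v ((case p of (k, f) \<Rightarrow> f + replicate_mset k h) + g)) y =
          (case p of (k, f) \<Rightarrow> (1 / fact k) *\<^sub>R (1 / mfact f) *\<^sub>R
            mderiv G (image_mset v (f + (g + replicate_mset k h))) y)"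
        using p mfact_add_replicate[OF hf] by (simp add: add_ac mult.commute)
    qed
    finally show ?thesis by simp
  qed
  have sum: "y + (\<Sum>h\<in>set (h # hs). v h) = z + v h" using h by (simp add: z_def add_ac)
  define N where "N = real (n + 1) ^ length hs"
  have N: "1 \<le> N" unfolding N_def by (rule one_le_power) simp
  have "norm (mderiv G (image_mset v g) (z + v h) - (\<Sum>k<K. (1 / fact k) *\<^sub>R T k))
    \<le> norm (mderiv G (image_mset v g) (z + v h) -
      (\<Sum>k<K. (1 / fact k) *\<^sub>R mderiv G (image_mset v (g + replicate_mset k h)) z))
     + norm (\<Sum>k<K. (1 / fact k) *\<^sub>R (mderiv G (image_mset v (g + replicate_mset k h)) z - T k))"
    using dist_triangle[of "mderiv G (image_mset v g) (z + v h)" "\<Sum>k<K. (1 / fact k) *\<^sub>R T k"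
        "\<Sum>k<K. (1 / fact k) *\<^sub>R mderiv G (image_mset v (g + replicate_mset k h)) z"]
    by (simp only: dist_norm scaleR_diff_right sum_subtractf)
  also have "\<dots> \<le> M + (\<Sum>k<K. N * M)"
  proof (intro add_mono line order_trans[OF norm_sum] sum_mono)
    fix k assume "k \<in> {..<K}"
    have "norm ((1 / fact k) *\<^sub>R (mderiv G (image_mset v (g + replicate_mset k h)) z - T k))
      \<le> norm (mderiv G (image_mset v (g + replicate_mset k h)) z - T k)"
      unfolding norm_scaleR by (rule mult_left_le_one_le) auto
    also have "\<dots> \<le> N * M" using IH \<open>k \<in> {..<K}\<close> by (simp add: N_def)
    finally show "norm ((1 / fact k) *\<^sub>R (mderiv G (image_mset v (g + replicate_mset k h)) z - T k)) \<le> N * M" .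
  qed
  also have "\<dots> \<le> N * M + real n * (N * M)"
    using Kn N \<open>0 \<le> M\<close> by (intro add_mono) (auto intro!: mult_right_mono simp: mult_le_cancel_right1)
  also have "\<dots> = real (n + 1) ^ length (h # hs) * M" by (simp add: N_def algebra_simps)
  finally show ?case unfolding sum split .
qed

section \<open>Counting vertices\<close>

lemma fvert_empty [simp]: "fvert {#} = 0"
  by (simp add: fvert_def)

lemma fvert_add_mset [simp]: "fvert (add_mset h f) = nvert h + fvert f"
  by (simp add: fvert_def)

lemma fvert_union [simp]: "fvert (f + g) = fvert f + fvert g"
  by (simp add: fvert_def)

lemma nvert_Node [simp]: "nvert (Node \<mu> f) = Suc (fvert f)"
  by (simp add: fvert_def)

declare nvert.simps [simp del]

lemma nvert_pos: "0 < nvert h"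
  by (cases h) simp

lemma nvert_neq_0 [simp]: "nvert h \<noteq> 0"
  using nvert_pos[of h] by simp

lemma size_le_fvert: "size f \<le> fvert f"
proof (induction f)
  case (add h f)
  then show ?case using nvert_pos[of h] by simp
qed simp

lemma nvert_le_fvert: "h \<in># f \<Longrightarrow> nvert h \<le> fvert f"
  by (auto dest: multi_member_split)

lemma fvert_mono: "f \<subseteq># g \<Longrightarrow> fvert f \<le> fvert g"
  by (auto simp: subset_mset.le_iff_add)

lemma finite_msets_bounded:
  assumes "finite T"
  shows "finite {f. set_mset f \<subseteq> T \<and> size f \<le> n}"
proof (rule finite_subset)
  show "{f. set_mset f \<subseteq> T \<and> size f \<le> n} \<subseteq> mset ` {hs. set hs \<subseteq> T \<and> length hs \<le> n}"
  proof
    fix f assume f: "f \<in> {f. set_mset f \<subseteq> T \<and> size f \<le> n}"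
    obtain hs where "f = mset hs" by (metis ex_mset)
    then show "f \<in> mset ` {hs. set hs \<subseteq> T \<and> length hs \<le> n}" using f by auto
  qed
qed (use assms finite_lists_length_le in blast)

lemma finite_trees: "finite {h :: 'd::finite rtree. nvert h \<le> n}"
proof (induction n)
  case 0
  show ?case by simp
next
  case (Suc n)
  have "{h :: 'd rtree. nvert h \<le> Suc n} \<subseteq>
      (\<lambda>(\<mu>, f). Node \<mu> f) ` (UNIV \<times> {f. set_mset f \<subseteq> {h. nvert h \<le> n} \<and> size f \<le> n})"
  proof
    fix h :: "'d rtree" assume h: "h \<in> {h. nvert h \<le> Suc n}"
    obtain \<mu> f where hf: "h = Node \<mu> f" by (cases h)
    then have "fvert f \<le> n" using h by simp
    then have "f \<in> {f. set_mset f \<subseteq> {h. nvert h \<le> n} \<and> size f \<le> n}"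
      using nvert_le_fvert[of _ f] size_le_fvert[of f] by (auto intro: order_trans)
    then show "h \<in> (\<lambda>(\<mu>, f). Node \<mu> f) ` (UNIV \<times> {f. set_mset f \<subseteq> {h. nvert h \<le> n} \<and> size f \<le> n})"
      using hf by auto
  qed
  then show ?case
    by (rule finite_subset) (intro finite_imageI finite_cartesian_product finite finite_msets_bounded Suc.IH)
qed

lemma finite_forests: "finite {f :: 'd::finite forest. fvert f \<le> n}"
proof (rule finite_subset)
  show "{f :: 'd forest. fvert f \<le> n} \<subseteq> {f. set_mset f \<subseteq> {h. nvert h \<le> n} \<and> size f \<le> n}"
    by (auto intro: order_trans nvert_le_fvert size_le_fvert)
qed (intro finite_msets_bounded finite_trees)

section \<open>The coefficients of the coproduct\<close>

lemma lookup_pscale [simp]: "Poly_Mapping.lookup (pscale c x) a = c * Poly_Mapping.lookup x a"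
  by (simp add: pscale_def Poly_Mapping.map.rep_eq when_def)

lemma lookup_lin_ext:
  "Poly_Mapping.lookup (lin_ext \<phi> x) b =
    (\<Sum>a\<in>Poly_Mapping.keys x. Poly_Mapping.lookup x a * Poly_Mapping.lookup (\<phi> a) b)"
  by (simp add: lin_ext_def lookup_sum)

lemma lookup_id_graft:
  "Poly_Mapping.lookup (id_graft \<mu> x) (m, {#Node \<nu> f#}) = (if \<nu> = \<mu> then Poly_Mapping.lookup x (m, f) else 0)"
proof -
  have "Poly_Mapping.lookup (id_graft \<mu> x) (m, {#Node \<nu> f#}) =
    (\<Sum>a\<in>Poly_Mapping.keys x. if a = (m, f) then (if \<nu> = \<mu> then Poly_Mapping.lookup x (m, f) else 0) else 0)"
    unfolding id_graft_def lookup_lin_ext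
    by (intro sum.cong refl) (auto simp: lookup_single when_def split: if_splits)
  also have "\<dots> = (if \<nu> = \<mu> then Poly_Mapping.lookup x (m, f) else 0)"
    by (simp add: not_in_keys_iff_lookup_eq_zero)
  finally show ?thesis .
qed

lemma keys_id_graft:
  "c \<in> Poly_Mapping.keys (id_graft \<mu> x) \<Longrightarrow>
    \<exists>f. snd c = {#Node \<mu> f#} \<and> (fst c, f) \<in> Poly_Mapping.keys x"
  unfolding id_graft_def in_keys_iff[of c] lookup_lin_ext
  by (drule sum.not_neutral_contains_not_neutral) (auto simp: lookup_single when_def split: if_splits)

abbreviation coprod_forest :: "'d forest \<Rightarrow> (('d forest \<times> 'd forest) \<Rightarrow>\<^sub>0 real)" where
  "coprod_forest f \<equiv> \<Prod>\<^sub># (image_mset coprod_tree f)"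

lemma coprod_tree_cut_all:
  "Poly_Mapping.lookup (coprod_tree h) (m, {#}) = (if m = {#h#} then 1 else 0)"
proof (cases h)
  case (Node \<mu> f)
  have "Poly_Mapping.lookup (id_graft \<mu> x) (m, {#}) = 0" for x
    using keys_id_graft[of "(m, {#})" \<mu> x] by (auto simp: in_keys_iff)
  then show ?thesis by (auto simp: Node lookup_add lookup_single when_def)
qed

lemma coprod_tree_cut:
  "Poly_Mapping.lookup (coprod_tree (Node \<nu> g)) (m, {#Node \<mu> f#}) =
    (if \<mu> = \<nu> then Poly_Mapping.lookup (coprod_forest g) (m, f) else 0)"
  by (simp add: lookup_add lookup_single lookup_id_graft)

definition pvert :: "'d forest \<times> 'd forest \<Rightarrow> nat" where
  "pvert c = fvert (fst c) + fvert (snd c)"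

lemma pvert_add [simp]: "pvert (c + c') = pvert c + pvert c'"
  by (simp add: pvert_def)

lemma pvert_zero [simp]: "pvert 0 = 0"
  by (simp add: pvert_def)

lemma keys_prod_mset_pvert:
  assumes "\<And>h c. h \<in># f \<Longrightarrow> c \<in> Poly_Mapping.keys (coprod_tree h) \<Longrightarrow> pvert c = nvert h"
  shows "c \<in> Poly_Mapping.keys (coprod_forest f) \<Longrightarrow> pvert c = fvert f"
  using assms
proof (induction f arbitrary: c)
  case (add h f)
  then obtain a b where "c = a + b" "a \<in> Poly_Mapping.keys (coprod_tree h)" "b \<in> Poly_Mapping.keys (coprod_forest f)"
    using keys_mult[of "coprod_tree h" "coprod_forest f"] by auto
  then show ?case using add by auto
qed simp

lemma keys_coprod_tree_Node:
  assumes "c \<in> Poly_Mapping.keys (coprod_tree (Node \<mu> f))"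
  shows "c = ({#Node \<mu> f#}, {#}) \<or> c \<in> Poly_Mapping.keys (id_graft \<mu> (coprod_forest f))"
  using assms keys_add[of "Poly_Mapping.single ({#Node \<mu> f#}, {#}) 1" "id_graft \<mu> (coprod_forest f)"]
  by auto

lemma keys_coprod_tree_pvert: "c \<in> Poly_Mapping.keys (coprod_tree h) \<Longrightarrow> pvert c = nvert h"
proof (induction h arbitrary: c)
  case (Node \<mu> f)
  have "c = ({#Node \<mu> f#}, {#}) \<or> c \<in> Poly_Mapping.keys (id_graft \<mu> (coprod_forest f))"
    using Node.prems by (rule keys_coprod_tree_Node)
  then show ?case
  proof
    assume c: "c \<in> Poly_Mapping.keys (id_graft \<mu> (coprod_forest f))"
    obtain f' where f': "snd c = {#Node \<mu> f'#}" "(fst c, f') \<in> Poly_Mapping.keys (coprod_forest f)"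
      using keys_id_graft[OF c] by (elim exE conjE)
    have "pvert (fst c, f') = fvert f"
      by (rule keys_prod_mset_pvert[OF Node.IH]) (use f' in auto)
    then show ?thesis using f' by (simp add: pvert_def)
  qed (simp add: pvert_def)
qed

lemma keys_coprod_forest_pvert: "c \<in> Poly_Mapping.keys (coprod_forest f) \<Longrightarrow> pvert c = fvert f"
  by (rule keys_prod_mset_pvert) (rule keys_coprod_tree_pvert)

lemma lookup_coprod_forest_eq_0: "pvert c \<noteq> fvert f \<Longrightarrow> Poly_Mapping.lookup (coprod_forest f) c = 0"
  using keys_coprod_forest_pvert[of c f] by (auto simp: in_keys_iff)

text \<open>A cut of a tree either removes the whole tree or leaves a single tree containing the root.  Hence
  the terms of the coproduct of a tree are indexed by a sum type: \<open>Inl h\<close> stands for \<open>h \<otimes> 1\<close>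
  and \<open>Inr (m, \<tau>)\<close> for \<open>m \<otimes> \<tau>\<close>.  Each has at least one vertex, so that only finitely many
  collections of cuts have a given product.\<close>

primrec cut_key :: "'d rtree + 'd forest \<times> 'd rtree \<Rightarrow> 'd forest \<times> 'd forest" where
  "cut_key (Inl h) = ({#h#}, {#})"
| "cut_key (Inr p) = (fst p, {#snd p#})"

lemma inj_cut_key: "inj cut_key"
proof (rule injI)
  fix x y :: "'d rtree + 'd forest \<times> 'd rtree" assume "cut_key x = cut_key y"
  then show "x = y" by (cases x; cases y) (auto simp: prod_eq_iff)
qed

lemma keys_coprod_tree: "Poly_Mapping.keys (coprod_tree h) \<subseteq> range cut_key"
proof (cases h)
  case (Node \<mu> f)
  show ?thesis
  proof
    fix c assume "c \<in> Poly_Mapping.keys (coprod_tree h)"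
    then have "c = ({#Node \<mu> f#}, {#}) \<or> c \<in> Poly_Mapping.keys (id_graft \<mu> (coprod_forest f))"
      unfolding Node by (rule keys_coprod_tree_Node)
    then show "c \<in> range cut_key"
    proof
      assume "c = ({#Node \<mu> f#}, {#})"
      then have "c = cut_key (Inl h)" using Node by simp
      then show ?thesis by (rule range_eqI)
    next
      assume "c \<in> Poly_Mapping.keys (id_graft \<mu> (coprod_forest f))"
      from keys_id_graft[OF this] obtain f' where "snd c = {#Node \<mu> f'#}" by (elim exE conjE)
      then have "c = cut_key (Inr (fst c, Node \<mu> f'))" by (simp add: prod_eq_iff)
      then show ?thesis by (rule range_eqI)
    qed
  qed
qed

lemma pvert_cut_key_pos: "0 < pvert (cut_key i)"
  using nvert_pos by (cases i) (auto simp: pvert_def)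

lemma finite_cut_keys: "finite {i :: 'd::finite rtree + 'd forest \<times> 'd rtree. pvert (cut_key i) \<le> n}"
proof (rule finite_subset)
  show "{i :: 'd rtree + 'd forest \<times> 'd rtree. pvert (cut_key i) \<le> n} \<subseteq>
    Inl ` {h. nvert h \<le> n} \<union> Inr ` ({m. fvert m \<le> n} \<times> {\<tau>. nvert \<tau> \<le> n})"
  proof
    fix i :: "'d rtree + 'd forest \<times> 'd rtree" assume "i \<in> {i. pvert (cut_key i) \<le> n}"
    then show "i \<in> Inl ` {h. nvert h \<le> n} \<union> Inr ` ({m. fvert m \<le> n} \<times> {\<tau>. nvert \<tau> \<le> n})"
      by (cases i) (auto simp: pvert_def)
  qed
qed (intro finite_UnI finite_imageI finite_cartesian_product finite_trees finite_forests)

lemma pvert_sum_list: "pvert (sum_list (map cut_key cs)) = (\<Sum>i\<leftarrow>cs. pvert (cut_key i))"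
  by (induction cs) auto

lemma sum_cut_keys_bound:
  assumes "sum_list (map cut_key cs) = c"
  shows "length cs \<le> pvert c" "i \<in> set cs \<Longrightarrow> pvert (cut_key i) \<le> pvert c"
    "Inr (m, \<tau>) \<in> set cs \<Longrightarrow> nvert \<tau> \<le> fvert (snd c)"
proof -
  have "length cs \<le> (\<Sum>i\<leftarrow>cs. pvert (cut_key i))"
  proof (induction cs)
    case (Cons i cs)
    then show ?case using pvert_cut_key_pos[of i] by simp
  qed simp
  moreover have total: "(\<Sum>i\<leftarrow>cs. pvert (cut_key i)) = pvert c"
    using assms pvert_sum_list[of cs] by simp
  ultimately show "length cs \<le> pvert c" by simp
  show "pvert (cut_key i) \<le> pvert c" if "i \<in> set cs"
    unfolding total[symmetric] by (rule member_le_sum_list) (use that in auto)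
  show "nvert \<tau> \<le> fvert (snd c)" if "Inr (m, \<tau>) \<in> set cs"
    using that unfolding assms[symmetric] by (induction cs) auto
qed

lemma finite_cut_lists: "finite {cs :: ('d::finite rtree + 'd forest \<times> 'd rtree) list. sum_list (map cut_key cs) = c}"
proof (rule finite_subset)
  show "{cs. sum_list (map cut_key cs) = c} \<subseteq> {cs. set cs \<subseteq> {i. pvert (cut_key i) \<le> pvert c} \<and> length cs \<le> pvert c}"
    using sum_cut_keys_bound(1,2)[OF refl] by auto
qed (intro finite_lists_length_le finite_cut_keys)

lemma lookup_mult_cut:
  fixes x :: "('d::finite forest \<times> 'd forest) \<Rightarrow>\<^sub>0 real"
  assumes "Poly_Mapping.keys x \<subseteq> range cut_key"
  shows "Poly_Mapping.lookup (x * y) c =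
    (\<Sum>i | \<exists>q. c = cut_key i + q. Poly_Mapping.lookup x (cut_key i) * Poly_Mapping.lookup y (c - cut_key i))"
proof -
  let ?I = "{i. \<exists>q. c = cut_key i + q}"
  have fin: "finite ?I"
    by (rule finite_subset[OF _ finite_cut_keys[of "pvert c"]]) auto
  have inner: "(\<Sum>q. Poly_Mapping.lookup y q when c = l + q) =
      (if \<exists>q. c = l + q then Poly_Mapping.lookup y (c - l) else 0)" for l
  proof (cases "\<exists>q. c = l + q")
    case True
    then have "(c = l + q) = (q = c - l)" for q by (auto simp: prod_eq_iff)
    then show ?thesis using True by simp
  next
    case False
    then have "c \<noteq> l + q" for q by blast
    then show ?thesis using False by (simp only: if_False when_simps Sum_any.neutral)
  qed
  have "Poly_Mapping.lookup (x * y) c = (\<Sum>l. Poly_Mapping.lookup x l *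
      (if \<exists>q. c = l + q then Poly_Mapping.lookup y (c - l) else 0))"
    by (simp add: lookup_mult inner)
  also have "\<dots> = (\<Sum>l\<in>cut_key ` ?I. Poly_Mapping.lookup x l *
      (if \<exists>q. c = l + q then Poly_Mapping.lookup y (c - l) else 0))"
  proof (rule Sum_any.expand_superset)
    show "{l. Poly_Mapping.lookup x l * (if \<exists>q. c = l + q then Poly_Mapping.lookup y (c - l) else 0) \<noteq> 0}
        \<subseteq> cut_key ` ?I"
    proof
      fix l assume l: "l \<in> {l. Poly_Mapping.lookup x l *
        (if \<exists>q. c = l + q then Poly_Mapping.lookup y (c - l) else 0) \<noteq> 0}"
      then have "l \<in> Poly_Mapping.keys x" and q: "\<exists>q. c = l + q"
        by (auto simp: in_keys_iff split: if_splits)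
      then show "l \<in> cut_key ` ?I" using assms by blast
    qed
  qed (use fin in simp)
  also have "\<dots> = (\<Sum>i\<in>?I. Poly_Mapping.lookup x (cut_key i) * Poly_Mapping.lookup y (c - cut_key i))"
    by (subst sum.reindex) (auto intro!: sum.cong inj_on_subset[OF inj_cut_key])
  finally show ?thesis .
qed

text \<open>A cut of a forest is a choice of a cut of each of its trees.\<close>

lemma lookup_coprod_list:
  fixes hs :: "'d::finite rtree list"
  shows "Poly_Mapping.lookup (coprod_forest (mset hs)) c =
    (\<Sum>cs | sum_list (map cut_key cs) = c \<and> length cs = length hs.
      prod_list (map2 (\<lambda>h i. Poly_Mapping.lookup (coprod_tree h) (cut_key i)) hs cs))"
proof (induction hs arbitrary: c)
  case Nil
  have "{cs :: ('d rtree + 'd forest \<times> 'd rtree) list. sum_list (map cut_key cs) = c \<and> cs = []} = (if c = 0 then {[]} else {})" by auto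
  then show ?case by (simp add: lookup_one when_def)
next
  case (Cons h hs)
  let ?a = "\<lambda>h i. Poly_Mapping.lookup (coprod_tree h) (cut_key i)"
  let ?I = "{i. \<exists>q. c = cut_key i + q}"
  let ?L = "\<lambda>c n. {cs. sum_list (map cut_key cs) = c \<and> length cs = n}"
  have finL: "finite (?L c n)" for c :: "'d forest \<times> 'd forest" and n by (rule finite_subset[OF _ finite_cut_lists[of c]]) auto
  have finI: "finite ?I"
    by (rule finite_subset[OF _ finite_cut_keys[of "pvert c"]]) auto
  have "Poly_Mapping.lookup (coprod_forest (mset (h # hs))) c =
      (\<Sum>i\<in>?I. ?a h i * (\<Sum>cs\<in>?L (c - cut_key i) (length hs). prod_list (map2 ?a hs cs)))"
    by (simp only: mset.simps image_mset_add_mset prod_mset.add_mset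
        lookup_mult_cut[OF keys_coprod_tree] Cons.IH)
  also have "\<dots> = (\<Sum>(i, cs)\<in>(SIGMA i:?I. ?L (c - cut_key i) (length hs)). prod_list (map2 ?a (h # hs) (i # cs)))"
    by (subst sum.Sigma[symmetric]) (use finL finI in \<open>auto simp: sum_distrib_left\<close>)
  also have "\<dots> = (\<Sum>cs\<in>?L c (length (h # hs)). prod_list (map2 ?a (h # hs) cs))"
  proof (rule sum.reindex_bij_witness[where i = "\<lambda>cs. (hd cs, tl cs)" and j = "\<lambda>(i, cs). i # cs"])
    fix cs assume cs: "cs \<in> ?L c (length (h # hs))"
    then obtain i cs' where i: "cs = i # cs'" by (cases cs) auto
    then have c: "c = cut_key i + sum_list (map cut_key cs')" using cs by simp
    show "(case (hd cs, tl cs) of (i, cs) \<Rightarrow> i # cs) = cs" using i by simp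
    show "(hd cs, tl cs) \<in> (SIGMA i:?I. ?L (c - cut_key i) (length hs))"
      using cs i c by auto
  next
    fix p assume "p \<in> (SIGMA i:?I. ?L (c - cut_key i) (length hs))"
    then show "(case p of (i, cs) \<Rightarrow> i # cs) \<in> ?L c (length (h # hs))" by auto
  qed auto
  finally show ?case .
qed

section \<open>Elementary differentials divided by symmetry factors\<close>

text \<open>The order of the automorphism group of the tree.\<close>

primrec symfact :: "'d rtree \<Rightarrow> real" where
  "symfact (Node \<mu> f) = mfact f * (\<Prod>\<^sub># (image_mset symfact f))"

lemma prod_mset_ge_1: "(\<And>x. x \<in># f \<Longrightarrow> 1 \<le> c x) \<Longrightarrow> 1 \<le> (\<Prod>x\<in>#f. c x :: real)"
proof (induction f)
  case (add x f)
  then have "1 \<le> c x" "1 \<le> (\<Prod>x\<in>#f. c x)" by auto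
  then show ?case using mult_mono[of 1 "c x" 1 "\<Prod>x\<in>#f. c x"] by simp
qed simp

lemma symfact_ge_1: "1 \<le> symfact h"
proof (induction h)
  case (Node \<mu> f)
  then have "1 * 1 \<le> mfact f * (\<Prod>\<^sub># (image_mset symfact f))"
    by (intro mult_mono prod_mset_ge_1 mfact_ge_1) (auto simp: mfact_ge_1 intro: order_trans[OF zero_le_one])
  then show ?case by simp
qed

text \<open>The coefficient of a coherent path at the tree \<open>h\<close>.\<close>

definition tree_coeff :: "('d \<Rightarrow> 'a::real_normed_vector \<Rightarrow> 'a) \<Rightarrow> 'd rtree \<Rightarrow> 'a \<Rightarrow> 'a" where
  "tree_coeff \<sigma> h y = (1 / symfact h) *\<^sub>R elem_diff \<sigma> h y"

text \<open>The term of index \<open>m\<close> in the Taylor series of \<open>g\<close>, the index \<open>h\<close> standing for the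
  direction \<open>w h\<close>.\<close>

definition taylor_term ::
    "('a::real_normed_vector \<Rightarrow> 'b::real_normed_vector) \<Rightarrow> ('i \<Rightarrow> 'a) \<Rightarrow> 'i multiset \<Rightarrow> 'a \<Rightarrow> 'b" where
  "taylor_term g w m y = (1 / mfact m) *\<^sub>R mderiv g (image_mset w m) y"

lemma taylor_term_empty [simp]: "taylor_term g w {#} = g"
  by (rule ext) (simp add: taylor_term_def)

lemma C_class_scaled: "C_class n g \<Longrightarrow> C_class n (\<lambda>y. c *\<^sub>R g y)"
  for g :: "'a::euclidean_space \<Rightarrow> 'b::real_normed_vector"
  by (intro C_class_scaleR C_class_const)

lemma C_class_taylor_term:
  fixes g :: "'a::euclidean_space \<Rightarrow> 'b::euclidean_space"
  shows "C_class (n + size m) g \<Longrightarrow> C_class n (taylor_term g w m)"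
  unfolding taylor_term_def[abs_def] by (intro C_class_scaled C_class_mderiv) simp

lemma dirder_taylor_term:
  fixes g :: "'a::euclidean_space \<Rightarrow> 'b::euclidean_space"
  assumes "C_class (Suc (size m)) g"
  shows "dirder (taylor_term g w m) (w h) y = real (Suc (count m h)) *\<^sub>R taylor_term g w (add_mset h m) y"
proof -
  have C: "C_class (Suc (size (image_mset w m))) g" using assms by simp
  have "dirder (taylor_term g w m) (w h) y = (1 / mfact m) *\<^sub>R mderiv g (image_mset w (add_mset h m)) y"
    unfolding taylor_term_def[abs_def]
    using dirder_cmul[OF mderiv_differentiable[OF C]] mderiv_add_mset[OF C] by simp
  then show ?thesis by (simp add: taylor_term_def mfact_add_mset del: of_nat_Suc)
qed

text \<open>After division by the symmetry factor, the recursion for elementary differentials becomes the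
  one that defines the coefficients of \<open>\<sigma> \<mu>\<close> composed with a tree path, and that coherence imposes
  on the path.\<close>

lemma tree_coeff_Node:
  fixes \<sigma> :: "'d \<Rightarrow> 'a::euclidean_space \<Rightarrow> 'a"
  assumes "C_class (size f) (\<sigma> \<mu>)"
  shows "tree_coeff \<sigma> (Node \<mu> f) y = taylor_term (\<sigma> \<mu>) (\<lambda>h. tree_coeff \<sigma> h y) f y"
proof -
  have "mderiv (\<sigma> \<mu>) (image_mset (\<lambda>h. tree_coeff \<sigma> h y) f) y =
     (\<Prod>h\<in>#f. 1 / symfact h) *\<^sub>R mderiv (\<sigma> \<mu>) (image_mset (\<lambda>h. elem_diff \<sigma> h y) f) y"
    unfolding tree_coeff_def by (rule mderiv_scale[OF assms])
  moreover have "(\<Prod>h\<in>#f. 1 / symfact h) = 1 / (\<Prod>h\<in>#f. symfact h)"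
    by (induction f) auto
  ultimately show ?thesis
    by (simp add: tree_coeff_def taylor_term_def multiset.map_comp comp_def)
qed

lemma C_class_tree_coeff:
  fixes \<sigma> :: "'d \<Rightarrow> 'a::euclidean_space \<Rightarrow> 'a"
  assumes \<sigma>: "\<And>\<mu>. C_class N (\<sigma> \<mu>)"
  shows "nvert h \<le> N \<Longrightarrow> C_class (Suc N - nvert h) (tree_coeff \<sigma> h)"
proof (induction h)
  case (Node \<mu> f)
  have f: "size f \<le> fvert f" "fvert f < N" using Node.prems size_le_fvert[of f] by auto
  have "tree_coeff \<sigma> (Node \<mu> f) = (\<lambda>y. (1 / mfact f) *\<^sub>R mderiv (\<sigma> \<mu>) (image_mset (\<lambda>h. tree_coeff \<sigma> h y) f) y)"
    using tree_coeff_Node[where f = f and \<sigma> = \<sigma> and \<mu> = \<mu>] C_class_mono[OF _ \<sigma>, of "size f" \<mu>] f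
    by (auto simp: taylor_term_def fun_eq_iff)
  moreover have "C_class (N - fvert f) (\<lambda>y. mderiv (\<sigma> \<mu>) (image_mset (\<lambda>h. tree_coeff \<sigma> h y) f) y)"
  proof (rule C_class_mderiv_compose)
    show "C_class (N - fvert f + size f) (\<sigma> \<mu>)" by (rule C_class_mono[OF _ \<sigma>]) (use f in simp)
    fix h assume h: "h \<in># f"
    then have n: "nvert h \<le> fvert f" by (rule nvert_le_fvert)
    show "C_class (N - fvert f) (tree_coeff \<sigma> h)"
      by (rule C_class_mono[OF _ Node.IH[OF h]]) (use n f in auto)
  qed
  ultimately show ?case by (simp add: C_class_scaled)
qed

section \<open>Grafting\<close>

lemma sum_mset_eq_sum:
  fixes F :: "'i \<Rightarrow> 'b::real_vector"
  shows "(\<Sum>i\<in>#P. F i) = (\<Sum>i\<in>set_mset P. real (count P i) *\<^sub>R F i)"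
proof (induction P)
  case (add x P)
  let ?S = "insert x (set_mset P)"
  have "(\<Sum>i\<in>set_mset P. real (count P i) *\<^sub>R F i) = (\<Sum>i\<in>?S. real (count P i) *\<^sub>R F i)"
    by (rule sum.mono_neutral_left) (auto simp: not_in_iff)
  then have "(\<Sum>i\<in>#add_mset x P. F i) = (\<Sum>i\<in>?S. if i = x then F x else 0) + (\<Sum>i\<in>?S. real (count P i) *\<^sub>R F i)"
    using add.IH by simp
  also have "\<dots> = (\<Sum>i\<in>?S. real (count (add_mset x P) i) *\<^sub>R F i)"
    unfolding sum.distrib[symmetric] by (rule sum.cong) (auto simp: scaleR_add_left)
  finally show ?case by simp
qed simp

lemma finite_marked_multisets:
  assumes "finite D"
  shows "finite {(P, i). add_mset i P \<in> D}"
proof (rule finite_subset)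
  show "{(P, i). add_mset i P \<in> D} \<subseteq> (\<lambda>(Q, i). (Q - {#i#}, i)) ` (SIGMA Q:D. set_mset Q)"
  proof clarify
    fix P i assume "add_mset i P \<in> D"
    then show "(P, i) \<in> (\<lambda>(Q, i). (Q - {#i#}, i)) ` (SIGMA Q:D. set_mset Q)"
      by (intro image_eqI[where x = "(add_mset i P, i)"]) auto
  qed
qed (use assms in auto)

text \<open>Removing an element \<open>i\<close> from \<open>P\<close> divides \<open>mfact P\<close> by the multiplicity of \<open>i\<close>, which is also the number
  of times that \<open>i\<close> occurs in the inner sum.\<close>

lemma sum_marked_multisets:
  fixes F :: "'i \<Rightarrow> 'i multiset \<Rightarrow> 'b::real_vector"
  assumes "finite D"
  shows "(\<Sum>P\<in>D. (1 / mfact P) *\<^sub>R (\<Sum>i\<in>#P. F i (P - {#i#}))) =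
    (\<Sum>(P, i) | add_mset i P \<in> D. (1 / mfact P) *\<^sub>R F i P)"
proof -
  have "(\<Sum>P\<in>D. (1 / mfact P) *\<^sub>R (\<Sum>i\<in>#P. F i (P - {#i#})))
    = (\<Sum>P\<in>D. \<Sum>i\<in>set_mset P. (1 / mfact (P - {#i#})) *\<^sub>R F i (P - {#i#}))"
  proof (rule sum.cong[OF refl])
    fix P assume "P \<in> D"
    have "(\<Sum>i\<in>#P. F i (P - {#i#})) = (\<Sum>i\<in>set_mset P. real (count P i) *\<^sub>R F i (P - {#i#}))"
      by (rule sum_mset_eq_sum)
    moreover have "(1 / mfact P) * real (count P i) = 1 / mfact (P - {#i#})" if i: "i \<in># P" for i
    proof -
      obtain Q where "P = add_mset i Q" using multi_member_split[OF i] by blast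
      then show ?thesis by (simp add: mfact_add_mset)
    qed
    ultimately show "(1 / mfact P) *\<^sub>R (\<Sum>i\<in>#P. F i (P - {#i#})) =
        (\<Sum>i\<in>set_mset P. (1 / mfact (P - {#i#})) *\<^sub>R F i (P - {#i#}))"
      by (simp add: scaleR_sum_right cong: sum.cong)
  qed
  also have "\<dots> = (\<Sum>(P, i)\<in>(SIGMA P:D. set_mset P). (1 / mfact (P - {#i#})) *\<^sub>R F i (P - {#i#}))"
    using assms by (intro sum.Sigma) auto
  also have "\<dots> = (\<Sum>(P, i) | add_mset i P \<in> D. (1 / mfact P) *\<^sub>R F i P)"
  proof (rule sum.reindex_bij_witness[where j = "\<lambda>(P, i). (P - {#i#}, i)" and i = "\<lambda>(P, i). (add_mset i P, i)"])
    fix a assume "a \<in> (SIGMA P:D. set_mset P)"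
    then obtain P i where a: "a = (P, i)" "P \<in> D" "i \<in># P" by (rule SigmaE)
    then have "add_mset i (P - {#i#}) = P" by simp
    with a show "(case case a of (P, i) \<Rightarrow> (P - {#i#}, i) of (P, i) \<Rightarrow> (add_mset i P, i)) = a"
      "(case a of (P, i) \<Rightarrow> (P - {#i#}, i)) \<in> {(P, i). add_mset i P \<in> D}"
      "(case case a of (P, i) \<Rightarrow> (P - {#i#}, i) of (P, i) \<Rightarrow> (1 / mfact P) *\<^sub>R F i P) =
        (case a of (P, i) \<Rightarrow> (1 / mfact (P - {#i#})) *\<^sub>R F i (P - {#i#}))"
      by simp_all
  next
    fix b assume "b \<in> {(P, i). add_mset i P \<in> D}"
    then show "(case case b of (P, i) \<Rightarrow> (add_mset i P, i) of (P, i) \<Rightarrow> (P - {#i#}, i)) = b"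
      "(case b of (P, i) \<Rightarrow> (add_mset i P, i)) \<in> (SIGMA P:D. set_mset P)"
      by (cases b; simp)+
  qed
  finally show ?thesis .
qed

definition cuts :: "'d forest \<times> 'd forest \<Rightarrow> ('d rtree + 'd forest \<times> 'd rtree) multiset set" where
  "cuts c = {P. (\<Sum>i\<in>#P. cut_key i) = c}"

lemma cuts_mset: "mset cs \<in> cuts c \<longleftrightarrow> sum_list (map cut_key cs) = c"
  by (simp add: cuts_def flip: sum_mset_sum_list mset_map)

lemma finite_cuts: "finite (cuts (c :: 'd::finite forest \<times> 'd forest))"
proof -
  have "cuts c \<subseteq> mset ` {cs. sum_list (map cut_key cs) = c}"
  proof
    fix P assume "P \<in> cuts c"
    moreover obtain cs where "P = mset cs" by (metis ex_mset)
    ultimately show "P \<in> mset ` {cs. sum_list (map cut_key cs) = c}" by (auto simp: cuts_mset)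
  qed
  then show ?thesis using finite_cut_lists finite_surj by blast
qed

lemma cuts_bound:
  assumes "P \<in> cuts c"
  shows "size P \<le> pvert c" "i \<in># P \<Longrightarrow> pvert (cut_key i) \<le> pvert c"
proof -
  obtain cs where cs: "P = mset cs" by (metis ex_mset)
  then have "sum_list (map cut_key cs) = c" using assms by (simp add: cuts_mset)
  from sum_cut_keys_bound(1,2)[OF this]
  show "size P \<le> pvert c" "i \<in># P \<Longrightarrow> pvert (cut_key i) \<le> pvert c" by (auto simp: cs)
qed

lemma fst_sum_cut_keys: "fst (\<Sum>i\<in>#P. cut_key i) = (\<Sum>i\<in>#P. fst (cut_key i))"
  by (induction P) auto

lemma add_mset_in_cuts:
  "add_mset (Inl h) P \<in> cuts (add_mset h m, f) \<longleftrightarrow> P \<in> cuts (m, f)"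
  "add_mset (Inr (add_mset h m', \<tau>)) P \<in> cuts (add_mset h m, f) \<longleftrightarrow> add_mset (Inr (m', \<tau>)) P \<in> cuts (m, f)"
  by (auto simp: cuts_def prod_eq_iff)

text \<open>With \<open>w h\<close> the value of \<^term>\<open>tree_coeff \<sigma> h\<close> at the base point, this will turn out to be the
  coefficient of the cut in the sum of \<open>w h\<close> times the coproduct of \<open>h\<close> over all trees \<open>h\<close>.  As a
  function of \<open>y\<close> it can be differentiated, while the directions \<open>w h\<close> stay frozen.\<close>

primrec cut_coeff :: "('d \<Rightarrow> 'a::real_normed_vector \<Rightarrow> 'a) \<Rightarrow> ('d rtree \<Rightarrow> 'a) \<Rightarrow>
    'd rtree + 'd forest \<times> 'd rtree \<Rightarrow> 'a \<Rightarrow> 'a" where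
  "cut_coeff \<sigma> w (Inl h) = (\<lambda>y. w h)"
| "cut_coeff \<sigma> w (Inr p) = taylor_term (tree_coeff \<sigma> (snd p)) w (fst p)"

text \<open>The coefficient of \<open>c\<close> in the formal Taylor series of \<open>\<sigma> \<mu>\<close> at \<open>y\<close>, in the displacement that is the
  formal sum of the cuts with their coefficients.\<close>

definition cut_sum :: "('d \<Rightarrow> 'a::real_normed_vector \<Rightarrow> 'a) \<Rightarrow> 'd \<Rightarrow> ('d rtree \<Rightarrow> 'a) \<Rightarrow>
    'd forest \<times> 'd forest \<Rightarrow> 'a \<Rightarrow> 'a" where
  "cut_sum \<sigma> \<mu> w c y =
    (\<Sum>P\<in>cuts c. (1 / mfact P) *\<^sub>R mderiv (\<sigma> \<mu>) (image_mset (\<lambda>i. cut_coeff \<sigma> w i y) P) y)"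

lemma cuts_empty_left:
  fixes f :: "'d forest"
  shows "cuts ({#}, f) = {image_mset (\<lambda>\<tau>. Inr ({#}, \<tau>)) f}"
proof -
  have eq: "fst (\<Sum>i\<in>#P. cut_key i) = {#} \<Longrightarrow> P = image_mset (\<lambda>\<tau>. Inr ({#}, \<tau>)) (snd (\<Sum>i\<in>#P. cut_key i))"
    for P :: "('d rtree + 'd forest \<times> 'd rtree) multiset"
  proof (induction P)
    case (add i P)
    then show ?case by (cases i) auto
  qed simp
  have "P = image_mset (\<lambda>\<tau>. Inr ({#}, \<tau>)) f" if "P \<in> cuts ({#}, f)" for P
    using that eq[of P] by (simp add: cuts_def)
  then have "cuts ({#}, f) \<subseteq> {image_mset (\<lambda>\<tau>. Inr ({#}, \<tau>)) f}" unfolding subset_iff singleton_iff by iprover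
  moreover have "(\<Sum>i\<in>#image_mset (\<lambda>\<tau>. Inr ({#}, \<tau>)) f. cut_key i) = ({#}, f)"
    by (induction f) (auto simp: zero_prod_def)
  then have "image_mset (\<lambda>\<tau>. Inr ({#}, \<tau>)) f \<in> cuts ({#}, f)" unfolding cuts_def by (rule CollectI)
  ultimately show ?thesis by (intro equalityI) simp_all
qed

context
  fixes \<sigma> :: "'d::finite \<Rightarrow> 'a::euclidean_space \<Rightarrow> 'a" and N :: nat
  assumes \<sigma>: "\<And>\<mu>. C_class N (\<sigma> \<mu>)"
begin

lemma C_class_cut_coeff:
  assumes "pvert (cut_key i) < N"
  shows "C_class (Suc 0) (cut_coeff \<sigma> w i)"
proof (cases i)
  case (Inr p)
  obtain m \<tau> where p: "p = (m, \<tau>)" by (cases p)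
  have b: "fvert m + nvert \<tau> < N" using assms Inr p by (simp add: pvert_def)
  have "C_class (Suc 0) (taylor_term (tree_coeff \<sigma> \<tau>) w m)"
    by (rule C_class_taylor_term, rule C_class_mono[OF _ C_class_tree_coeff[OF \<sigma>]])
      (use b size_le_fvert[of m] in auto)
  then show ?thesis using Inr p by simp
qed simp

lemma dirder_cut_coeff:
  assumes "fvert m + nvert \<tau> < N"
  shows "dirder (cut_coeff \<sigma> w (Inr (m, \<tau>))) (w h) y =
    real (Suc (count m h)) *\<^sub>R cut_coeff \<sigma> w (Inr (add_mset h m, \<tau>)) y"
proof -
  have "C_class (Suc (size m)) (tree_coeff \<sigma> \<tau>)"
    by (rule C_class_mono[OF _ C_class_tree_coeff[OF \<sigma>]]) (use assms size_le_fvert[of m] in auto)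
  from dirder_taylor_term[OF this] show ?thesis by simp
qed

text \<open>By the chain rule, differentiating in the direction \<open>w h\<close> either adds the cut \<open>h \<otimes> 1\<close>, when the
  derivative falls on \<open>\<sigma> \<mu>\<close>, or adds \<open>h\<close> to the left of one of the cuts \<open>m' \<otimes> \<tau>\<close>.  Conversely, a
  collection of cuts with product \<open>c\<close> arises in this way once for every copy of \<open>h\<close> on its left.  Both
  sides are therefore sums over collections of cuts with a marked element.\<close>

lemma dirder_cut_sum:
  assumes b: "fvert m + fvert f < N"
  shows "dirder (cut_sum \<sigma> \<mu> w (m, f)) (w h) y
    = real (Suc (count m h)) *\<^sub>R cut_sum \<sigma> \<mu> w (add_mset h m, f) y"
proof -
  let ?V = "cut_coeff \<sigma> w"
  let ?X = "\<lambda>P. mderiv (\<sigma> \<mu>) (image_mset (\<lambda>i. ?V i y) P) y"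
  have bnd: "size P < N" "\<And>i. i \<in># P \<Longrightarrow> pvert (cut_key i) < N" if "P \<in> cuts (m, f)" for P
    using cuts_bound[OF that] b by (auto simp: pvert_def[of "(m, f)"] intro: le_less_trans)
  have CV: "C_class (Suc 0) (?V i)" if "P \<in> cuts (m, f)" "i \<in># P" for P i
    using C_class_cut_coeff bnd that by blast
  have C\<sigma>: "C_class (Suc (size P)) (\<sigma> \<mu>)" if "P \<in> cuts (m, f)" for P
    using C_class_mono[OF _ \<sigma>] bnd[OF that] by simp
  have dM: "(\<lambda>y. mderiv (\<sigma> \<mu>) (image_mset (\<lambda>i. ?V i y) P) y) differentiable (at y)" if "P \<in> cuts (m, f)" for P y
    using C\<sigma>[OF that] CV[OF that]
    by (intro C_class_imp_differentiable[OF C_class_mderiv_compose]) auto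
  \<comment> \<open>the term in which the derivative falls on the cut \<open>i\<close>, the others being \<open>P\<close>\<close>
  define shifted where "shifted = (\<lambda>(i :: 'd rtree + 'd forest \<times> 'd rtree) P. case i of Inl h' \<Rightarrow> 0
    | Inr p \<Rightarrow> real (Suc (count (fst p) h)) *\<^sub>R ?X (add_mset (Inr (add_mset h (fst p), snd p)) P))"
  have summand: "dirder (\<lambda>y. mderiv (\<sigma> \<mu>) (image_mset (\<lambda>i. ?V i y) P) y) (w h) y =
      ?X (add_mset (Inl h) P) + (\<Sum>i\<in>#P. shifted i (P - {#i#}))" if P: "P \<in> cuts (m, f)" for P
  proof -
    have eq: "mderiv (\<sigma> \<mu>) (add_mset (dirder (?V i) (w h) y) (image_mset (\<lambda>i. ?V i y) (P - {#i#}))) y = shifted i (P - {#i#})"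
      if i: "i \<in># P" for i
    proof -
      have C: "C_class (Suc (size (image_mset (\<lambda>i. ?V i y) (P - {#i#})))) (\<sigma> \<mu>)"
        by (rule C_class_mono[OF _ C\<sigma>[OF P]]) (simp add: size_Diff1_le)
      have scale: "mderiv (\<sigma> \<mu>) (add_mset (a *\<^sub>R u) (image_mset (\<lambda>i. ?V i y) (P - {#i#}))) y =
          a *\<^sub>R mderiv (\<sigma> \<mu>) (add_mset u (image_mset (\<lambda>i. ?V i y) (P - {#i#}))) y" for a u
        by (simp add: mderiv_add_mset[OF C] dirder_scale mderiv_differentiable[OF C])
      show ?thesis
      proof (cases i)
        case (Inl h')
        then show ?thesis using scale[of 0 0] by (simp add: shifted_def)
      next
        case (Inr p)
        have "fvert (fst p) + nvert (snd p) < N" using bnd(2)[OF P i] Inr by (simp add: pvert_def)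
        from dirder_cut_coeff[OF this, of w h y] have der: "dirder (?V i) (w h) y =
            real (Suc (count (fst p) h)) *\<^sub>R ?V (Inr (add_mset h (fst p), snd p)) y"
          unfolding Inr prod.collapse .
        show ?thesis unfolding der scale by (simp add: Inr shifted_def)
      qed
    qed
    have "(\<Sum>i\<in>#P. mderiv (\<sigma> \<mu>) (add_mset (dirder (?V i) (w h) y) (image_mset (\<lambda>i. ?V i y) (P - {#i#}))) y)
        = (\<Sum>i\<in>#P. shifted i (P - {#i#}))"
      by (rule arg_cong[where f = sum_mset], rule image_mset_cong) (rule eq)
    then show ?thesis
      using dirder_mderiv_compose[of P "\<sigma> \<mu>" ?V "w h" y, OF C\<sigma>[OF P] CV[OF P]] by simp
  qed
  \<comment> \<open>the number of copies of \<open>h\<close> that the cut \<open>i\<close> contributes to the left factor\<close>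
  define weight where "weight = (\<lambda>i :: 'd rtree + 'd forest \<times> 'd rtree. count (fst (cut_key i)) h)"
  let ?D = "cuts (add_mset h m, f)"
  let ?M = "{(P, i). add_mset i P \<in> ?D}"
  have finM: "finite ?M"
    by (rule finite_marked_multisets[OF finite_cuts])
  have right: "real (Suc (count m h)) *\<^sub>R cut_sum \<sigma> \<mu> w (add_mset h m, f) y =
      (\<Sum>(P, i)\<in>?M. (1 / mfact P) *\<^sub>R real (weight i) *\<^sub>R ?X (add_mset i P))"
  proof -
    have marked: "real (Suc (count m h)) *\<^sub>R ?X P = (\<Sum>i\<in>#P. real (weight i) *\<^sub>R ?X (add_mset i (P - {#i#})))"
      if "P \<in> ?D" for P
    proof -
      have "(\<Sum>i\<in>#P. fst (cut_key i)) = add_mset h m"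
        using that fst_sum_cut_keys[of P] by (simp add: cuts_def)
      then have "Suc (count m h) = count (\<Sum>i\<in>#P. fst (cut_key i)) h" by simp
      also have "\<dots> = (\<Sum>i\<in>#P. weight i)"
        unfolding weight_def by (induction P) auto
      finally have total: "Suc (count m h) = (\<Sum>i\<in>#P. weight i)" .
      have "real (\<Sum>i\<in>#Q. weight i) *\<^sub>R x = (\<Sum>i\<in>#Q. real (weight i) *\<^sub>R x)" for Q and x :: 'a
        by (induction Q) (auto simp: scaleR_add_left)
      then have "real (Suc (count m h)) *\<^sub>R ?X P = (\<Sum>i\<in>#P. real (weight i) *\<^sub>R ?X P)"
        unfolding total .
      also have "\<dots> = (\<Sum>i\<in>#P. real (weight i) *\<^sub>R ?X (add_mset i (P - {#i#})))"
        by (rule arg_cong[where f = sum_mset], rule image_mset_cong) simp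
      finally show ?thesis .
    qed
    have "real (Suc (count m h)) *\<^sub>R cut_sum \<sigma> \<mu> w (add_mset h m, f) y =
        (\<Sum>P\<in>?D. (1 / mfact P) *\<^sub>R (\<Sum>i\<in>#P. real (weight i) *\<^sub>R ?X (add_mset i (P - {#i#}))))"
      unfolding cut_sum_def scaleR_sum_right
      by (rule sum.cong[OF refl]) (simp only: scaleR_left_commute[of "real (Suc (count m h))"] marked)
    also have "\<dots> = (\<Sum>(P, i)\<in>?M. (1 / mfact P) *\<^sub>R real (weight i) *\<^sub>R ?X (add_mset i P))"
      by (rule sum_marked_multisets[OF finite_cuts])
    finally show ?thesis .
  qed
  \<comment> \<open>the marked cuts that contain a copy of \<open>h\<close> on the left: \<open>h \<otimes> 1\<close> itself, and \<open>(h m') \<otimes> \<tau>\<close>\<close>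
  let ?M1 = "(\<lambda>P. (P, Inl h)) ` cuts (m, f)"
  let ?M2 = "(\<lambda>(P, m', \<tau>). (P, Inr (add_mset h m', \<tau>))) ` {(P, m', \<tau>). add_mset (Inr (m', \<tau>)) P \<in> cuts (m, f)}"
  have sub1: "?M1 \<subseteq> ?M" by (rule image_subsetI) (simp add: add_mset_in_cuts)
  have sub2: "?M2 \<subseteq> ?M" by (rule image_subsetI) (simp add: add_mset_in_cuts case_prod_unfold)
  have vanish: "weight i = 0" if "(P, i) \<in> ?M - (?M1 \<union> ?M2)" for P i
  proof (rule ccontr)
    assume w: "weight i \<noteq> 0"
    show False
    proof (cases i)
      case (Inl h')
      then have "h' = h" using w by (simp add: weight_def split: if_splits)
      then have "P \<in> cuts (m, f)" using that Inl by (simp add: add_mset_in_cuts)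
      then have "(P, i) \<in> ?M1" unfolding Inl \<open>h' = h\<close> by (rule imageI)
      then show False using that by blast
    next
      case (Inr p)
      then have "h \<in># fst p" using w by (simp add: weight_def)
      from multi_member_split[OF this] obtain m' where "fst p = add_mset h m'" by blast
      then have i: "i = Inr (add_mset h m', snd p)" using Inr by (simp add: prod_eq_iff)
      have "add_mset (Inr (m', snd p)) P \<in> cuts (m, f)" using that unfolding i by (simp add: add_mset_in_cuts)
      then have "(P, m', snd p) \<in> {(P, m', \<tau>). add_mset (Inr (m', \<tau>)) P \<in> cuts (m, f)}" by simp
      then have "(P, i) \<in> ?M2" unfolding i by (rule rev_image_eqI) simp
      then show False using that by blast
    qed
  qed
  note fin12 = finite_subset[OF sub1 finM] finite_subset[OF sub2 finM]
  have "(\<Sum>(P, i)\<in>?M. (1 / mfact P) *\<^sub>R real (weight i) *\<^sub>R ?X (add_mset i P)) =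
      (\<Sum>(P, i)\<in>?M1 \<union> ?M2. (1 / mfact P) *\<^sub>R real (weight i) *\<^sub>R ?X (add_mset i P))"
  proof (rule sum.mono_neutral_right[OF finM Un_least[OF sub1 sub2]], rule ballI)
    fix x assume x: "x \<in> ?M - (?M1 \<union> ?M2)"
    obtain P i where Pi: "x = (P, i)" by (rule prod.exhaust)
    have "weight i = 0" by (rule vanish) (rule x[unfolded Pi])
    then show "(case x of (P, i) \<Rightarrow> (1 / mfact P) *\<^sub>R real (weight i) *\<^sub>R ?X (add_mset i P)) = 0"
      by (simp add: Pi)
  qed
  also have "\<dots> = (\<Sum>(P, i)\<in>?M1. (1 / mfact P) *\<^sub>R real (weight i) *\<^sub>R ?X (add_mset i P)) +
      (\<Sum>(P, i)\<in>?M2. (1 / mfact P) *\<^sub>R real (weight i) *\<^sub>R ?X (add_mset i P))"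
    by (rule sum.union_disjoint[OF fin12]) (rule equals0I, elim IntE imageE, simp add: case_prod_unfold)
  also have "(\<Sum>(P, i)\<in>?M1. (1 / mfact P) *\<^sub>R real (weight i) *\<^sub>R ?X (add_mset i P)) =
      (\<Sum>P\<in>cuts (m, f). (1 / mfact P) *\<^sub>R ?X (add_mset (Inl h) P))"
  proof -
    have inj: "inj_on (\<lambda>P. (P, Inl h :: 'd rtree + 'd forest \<times> 'd rtree)) A" for A by (rule inj_onI) simp
    show ?thesis
      unfolding sum.reindex[OF inj] by (rule sum.cong[OF refl]) (simp add: weight_def)
  qed
  also have "(\<Sum>(P, i)\<in>?M2. (1 / mfact P) *\<^sub>R real (weight i) *\<^sub>R ?X (add_mset i P)) =
      (\<Sum>(P, m', \<tau>) | add_mset (Inr (m', \<tau>)) P \<in> cuts (m, f). (1 / mfact P) *\<^sub>R shifted (Inr (m', \<tau>)) P)"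
  proof -
    have inj: "inj_on (\<lambda>(P, m', \<tau>). (P, Inr (add_mset h m', \<tau>) :: 'd rtree + 'd forest \<times> 'd rtree)) A" for A by (rule inj_onI) auto
    show ?thesis
      unfolding sum.reindex[OF inj]
      by (rule sum.cong[OF refl]) (simp add: weight_def shifted_def case_prod_unfold)
  qed
  also have "\<dots> = (\<Sum>(P, i) | add_mset i P \<in> cuts (m, f). (1 / mfact P) *\<^sub>R shifted i P)"
  proof -
    let ?L = "{(P, i). add_mset i P \<in> cuts (m, f)}"
    have "(\<Sum>(P, i)\<in>?L. (1 / mfact P) *\<^sub>R shifted i P) =
      (\<Sum>(P, i)\<in>(\<lambda>(P, p). (P, Inr p)) ` {(P, m', \<tau>). add_mset (Inr (m', \<tau>)) P \<in> cuts (m, f)}.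
        (1 / mfact P) *\<^sub>R shifted i P)"
    proof (rule sum.mono_neutral_right)
      show "finite ?L"
        by (rule finite_marked_multisets[OF finite_cuts])
      show "\<forall>x\<in>?L - (\<lambda>(P, p). (P, Inr p)) ` {(P, m', \<tau>). add_mset (Inr (m', \<tau>)) P \<in> cuts (m, f)}.
          (case x of (P, i) \<Rightarrow> (1 / mfact P) *\<^sub>R shifted i P) = 0"
      proof
        fix x assume x: "x \<in> ?L - (\<lambda>(P, p). (P, Inr p)) ` {(P, m', \<tau>). add_mset (Inr (m', \<tau>)) P \<in> cuts (m, f)}"
        obtain P i where Pi: "x = (P, i)" by (cases x)
        show "(case x of (P, i) \<Rightarrow> (1 / mfact P) *\<^sub>R shifted i P) = 0"
        proof (cases i)
          case (Inr p)
          then have "(P, p) \<in> {(P, m', \<tau>). add_mset (Inr (m', \<tau>)) P \<in> cuts (m, f)}"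
            using x Pi by (simp add: case_prod_unfold)
          then have "x \<in> (\<lambda>(P, p). (P, Inr p)) ` {(P, m', \<tau>). add_mset (Inr (m', \<tau>)) P \<in> cuts (m, f)}"
            unfolding Pi Inr by (rule rev_image_eqI) simp
          then show ?thesis using x by blast
        qed (simp add: Pi shifted_def)
      qed
    qed auto
    also have "\<dots> = (\<Sum>(P, m', \<tau>) | add_mset (Inr (m', \<tau>)) P \<in> cuts (m, f). (1 / mfact P) *\<^sub>R shifted (Inr (m', \<tau>)) P)"
    proof -
      have inj: "inj_on (\<lambda>(P, p). (P, Inr p :: 'd rtree + 'd forest \<times> 'd rtree)) A" for A by (rule inj_onI) auto
      show ?thesis
        unfolding sum.reindex[OF inj]
        by (rule sum.cong[OF refl]) (simp add: case_prod_unfold)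
    qed
    finally show ?thesis by simp
  qed
  also have "\<dots> = (\<Sum>P\<in>cuts (m, f). (1 / mfact P) *\<^sub>R (\<Sum>i\<in>#P. shifted i (P - {#i#})))"
    by (rule sum_marked_multisets[OF finite_cuts, symmetric])
  finally have "real (Suc (count m h)) *\<^sub>R cut_sum \<sigma> \<mu> w (add_mset h m, f) y =
      (\<Sum>P\<in>cuts (m, f). (1 / mfact P) *\<^sub>R (?X (add_mset (Inl h) P) + (\<Sum>i\<in>#P. shifted i (P - {#i#}))))"
    unfolding right by (simp add: scaleR_add_right sum.distrib)
  also have "\<dots> = (\<Sum>P\<in>cuts (m, f). dirder (\<lambda>y. (1 / mfact P) *\<^sub>R
      mderiv (\<sigma> \<mu>) (image_mset (\<lambda>i. ?V i y) P) y) (w h) y)"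
    by (rule sum.cong[OF refl]) (simp only: dirder_cmul[OF dM] summand)
  also have "\<dots> = dirder (cut_sum \<sigma> \<mu> w (m, f)) (w h) y"
    unfolding cut_sum_def[abs_def] by (rule dirder_sum[symmetric]) (intro differentiable_scaleR differentiable_const dM)
  finally show ?thesis by (rule sym)
qed

text \<open>Both sides change in the same way under differentiation in the direction \<open>w h\<close>, that is, when \<open>h\<close>
  is added to \<open>m\<close>; for empty \<open>m\<close> the equation is the recursion for \<^const>\<open>tree_coeff\<close>.\<close>

lemma cut_sum_eq_taylor_term:
  "fvert m + fvert f < N \<Longrightarrow> cut_sum \<sigma> \<mu> w (m, f) = taylor_term (tree_coeff \<sigma> (Node \<mu> f)) w m"
proof (induction m)
  case empty
  have C: "C_class (size f) (\<sigma> \<mu>)"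
    by (rule C_class_mono[OF _ \<sigma>]) (use empty size_le_fvert[of f] in simp)
  have inj: "inj_on (\<lambda>\<tau>. Inr ({#}, \<tau>) :: 'd rtree + 'd forest \<times> 'd rtree) (set_mset f)"
    by (rule inj_onI) simp
  show ?case
    by (rule ext)
      (simp add: cut_sum_def cuts_empty_left mfact_image_inj[OF inj] tree_coeff_Node[where f = f and \<sigma> = \<sigma> and \<mu> = \<mu>, OF C] taylor_term_def
        multiset.map_comp comp_def)
next
  case (add h m)
  have C: "C_class (Suc (size m)) (tree_coeff \<sigma> (Node \<mu> f))"
    by (rule C_class_mono[OF _ C_class_tree_coeff[OF \<sigma>]])
      (use add.prems size_le_fvert[of m] nvert_pos[of h] in auto)
  have b: "fvert m + fvert f < N" using add.prems by simp
  show ?case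
  proof
    fix y
    have "real (Suc (count m h)) *\<^sub>R cut_sum \<sigma> \<mu> w (add_mset h m, f) y
        = dirder (taylor_term (tree_coeff \<sigma> (Node \<mu> f)) w m) (w h) y"
      using dirder_cut_sum[OF b, of \<mu> w h y] add.IH[OF b] by simp
    also have "\<dots> = real (Suc (count m h)) *\<^sub>R taylor_term (tree_coeff \<sigma> (Node \<mu> f)) w (add_mset h m) y"
      by (rule dirder_taylor_term[OF C])
    finally show "cut_sum \<sigma> \<mu> w (add_mset h m, f) y = taylor_term (tree_coeff \<sigma> (Node \<mu> f)) w (add_mset h m) y"
      by (simp del: of_nat_Suc)
  qed
qed

lemma sum_over_lists_of_trees:
  fixes w :: "'d rtree \<Rightarrow> 'a" and a :: "'d forest \<Rightarrow> real"
  shows "(\<Sum>g | fvert g < N. a g *\<^sub>R taylor_term (\<sigma> \<mu>) w g y) =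
    (\<Sum>hs | fvert (mset hs) < N. (1 / fact (length hs)) *\<^sub>R a (mset hs) *\<^sub>R nderiv (\<sigma> \<mu>) (map w hs) y)"
proof -
  have fin: "finite {g :: 'd forest. fvert g < N}"
    by (rule finite_subset[OF _ finite_forests[of N]]) auto
  have "nderiv (\<sigma> \<mu>) (map w hs) y = mderiv (\<sigma> \<mu>) (image_mset w (mset hs)) y" if "fvert (mset hs) < N" for hs
    using mderiv_mset[of "map w hs" "\<sigma> \<mu>" y] C_class_mono[OF _ \<sigma>, of "length hs" \<mu>]
      size_le_fvert[of "mset hs"] that by simp
  then have "(\<Sum>hs | fvert (mset hs) < N. (1 / fact (length hs)) *\<^sub>R a (mset hs) *\<^sub>R nderiv (\<sigma> \<mu>) (map w hs) y)
    = (\<Sum>hs\<in>{hs. mset hs \<in> {g. fvert g < N}}. (1 / fact (length hs)) *\<^sub>R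
        a (mset hs) *\<^sub>R mderiv (\<sigma> \<mu>) (image_mset w (mset hs)) y)"
    by (intro sum.cong) auto
  also have "\<dots> = (\<Sum>g | fvert g < N. a g *\<^sub>R taylor_term (\<sigma> \<mu>) w g y)"
    by (subst sum_lists_to_multisets[OF fin]) (simp add: taylor_term_def mult.commute)
  finally show ?thesis by simp
qed

lemma cut_sum_lists:
  assumes "pvert c < N"
  shows "cut_sum \<sigma> \<mu> w c y =
    (\<Sum>cs | sum_list (map cut_key cs) = c. (1 / fact (length cs)) *\<^sub>R
      nderiv (\<sigma> \<mu>) (map (\<lambda>i. cut_coeff \<sigma> w i y) cs) y)"
proof -
  have "nderiv (\<sigma> \<mu>) (map (\<lambda>i. cut_coeff \<sigma> w i y) cs) y =
      mderiv (\<sigma> \<mu>) (image_mset (\<lambda>i. cut_coeff \<sigma> w i y) (mset cs)) y" if "sum_list (map cut_key cs) = c" for cs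
    using mderiv_mset[of "map (\<lambda>i. cut_coeff \<sigma> w i y) cs" "\<sigma> \<mu>" y] C_class_mono[OF _ \<sigma>, of "length cs" \<mu>]
      sum_cut_keys_bound(1)[OF that] assms by simp
  then have "(\<Sum>cs | sum_list (map cut_key cs) = c. (1 / fact (length cs)) *\<^sub>R
      nderiv (\<sigma> \<mu>) (map (\<lambda>i. cut_coeff \<sigma> w i y) cs) y) =
    (\<Sum>cs\<in>{cs. mset cs \<in> cuts c}. (1 / fact (length cs)) *\<^sub>R
      mderiv (\<sigma> \<mu>) (image_mset (\<lambda>i. cut_coeff \<sigma> w i y) (mset cs)) y)"
    by (intro sum.cong) (auto simp: cuts_mset)
  also have "\<dots> = cut_sum \<sigma> \<mu> w c y"
    unfolding cut_sum_def by (rule sum_lists_to_multisets[OF finite_cuts])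
  finally show ?thesis by simp
qed

text \<open>The forests \<open>g\<close> on the left, taken with a common root \<open>\<mu>\<close>, are the results of grafting the trees of
  \<open>m\<close> onto vertices of \<open>[f]\<^sub>\<mu>\<close>.  By the Leibniz rule they are also the terms obtained by differentiating the
  elementary differential of \<open>[f]\<^sub>\<mu>\<close>, because that is a product with one factor for each vertex.

  The combinatorics of this are avoided as follows.  Expanding the coproduct of \<open>g\<close> into cuts of its trees
  rewrites the left side as a sum over lists of cuts with product \<open>m \<otimes> f\<close>, in which the cut \<open>i\<close> carries the
  vector obtained by summing over all trees having this cut.  For \<open>i = m' \<otimes> \<tau>\<close> this vector is given by the
  induction hypothesis, \<open>\<tau>\<close> being a tree of \<open>f\<close>.  The left side thus equals \<^const>\<open>cut_sum\<close>.\<close>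

lemma grafting:
  assumes "fvert m + fvert f < N"
  shows "(\<Sum>g | fvert g < N. Poly_Mapping.lookup (coprod_forest g) (m, f) *\<^sub>R
      taylor_term (\<sigma> \<mu>) (\<lambda>h. tree_coeff \<sigma> h y) g y) =
    taylor_term (tree_coeff \<sigma> (Node \<mu> f)) (\<lambda>h. tree_coeff \<sigma> h y) m y"
  using assms
proof (induction "fvert f" arbitrary: f m \<mu> rule: less_induct)
  case less
  let ?w = "\<lambda>h. tree_coeff \<sigma> h y"
  let ?a = "\<lambda>h i. Poly_Mapping.lookup (coprod_tree h) (cut_key i)"
  let ?T = "{h :: 'd rtree. nvert h < N}"
  have finT: "finite ?T" by (rule finite_subset[OF _ finite_trees[of N]]) auto
  have coeff: "cut_coeff \<sigma> ?w i y = (\<Sum>h\<in>?T. ?a h i *\<^sub>R ?w h)"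
    if cs: "sum_list (map cut_key cs) = (m, f)" and i: "i \<in> set cs" for i cs
  proof (cases i)
    case (Inl h')
    have "h' \<in> ?T" using sum_cut_keys_bound(2)[OF cs i] less.prems Inl by (simp add: pvert_def)
    then have "(\<Sum>h\<in>?T. ?a h i *\<^sub>R ?w h) = (\<Sum>h\<in>{h'}. ?a h i *\<^sub>R ?w h)"
      using finT by (intro sum.mono_neutral_right) (auto simp: Inl coprod_tree_cut_all)
    then show ?thesis by (simp add: Inl coprod_tree_cut_all)
  next
    case (Inr p)
    obtain m' \<nu> f' where p: "p = (m', Node \<nu> f')" by (metis prod.exhaust rtree.exhaust)
    have b: "fvert m' + Suc (fvert f') < N"
      using sum_cut_keys_bound(2)[OF cs i] less.prems by (simp add: Inr p pvert_def)
    have lt: "fvert f' < fvert f"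
      using sum_cut_keys_bound(3)[OF cs, of m' "Node \<nu> f'"] i by (simp add: Inr p)
    have root: "inj_on (Node \<nu>) A" for A by (rule inj_onI) simp
    have "(\<Sum>h\<in>?T. ?a h i *\<^sub>R ?w h) = (\<Sum>h\<in>Node \<nu> ` {g. Suc (fvert g) < N}. ?a h i *\<^sub>R ?w h)"
    proof (rule sum.mono_neutral_right[OF finT])
      show "\<forall>h\<in>?T - Node \<nu> ` {g. Suc (fvert g) < N}. ?a h i *\<^sub>R ?w h = 0"
      proof
        fix h assume h: "h \<in> ?T - Node \<nu> ` {g. Suc (fvert g) < N}"
        obtain \<kappa> g where hg: "h = Node \<kappa> g" by (rule rtree.exhaust)
        then have "\<kappa> \<noteq> \<nu>" using h by auto
        then show "?a h i *\<^sub>R ?w h = 0" by (simp add: hg Inr p coprod_tree_cut del: coprod_tree.simps)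
      qed
    qed auto
    also have "\<dots> = (\<Sum>g | Suc (fvert g) < N. Poly_Mapping.lookup (coprod_forest g) (m', f') *\<^sub>R ?w (Node \<nu> g))"
      unfolding sum.reindex[OF root] by (simp add: Inr p coprod_tree_cut del: coprod_tree.simps)
    also have "\<dots> = (\<Sum>g | fvert g < N. Poly_Mapping.lookup (coprod_forest g) (m', f') *\<^sub>R ?w (Node \<nu> g))"
    \<comment> \<open>forests with \<open>N - 1\<close> vertices have too many vertices to have the cut \<open>m' \<otimes> f'\<close>\<close>
    proof (rule sum.mono_neutral_left)
      show "finite {g :: 'd forest. fvert g < N}" by (rule finite_subset[OF _ finite_forests[of N]]) auto
      show "\<forall>g\<in>{g. fvert g < N} - {g. Suc (fvert g) < N}.
          Poly_Mapping.lookup (coprod_forest g) (m', f') *\<^sub>R ?w (Node \<nu> g) = 0"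
        using b by (auto simp: pvert_def intro!: lookup_coprod_forest_eq_0)
    qed auto
    also have "\<dots> = (\<Sum>g | fvert g < N. Poly_Mapping.lookup (coprod_forest g) (m', f') *\<^sub>R taylor_term (\<sigma> \<nu>) ?w g y)"
    proof (rule sum.cong[OF refl])
      fix g :: "'d forest" assume "g \<in> {g. fvert g < N}"
      then have "C_class (size g) (\<sigma> \<nu>)" using size_le_fvert[of g] by (intro C_class_mono[OF _ \<sigma>]) simp
      from tree_coeff_Node[where f = g and \<sigma> = \<sigma> and \<mu> = \<nu>, OF this]
      show "Poly_Mapping.lookup (coprod_forest g) (m', f') *\<^sub>R ?w (Node \<nu> g) =
          Poly_Mapping.lookup (coprod_forest g) (m', f') *\<^sub>R taylor_term (\<sigma> \<nu>) ?w g y" by simp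
    qed
    also have "\<dots> = cut_coeff \<sigma> ?w i y"
      using less.hyps[OF lt, of m' \<nu>] b by (simp add: Inr p)
    finally show ?thesis by simp
  qed
  let ?S = "{cs. sum_list (map cut_key cs) = (m, f)}"
  let ?L = "\<lambda>cs. {hs. set hs \<subseteq> ?T \<and> length hs = length cs}"
  let ?H = "{hs :: 'd rtree list. fvert (mset hs) < N}"
  let ?term = "\<lambda>hs cs. (1 / fact (length hs)) *\<^sub>R prod_list (map2 ?a hs cs) *\<^sub>R nderiv (\<sigma> \<mu>) (map ?w hs) y"
  have finS: "finite ?S" by (rule finite_cut_lists)
  have H: "length hs < N" "set hs \<subseteq> ?T" if "hs \<in> ?H" for hs
  proof -
    show "length hs < N" using size_le_fvert[of "mset hs"] that by simp
    show "set hs \<subseteq> ?T"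
    proof
      fix h assume "h \<in> set hs"
      then show "h \<in> ?T" using nvert_le_fvert[of h "mset hs"] that by simp
    qed
  qed
  have finH: "finite ?H"
  proof (rule finite_subset)
    show "?H \<subseteq> {hs. set hs \<subseteq> ?T \<and> length hs \<le> N}" using H by fastforce
  qed (rule finite_lists_length_le[OF finT])
  have finL: "finite (?L cs)" for cs using finite_lists_length_eq[OF finT] .
  have inner: "(\<Sum>hs\<in>?L cs. ?term hs cs) = (\<Sum>hs\<in>{hs\<in>?H. length cs = length hs}. ?term hs cs)" if cs: "cs \<in> ?S" for cs
  proof (rule sum.mono_neutral_right[OF finL])
    show "{hs\<in>?H. length cs = length hs} \<subseteq> ?L cs"
      using H by auto
    show "\<forall>hs\<in>?L cs - {hs\<in>?H. length cs = length hs}. ?term hs cs = 0"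
    proof
      fix hs assume hs: "hs \<in> ?L cs - {hs\<in>?H. length cs = length hs}"
      have "prod_list (map2 ?a hs cs) = 0 \<or> fvert (mset hs) = (\<Sum>i\<leftarrow>cs. pvert (cut_key i))"
        if "length hs = length cs" for hs :: "'d rtree list" and cs
        using that
      proof (induction hs cs rule: list_induct2)
        case (Cons h hs i cs)
        then show ?case using keys_coprod_tree_pvert[of "cut_key i" h] by (auto simp: in_keys_iff)
      qed simp
      from this[of hs cs] show "?term hs cs = 0"
        using hs cs less.prems pvert_sum_list[of cs] by (auto simp: pvert_def)
    qed
  qed
  have Csig: "nderiv (\<sigma> \<mu>) us differentiable (at z)" if "length us < N" for us z
    by (rule nderiv_differentiable, rule C_class_mono[OF _ \<sigma>]) (use that in simp)
  have "taylor_term (tree_coeff \<sigma> (Node \<mu> f)) ?w m y = cut_sum \<sigma> \<mu> ?w (m, f) y"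
    using cut_sum_eq_taylor_term[OF less.prems] by simp
  also have "\<dots> = (\<Sum>cs\<in>?S. (1 / fact (length cs)) *\<^sub>R
      nderiv (\<sigma> \<mu>) (map (\<lambda>i. \<Sum>h\<in>?T. ?a h i *\<^sub>R ?w h) cs) y)"
    using less.prems
    by (subst cut_sum_lists) (auto simp: pvert_def coeff cong: map_cong intro!: sum.cong)
  also have "\<dots> = (\<Sum>cs\<in>?S. \<Sum>hs\<in>?L cs. ?term hs cs)"
  proof (rule sum.cong[OF refl])
    fix cs assume cs: "cs \<in> ?S"
    then have len: "length cs < N" using sum_cut_keys_bound(1)[of cs "(m, f)"] less.prems by (simp add: pvert_def)
    have "nderiv (\<sigma> \<mu>) (map (\<lambda>i. \<Sum>h\<in>?T. ?a h i *\<^sub>R ?w h) cs) y =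
        (\<Sum>hs\<in>?L cs. prod_list (map2 ?a hs cs) *\<^sub>R nderiv (\<sigma> \<mu>) (map ?w hs) y)"
      by (rule nderiv_multilinear[OF finT]) (rule Csig, use len in simp)
    then show "(1 / fact (length cs)) *\<^sub>R nderiv (\<sigma> \<mu>) (map (\<lambda>i. \<Sum>h\<in>?T. ?a h i *\<^sub>R ?w h) cs) y =
        (\<Sum>hs\<in>?L cs. ?term hs cs)"
      by (auto simp: scaleR_sum_right intro!: sum.cong)
  qed
  also have "\<dots> = (\<Sum>cs\<in>?S. \<Sum>hs\<in>{hs\<in>?H. length cs = length hs}. ?term hs cs)"
    by (rule sum.cong[OF refl]) (rule inner)
  also have "\<dots> = (\<Sum>hs\<in>?H. \<Sum>cs\<in>{cs\<in>?S. length cs = length hs}. ?term hs cs)"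
    by (rule sum.swap_restrict[OF finS finH])
  also have "\<dots> = (\<Sum>hs\<in>?H. (1 / fact (length hs)) *\<^sub>R
      Poly_Mapping.lookup (coprod_forest (mset hs)) (m, f) *\<^sub>R nderiv (\<sigma> \<mu>) (map ?w hs) y)"
    unfolding lookup_coprod_list by (intro sum.cong refl) (simp add: scaleR_sum_right scaleR_sum_left)
  also have "\<dots> = (\<Sum>g | fvert g < N. Poly_Mapping.lookup (coprod_forest g) (m, f) *\<^sub>R taylor_term (\<sigma> \<mu>) ?w g y)"
    by (rule sum_over_lists_of_trees[symmetric])
  finally show ?case by simp
qed

end

section \<open>Pairings with the coproduct\<close>

lemma lookup_of_forest: "Poly_Mapping.lookup (of_forest g) f = (if g = f then 1 else 0)"
  by (simp add: of_forest_def lookup_single when_def)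

lemma tensor_pair_coeff:
  assumes "finite S" "\<And>m. (m, f) \<in> Poly_Mapping.keys z \<Longrightarrow> m \<in> S"
  shows "tensor_pair \<phi> (coeff f) z = (\<Sum>m\<in>S. Poly_Mapping.lookup z (m, f) * \<phi> (of_forest m))"
proof -
  have inj: "inj_on (\<lambda>m. (m, f)) A" for A by (rule inj_onI) simp
  have "tensor_pair \<phi> (coeff f) z =
      (\<Sum>c\<in>Poly_Mapping.keys z. Poly_Mapping.lookup z c * \<phi> (of_forest (fst c)) * (if snd c = f then 1 else 0))"
    by (simp add: tensor_pair_def coeff_def lookup_of_forest case_prod_unfold)
  also have "\<dots> = (\<Sum>c\<in>Poly_Mapping.keys z \<union> (\<lambda>m. (m, f)) ` S.
      Poly_Mapping.lookup z c * \<phi> (of_forest (fst c)) * (if snd c = f then 1 else 0))"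
    by (rule sum.mono_neutral_left) (use assms in \<open>auto simp: in_keys_iff\<close>)
  also have "\<dots> = (\<Sum>c\<in>(\<lambda>m. (m, f)) ` S.
      Poly_Mapping.lookup z c * \<phi> (of_forest (fst c)) * (if snd c = f then 1 else 0))"
  proof (rule sum.mono_neutral_right)
    show "\<forall>c\<in>(Poly_Mapping.keys z \<union> (\<lambda>m. (m, f)) ` S) - (\<lambda>m. (m, f)) ` S.
        Poly_Mapping.lookup z c * \<phi> (of_forest (fst c)) * (if snd c = f then 1 else 0) = 0"
    proof
      fix c assume c: "c \<in> (Poly_Mapping.keys z \<union> (\<lambda>m. (m, f)) ` S) - (\<lambda>m. (m, f)) ` S"
      obtain m g where mg: "c = (m, g)" by (rule prod.exhaust)
      have "g \<noteq> f" using c assms(2)[of m] by (auto simp: mg)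
      then show "Poly_Mapping.lookup z c * \<phi> (of_forest (fst c)) * (if snd c = f then 1 else 0) = 0" by (simp add: mg)
    qed
  qed (use assms in auto)
  finally show ?thesis unfolding sum.reindex[OF inj] by simp
qed

lemma lookup_coprod:
  "Poly_Mapping.lookup (coprod x) c =
    (\<Sum>g\<in>Poly_Mapping.keys x. Poly_Mapping.lookup x g * Poly_Mapping.lookup (coprod_forest g) c)"
  unfolding coprod_def by (rule lookup_lin_ext)

lemma lookup_coprod_superset:
  assumes "finite S" "Poly_Mapping.keys x \<subseteq> S"
  shows "Poly_Mapping.lookup (coprod x) c =
    (\<Sum>g\<in>S. Poly_Mapping.lookup x g * Poly_Mapping.lookup (coprod_forest g) c)"
  unfolding lookup_coprod by (rule sum.mono_neutral_left) (use assms in \<open>auto simp: in_keys_iff\<close>)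

lemma of_forest_empty: "of_forest {#} = 1"
  by (simp add: of_forest_def flip: single_one)

lemma of_forest_add_mset: "of_forest (add_mset h f) = of_forest {#h#} * of_forest f"
  by (simp add: of_forest_def mult_single)

lemma of_forest_in_span: "set_mset f \<subseteq> trees_le N \<Longrightarrow> of_forest f \<in> span_of (forests N)"
  by (auto simp: of_forest_def span_of_def forests_def)

lemma character_of_forest:
  assumes "\<phi> \<in> characters N"
  shows "set_mset f \<subseteq> trees_le N \<Longrightarrow> \<phi> (of_forest f) = (\<Prod>h\<in>#f. \<phi> (of_forest {#h#}))"
proof (induction f)
  case empty
  then show ?case using assms by (simp add: characters_def of_forest_empty)
next
  case (add h f)
  have "of_forest {#h#} \<in> span_of (forests N)" "of_forest f \<in> span_of (forests N)"
    using add.prems by (auto intro!: of_forest_in_span)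
  then have "\<phi> (of_forest {#h#} * of_forest f) = \<phi> (of_forest {#h#}) * \<phi> (of_forest f)"
    using assms by (simp add: characters_def)
  then show ?case using add by (simp add: of_forest_add_mset[of h f])
qed

section \<open>Coherent paths\<close>

lemma trees_le_iff [simp]: "h \<in> trees_le n \<longleftrightarrow> nvert h \<le> n"
  by (simp add: trees_le_def)

lemma forests_le_eq: "n \<le> N \<Longrightarrow> forests_le N n = {f. fvert f \<le> n}"
  using nvert_le_fvert by (fastforce simp: forests_le_def forests_def)

lemma lookup_proj_le:
  "Poly_Mapping.lookup (proj_le n x) f = (if fvert f \<le> n then Poly_Mapping.lookup x f else 0)"
proof -
  have "Poly_Mapping.lookup (proj_le n x) f =
      (\<Sum>g\<in>Poly_Mapping.keys x. if g = f then (if fvert f \<le> n then Poly_Mapping.lookup x f else 0) else 0)"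
    unfolding proj_le_def lookup_lin_ext by (intro sum.cong refl) (auto simp: lookup_of_forest)
  then show ?thesis by (simp add: not_in_keys_iff_lookup_eq_zero)
qed

lemma lookup_compose_path_large:
  "N \<le> fvert f \<Longrightarrow> 0 < N \<Longrightarrow> Poly_Mapping.lookup (compose_path N g Y s $ i) f = 0"
  by (auto simp: compose_path_def lookup_add lookup_proj_le lookup_one when_def)

lemma vcoeff_compose_path:
  fixes g :: "real ^ 'k::finite \<Rightarrow> real ^ 'k" and Y :: "real \<Rightarrow> ('d::finite forest \<Rightarrow>\<^sub>0 real) ^ 'k"
  assumes g: "C_class N g" and f: "fvert f < N"
  shows "vcoeff f (compose_path N g Y s) = taylor_term g (\<lambda>h. vcoeff {#h#} (Y s)) f (base Y s)"
proof -
  let ?w = "\<lambda>h. vcoeff {#h#} (Y s)"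
  let ?L = "\<lambda>p. {hs :: 'd rtree list. set hs \<subseteq> trees_le (N - 1) \<and> length hs = p}"
  have finL: "finite (?L p)" for p
    unfolding trees_le_def by (rule finite_lists_length_eq[OF finite_trees])
  have size: "size f < N" using size_le_fvert[of f] f by simp
  have perm: "{hs\<in>?L (size f). mset hs = f} = permutations_of_multiset f"
  proof -
    have "nvert h \<le> N - 1" if "h \<in># f" for h using nvert_le_fvert[OF that] f by simp
    then show ?thesis by (auto simp: permutations_of_multiset_def)
  qed
  have "Poly_Mapping.lookup (compose_path N g Y s $ i) f = taylor_term g ?w f (base Y s) $ i" for i
  proof -
    let ?n = "\<lambda>hs. nderiv g (map ?w hs) (base Y s) $ i"
    let ?c = "real (card (permutations_of_multiset f)) * (mderiv g (image_mset ?w f) (base Y s) $ i)"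
    have "?n hs = mderiv g (image_mset ?w f) (base Y s) $ i" if "hs \<in> permutations_of_multiset f" for hs
    proof -
      have "mset hs = f" using permutations_of_multisetD[OF that] .
      then show ?thesis
        using mderiv_mset[of "map ?w hs" g "base Y s"] C_class_mono[OF _ g, of "length hs"] size by auto
    qed
    then have arrangements: "(\<Sum>hs\<in>permutations_of_multiset f. ?n hs) = ?c" by simp
    have inner: "(\<Sum>hs\<in>?L p. if mset hs = f then ?n hs else 0) = (if p = size f then ?c else 0)" for p
    proof (cases "p = size f")
      case True
      have "(\<Sum>hs\<in>?L (size f). if mset hs = f then ?n hs else 0) = (\<Sum>hs\<in>permutations_of_multiset f. ?n hs)"
        unfolding perm[symmetric] by (rule sum.inter_filter[OF finL, symmetric])
      then show ?thesis unfolding arrangements True by simp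
    next
      case False
      then have "mset hs \<noteq> f" if "hs \<in> ?L p" for hs using that by auto
      then show ?thesis using False by simp
    qed
    have "Poly_Mapping.lookup (compose_path N g Y s $ i) f = (if f = {#} then g (base Y s) $ i else 0) +
        (\<Sum>p = 1..N - 1. (1 / fact p) * (\<Sum>hs\<in>?L p. if mset hs = f then ?n hs else 0))"
      using f by (simp add: compose_path_def lookup_add lookup_proj_le lookup_one when_def lookup_sum
          lookup_of_forest if_distrib[of "(*) _"] cong: if_cong)
    also have "\<dots> = (if f = {#} then g (base Y s) $ i else 0) +
        (\<Sum>p = 1..N - 1. (1 / fact p) * (if p = size f then ?c else 0))"
      by (simp only: inner)
    also have "\<dots> = (real (card (permutations_of_multiset f)) / fact (size f)) * (mderiv g (image_mset ?w f) (base Y s) $ i)"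
    proof (cases "f = {#}")
      case False
      then have "size f \<in> {1..N - 1}" using size by (simp add: Suc_le_eq nonempty_has_size)
      then show ?thesis using False by (simp add: if_distrib[of "(*) _"] cong: if_cong)
    next
      case True
      then show ?thesis by (auto intro!: sum.neutral)
    qed
    also have "\<dots> = taylor_term g ?w f (base Y s) $ i"
      by (simp add: card_permutations_mfact taylor_term_def)
    finally show ?thesis .
  qed
  then show ?thesis by (simp add: vec_eq_iff vcoeff_def coeff_def)
qed

lemma taylor_term_cong:
  "(\<And>h. h \<in># m \<Longrightarrow> w h = w' h) \<Longrightarrow> taylor_term g w m y = taylor_term g w' m y"
  by (simp add: taylor_term_def cong: image_mset_cong)

text \<open>Coherence determines all coefficients from the base point, by induction on the tree.\<close>

lemma coherent_coeff:
  fixes \<sigma> :: "'d::finite \<Rightarrow> real ^ 'k::finite \<Rightarrow> real ^ 'k"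
  assumes \<sigma>: "\<And>\<mu>. C_class N (\<sigma> \<mu>)" and coh: "coherent N \<sigma> Y" and s: "s \<in> {0<..1}"
  shows "nvert h < N \<Longrightarrow> vcoeff {#h#} (Y s) = tree_coeff \<sigma> h (base Y s)"
proof (induction h)
  case (Node \<mu> f)
  have f: "Suc (fvert f) < N" using Node.prems by simp
  have "vcoeff {#Node \<mu> f#} (Y s) = vcoeff f (compose_path N (\<sigma> \<mu>) Y s)"
    using coh s f by (simp add: coherent_def)
  also have "\<dots> = taylor_term (\<sigma> \<mu>) (\<lambda>h. vcoeff {#h#} (Y s)) f (base Y s)"
    by (rule vcoeff_compose_path[OF \<sigma>]) (use f in simp)
  also have "\<dots> = taylor_term (\<sigma> \<mu>) (\<lambda>h. tree_coeff \<sigma> h (base Y s)) f (base Y s)"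
  proof (rule taylor_term_cong)
    fix h assume h: "h \<in># f"
    show "vcoeff {#h#} (Y s) = tree_coeff \<sigma> h (base Y s)"
      by (rule Node.IH[OF h]) (use nvert_le_fvert[OF h] f in simp)
  qed
  also have "\<dots> = tree_coeff \<sigma> (Node \<mu> f) (base Y s)"
    by (rule tree_coeff_Node[symmetric], rule C_class_mono[OF _ \<sigma>]) (use size_le_fvert[of f] f in simp)
  finally show ?case .
qed

lemma vcoeff_compose_coherent:
  fixes \<sigma> :: "'d::finite \<Rightarrow> real ^ 'k::finite \<Rightarrow> real ^ 'k"
  assumes \<sigma>: "\<And>\<mu>. C_class N (\<sigma> \<mu>)" and coh: "coherent N \<sigma> Y" and s: "s \<in> {0<..1}" and f: "fvert f < N"
  shows "vcoeff f (compose_path N (\<sigma> \<mu>) Y s) = taylor_term (\<sigma> \<mu>) (\<lambda>h. tree_coeff \<sigma> h (base Y s)) f (base Y s)"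
proof -
  have "vcoeff f (compose_path N (\<sigma> \<mu>) Y s) = taylor_term (\<sigma> \<mu>) (\<lambda>h. vcoeff {#h#} (Y s)) f (base Y s)"
    by (rule vcoeff_compose_path[OF \<sigma> f])
  also have "\<dots> = taylor_term (\<sigma> \<mu>) (\<lambda>h. tree_coeff \<sigma> h (base Y s)) f (base Y s)"
    by (rule taylor_term_cong, rule coherent_coeff[OF \<sigma> coh s])
      (use nvert_le_fvert[of _ f] f in \<open>auto intro: le_less_trans\<close>)
  finally show ?thesis .
qed

text \<open>By the grafting identity, the part of the remainder that is read off at time \<open>s\<close> is the Taylor
  polynomial of \<^term>\<open>tree_coeff \<sigma> (Node \<mu> f)\<close>, cut off where \<open>m\<close> and \<open>f\<close> together have \<open>N\<close> vertices.\<close>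

lemma remainder_compose_coherent:
  fixes \<sigma> :: "'d::finite \<Rightarrow> real ^ 'k::finite \<Rightarrow> real ^ 'k"
  assumes \<sigma>: "\<And>\<mu>. C_class N (\<sigma> \<mu>)" and coh: "coherent N \<sigma> Y"
    and s: "s \<in> {0<..1}" and t: "t \<in> {0<..1}" and f: "fvert f < N"
  shows "remainder X (compose_path N (\<sigma> \<mu>) Y) f s t =
    tree_coeff \<sigma> (Node \<mu> f) (base Y t) -
    (\<Sum>m | fvert m + fvert f < N. X s t (of_forest m) *\<^sub>R
      taylor_term (tree_coeff \<sigma> (Node \<mu> f)) (\<lambda>h. tree_coeff \<sigma> h (base Y s)) m (base Y s))"
proof -
  let ?w = "\<lambda>h. tree_coeff \<sigma> h (base Y s)"
  let ?Z = "compose_path N (\<sigma> \<mu>) Y"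
  let ?A = "{m :: 'd forest. fvert m + fvert f < N}"
  let ?F = "{g :: 'd forest. fvert g < N}"
  have finA: "finite ?A" by (rule finite_subset[OF _ finite_forests[of N]]) auto
  have finF: "finite ?F" by (rule finite_subset[OF _ finite_forests[of N]]) auto
  have keys: "Poly_Mapping.keys (?Z s $ i) \<subseteq> ?F" for i
  proof
    fix g assume "g \<in> Poly_Mapping.keys (?Z s $ i)"
    then show "g \<in> ?F"
      using lookup_compose_path_large[of N g "\<sigma> \<mu>" Y s i] f by (auto simp: in_keys_iff not_less[symmetric])
  qed
  have "tensor_pair (X s t) (coeff f) (coprod (?Z s $ i)) =
      (\<Sum>m\<in>?A. X s t (of_forest m) *\<^sub>R taylor_term (tree_coeff \<sigma> (Node \<mu> f)) ?w m (base Y s)) $ i" for i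
  proof -
    have "tensor_pair (X s t) (coeff f) (coprod (?Z s $ i)) =
        (\<Sum>m\<in>?A. Poly_Mapping.lookup (coprod (?Z s $ i)) (m, f) * X s t (of_forest m))"
    proof (rule tensor_pair_coeff[OF finA])
      fix m assume "(m, f) \<in> Poly_Mapping.keys (coprod (?Z s $ i))"
      then have "(\<Sum>g\<in>Poly_Mapping.keys (?Z s $ i). Poly_Mapping.lookup (?Z s $ i) g * Poly_Mapping.lookup (coprod_forest g) (m, f)) \<noteq> 0"
        unfolding in_keys_iff lookup_coprod .
      then obtain g where g: "g \<in> Poly_Mapping.keys (?Z s $ i)"
          "Poly_Mapping.lookup (?Z s $ i) g * Poly_Mapping.lookup (coprod_forest g) (m, f) \<noteq> 0"
        by (rule sum.not_neutral_contains_not_neutral)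
      then have "(m, f) \<in> Poly_Mapping.keys (coprod_forest g)" by (simp add: in_keys_iff)
      from keys_coprod_forest_pvert[OF this] show "m \<in> ?A" using keys g(1) by (auto simp: pvert_def)
    qed
    also have "\<dots> = (\<Sum>m\<in>?A. X s t (of_forest m) *
        (\<Sum>g\<in>?F. Poly_Mapping.lookup (coprod_forest g) (m, f) *\<^sub>R taylor_term (\<sigma> \<mu>) ?w g (base Y s)) $ i)"
    proof (rule sum.cong[OF refl])
      fix m :: "'d forest"
      have val: "Poly_Mapping.lookup (?Z s $ i) g = taylor_term (\<sigma> \<mu>) ?w g (base Y s) $ i" if "g \<in> ?F" for g
        using vcoeff_compose_coherent[OF \<sigma> coh s, of g \<mu>] that
        by (simp add: vec_eq_iff vcoeff_def coeff_def)
      have "Poly_Mapping.lookup (coprod (?Z s $ i)) (m, f) =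
          (\<Sum>g\<in>?F. Poly_Mapping.lookup (coprod_forest g) (m, f) *\<^sub>R taylor_term (\<sigma> \<mu>) ?w g (base Y s)) $ i"
        unfolding lookup_coprod_superset[OF finF keys] sum_component vector_scaleR_component real_scaleR_def
        by (rule sum.cong[OF refl]) (simp only: val mult.commute)
      then show "Poly_Mapping.lookup (coprod (?Z s $ i)) (m, f) * X s t (of_forest m) = X s t (of_forest m) *
          (\<Sum>g\<in>?F. Poly_Mapping.lookup (coprod_forest g) (m, f) *\<^sub>R taylor_term (\<sigma> \<mu>) ?w g (base Y s)) $ i"
        by simp
    qed
    also have "\<dots> = (\<Sum>m\<in>?A. X s t (of_forest m) * (taylor_term (tree_coeff \<sigma> (Node \<mu> f)) ?w m (base Y s) $ i))"
    proof (rule sum.cong[OF refl])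
      fix m assume "m \<in> ?A"
      then have "fvert m + fvert f < N" by simp
      from grafting[where \<sigma> = \<sigma>, OF \<sigma> this]
      show "X s t (of_forest m) * (\<Sum>g\<in>?F. Poly_Mapping.lookup (coprod_forest g) (m, f) *\<^sub>R
            taylor_term (\<sigma> \<mu>) ?w g (base Y s)) $ i =
          X s t (of_forest m) * (taylor_term (tree_coeff \<sigma> (Node \<mu> f)) ?w m (base Y s) $ i)" by simp
    qed
    finally show ?thesis by simp
  qed
  moreover have "vcoeff f (?Z t) = tree_coeff \<sigma> (Node \<mu> f) (base Y t)"
  proof -
    have "C_class (size f) (\<sigma> \<mu>)" by (rule C_class_mono[OF _ \<sigma>]) (use size_le_fvert[of f] f in simp)
    from tree_coeff_Node[where f = f and \<sigma> = \<sigma> and \<mu> = \<mu>, OF this]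
    show ?thesis using vcoeff_compose_coherent[OF \<sigma> coh t f] by simp
  qed
  ultimately show ?thesis by (simp add: remainder_def vec_eq_iff)
qed

text \<open>Of the cuts of a tree \<open>h\<close>, only \<open>h \<otimes> 1\<close> contributes at the empty forest.\<close>

lemma remainder_tree_path:
  fixes Y :: "real \<Rightarrow> ('d::finite forest \<Rightarrow>\<^sub>0 real) ^ 'k::finite"
  assumes "tree_path N Y" and s: "s \<in> {0..1}" and "X s t 1 = 1"
  shows "remainder X Y {#} s t =
    base Y t - (base Y s + (\<Sum>h\<in>trees_le (N - 1). X s t (of_forest {#h#}) *\<^sub>R vcoeff {#h#} (Y s)))"
proof -
  let ?T = "trees_le (N - 1) :: 'd rtree set"
  have finT: "finite ?T" unfolding trees_le_def by (rule finite_trees)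
  have fin: "finite (trees1_le (N - 1) :: 'd forest set)" using finT by (simp add: trees1_le_def)
  have inj: "inj_on (\<lambda>h. {#h#}) A" for A :: "'d rtree set" by (rule inj_onI) simp
  have "tensor_pair (X s t) (coeff {#}) (coprod (Y s $ i)) =
      (base Y s + (\<Sum>h\<in>?T. X s t (of_forest {#h#}) *\<^sub>R vcoeff {#h#} (Y s))) $ i" for i
  proof -
    have keys: "Poly_Mapping.keys (Y s $ i) \<subseteq> trees1_le (N - 1)"
      using assms(1) s by (auto simp: tree_path_def span_of_def)
    have cut: "Poly_Mapping.lookup (coprod_forest g) (m, {#}) = (if g = m then 1 else 0)"
      if "g \<in> trees1_le (N - 1)" for g m :: "'d forest"
      using that by (auto simp: trees1_le_def lookup_one when_def zero_prod_def coprod_tree_cut_all)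
    have val: "Poly_Mapping.lookup (coprod (Y s $ i)) (m, {#}) = Poly_Mapping.lookup (Y s $ i) m" for m
    proof -
      have "Poly_Mapping.lookup (coprod (Y s $ i)) (m, {#}) =
          (\<Sum>g\<in>Poly_Mapping.keys (Y s $ i). if g = m then Poly_Mapping.lookup (Y s $ i) m else 0)"
        unfolding lookup_coprod by (rule sum.cong[OF refl]) (use cut keys in auto)
      then show ?thesis by (simp add: not_in_keys_iff_lookup_eq_zero)
    qed
    have "tensor_pair (X s t) (coeff {#}) (coprod (Y s $ i)) =
        (\<Sum>m\<in>trees1_le (N - 1). Poly_Mapping.lookup (coprod (Y s $ i)) (m, {#}) * X s t (of_forest m))"
    proof (rule tensor_pair_coeff[OF fin])
      fix m assume "(m, {#}) \<in> Poly_Mapping.keys (coprod (Y s $ i))"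
      then show "m \<in> trees1_le (N - 1)" using keys by (auto simp: in_keys_iff val)
    qed
    also have "\<dots> = Poly_Mapping.lookup (Y s $ i) {#} * X s t (of_forest {#}) +
        (\<Sum>h\<in>?T. Poly_Mapping.lookup (Y s $ i) {#h#} * X s t (of_forest {#h#}))"
      unfolding trees1_le_def val using finT by (subst sum.insert) (auto simp: sum.reindex[OF inj])
    also have "\<dots> = (base Y s + (\<Sum>h\<in>?T. X s t (of_forest {#h#}) *\<^sub>R vcoeff {#h#} (Y s))) $ i"
      using assms(3) by (simp add: of_forest_empty base_def vcoeff_def coeff_def mult.commute)
    finally show ?thesis .
  qed
  then show ?thesis by (simp add: remainder_def vec_eq_iff base_def)
qed

section \<open>The estimate\<close>

lemma ex_sorted_list:
  assumes "finite H" "linear_order_on A r" "H \<subseteq> A"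
  shows "\<exists>hs. set hs = H \<and> distinct hs \<and> sorted_wrt (\<lambda>a b. (b, a) \<in> r) hs"
  using assms(1,3)
proof (induction H)
  case (insert x H)
  have r: "refl_on A r" "trans r" "total_on A r"
    using assms(2) by (auto simp: linear_order_on_def partial_order_on_def preorder_on_def)
  obtain hs where hs: "set hs = H" "distinct hs" "sorted_wrt (\<lambda>a b. (b, a) \<in> r) hs"
    using insert by auto
  have tot: "(a, x) \<in> r" if "a \<in> set hs" "(x, a) \<notin> r" for a
  proof -
    have "a \<in> A" "x \<in> A" "a \<noteq> x" using that hs insert by auto
    then show ?thesis using r(3) that(2) by (auto simp: total_on_def)
  qed
  let ?xs = "filter (\<lambda>a. (x, a) \<in> r) hs @ x # filter (\<lambda>a. (x, a) \<notin> r) hs"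
  have "sorted_wrt (\<lambda>a b. (b, a) \<in> r) ?xs"
    using hs(3) r(2) by (auto simp: sorted_wrt_append sorted_wrt_filter tot dest: transD)
      (meson tot transD)
  moreover have "set ?xs = insert x H" "distinct ?xs" using hs insert by auto
  ultimately show ?case by blast
qed simp

lemma min_tree_add_mset:
  assumes "antisym r" "(h, h) \<in> r" "\<And>x. x \<in># g \<Longrightarrow> (h, x) \<in> r"
  shows "min_tree r (add_mset h g) = h"
  unfolding min_tree_def
  by (rule the_equality) (use assms in \<open>auto dest: antisymD\<close>)

lemma mderiv_scaleR_fun:
  fixes g :: "'a::euclidean_space \<Rightarrow> 'b::euclidean_space"
  shows "C_class (size V) g \<Longrightarrow> mderiv (\<lambda>y. c *\<^sub>R g y) V = (\<lambda>y. c *\<^sub>R mderiv g V y)"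
proof (induction V)
  case (add v V)
  have C: "C_class (Suc (size V)) g" using add.prems by simp
  have C': "C_class (Suc (size V)) (\<lambda>y. c *\<^sub>R g y)" by (rule C_class_scaled[OF C])
  show ?case
    unfolding mderiv_add_mset[OF C'] mderiv_add_mset[OF C] add.IH[OF C_class_SucD[OF C]]
    by (rule ext) (rule dirder_cmul[OF mderiv_differentiable[OF C]])
qed simp

text \<open>An element of a set of reals is only known to be below the supremum when the set is bounded above.
  Both suprema of the estimate range over values of continuous functions on balls.\<close>

lemma bdd_above_continuous_cball:
  fixes \<psi> :: "'a::euclidean_space \<Rightarrow> real"
  assumes "continuous_on UNIV \<psi>"
  shows "bdd_above {\<psi> z | z. norm z \<le> \<rho>}"
proof -
  have "compact (\<psi> ` cball 0 \<rho>)"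
    by (intro compact_continuous_image continuous_on_subset[OF assms]) auto
  moreover have "{\<psi> z | z. norm z \<le> \<rho>} = \<psi> ` cball 0 \<rho>" by auto
  ultimately show ?thesis using bounded_imp_bdd_above compact_imp_bounded by metis
qed

lemma le_sup0: "x \<in> S \<Longrightarrow> bdd_above S \<Longrightarrow> x \<le> sup0 S"
  by (auto simp: sup0_def intro: cSup_upper)

lemma sup0_nonneg: "bdd_above S \<Longrightarrow> (\<And>x. x \<in> S \<Longrightarrow> 0 \<le> x) \<Longrightarrow> 0 \<le> sup0 S"
proof (cases "S = {}")
  case False
  assume S: "bdd_above S" "\<And>x. x \<in> S \<Longrightarrow> 0 \<le> x"
  obtain x where "x \<in> S" using False by blast
  then show ?thesis using S(2)[of x] le_sup0[of x S] S(1) by linarith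
qed (simp add: sup0_def)

lemma onorm_frechet_bounds:
  fixes F :: "'a::euclidean_space \<Rightarrow> 'b::euclidean_space"
  assumes "F differentiable (at y)"
  shows "0 \<le> onorm (frechet_derivative F (at y))"
    and "onorm (frechet_derivative F (at y)) \<le> (\<Sum>b\<in>Basis. norm (dirder F b y))"
proof -
  have "bounded_linear (frechet_derivative F (at y))"
    using assms frechet_derivative_works has_derivative_bounded_linear by blast
  from onorm_pos_le[OF this] onorm_componentwise[OF this]
  show "0 \<le> onorm (frechet_derivative F (at y))"
    and "onorm (frechet_derivative F (at y)) \<le> (\<Sum>b\<in>Basis. norm (dirder F b y))"
    by (simp_all add: dirder_def)
qed

lemma bdd_above_onorm_frechet:
  fixes F :: "'a::euclidean_space \<Rightarrow> 'b::euclidean_space"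
  assumes F: "C_class (Suc 0) F" and "0 \<le> c"
  shows "bdd_above {onorm (frechet_derivative F (at (y + a))) * c | a. norm a \<le> \<rho>}"
proof -
  have "continuous_on UNIV (\<lambda>a. \<Sum>b\<in>Basis. norm (dirder F b (y + a)))"
    by (intro continuous_intros continuous_on_compose2[OF C_class_continuous[OF C_class_dirder[OF F]]]) auto
  from bdd_above_continuous_cball[OF this] obtain M where
    M: "\<And>a. norm a \<le> \<rho> \<Longrightarrow> (\<Sum>b\<in>Basis. norm (dirder F b (y + a))) \<le> M"
    by (force simp: bdd_above_def)
  show ?thesis
  proof (rule bdd_aboveI[where M = "M * c"], clarify)
    fix a :: 'a assume a: "norm a \<le> \<rho>"
    have "onorm (frechet_derivative F (at (y + a))) \<le> M"
      using order_trans[OF onorm_frechet_bounds(2)[OF C_class_imp_differentiable[OF F]] M[OF a]] .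
    then show "onorm (frechet_derivative F (at (y + a))) * c \<le> M * c"
      using \<open>0 \<le> c\<close> by (rule mult_right_mono)
  qed
qed

text \<open>The segment from \<open>z\<close> to \<open>z'\<close> lies in the ball around \<open>y\<close> that contains its end points.\<close>

lemma increment_le_sup0:
  fixes F :: "'a::euclidean_space \<Rightarrow> 'b::euclidean_space"
  assumes F: "C_class (Suc 0) F" and z: "norm (z - y) \<le> \<rho>" and z': "norm (z' - y) \<le> \<rho>"
  shows "norm (F z' - F z) \<le> sup0 {onorm (frechet_derivative F (at (y + a))) * norm (z' - z) | a. norm a \<le> \<rho>}"
    (is "_ \<le> sup0 ?S")
proof (cases "z' = z")
  case True
  then have "?S = {0}" using order_trans[OF norm_ge_zero z] by (auto intro!: exI[of _ 0])
  then show ?thesis using True by (simp add: sup0_def)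
next
  case False
  let ?f' = "\<lambda>p. frechet_derivative F (at p)"
  define B where "B = sup0 ?S / norm (z' - z)"
  have bdd: "bdd_above ?S" by (rule bdd_above_onorm_frechet[OF F]) simp
  have "norm (F (z + (z' - z)) - F z) \<le> norm (z' - z) * B"
  proof (rule differentiable_bound_segment[where G = UNIV and f' = ?f'])
    show "(F has_derivative ?f' p) (at p within UNIV)" for p
      using C_class_imp_differentiable[OF F] frechet_derivative_works by blast
    fix x :: real assume x: "x \<in> {0..1}"
    define a where "a = (1 - x) *\<^sub>R (z - y) + x *\<^sub>R (z' - y)"
    have p: "z + x *\<^sub>R (z' - z) = y + a" by (simp add: a_def algebra_simps)
    have "norm a \<le> (1 - x) * norm (z - y) + x * norm (z' - y)"
      unfolding a_def by (rule order_trans[OF norm_triangle_ineq]) (use x in simp)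
    also have "\<dots> \<le> (1 - x) * \<rho> + x * \<rho>" using x z z' by (intro add_mono mult_left_mono) auto
    finally have "norm a \<le> \<rho>" by (simp add: algebra_simps)
    then have "onorm (?f' (y + a)) * norm (z' - z) \<le> sup0 ?S" by (intro le_sup0 bdd) blast
    then show "onorm (?f' (z + x *\<^sub>R (z' - z))) \<le> B" 
      unfolding p B_def using False by (simp add: pos_le_divide_eq)
  qed auto
  then show ?thesis using False by (simp add: B_def)
qed

lemma bdry_props:
  assumes "f \<in> bdry N r (forests_le N n)" "n \<le> N"
  shows "set_mset f \<subseteq> trees_le (N - 1)" "size f \<le> Suc n"
proof -
  show "set_mset f \<subseteq> trees_le (N - 1)" using assms by (simp add: bdry_def)
  have "fvert (f - {#min_tree r f#}) \<le> n" using assms by (simp add: bdry_def forests_le_eq)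
  then have "size (f - {#min_tree r f#}) \<le> n" using size_le_fvert order_trans by blast
  then show "size f \<le> Suc n" using diff_size_le_size_Diff[of f "{#min_tree r f#}"] by simp
qed

lemma bdd_above_boundary:
  fixes F :: "'a::euclidean_space \<Rightarrow> 'b::euclidean_space" and v :: "'i \<Rightarrow> 'a"
  assumes "finite B" "\<And>f. f \<in> B \<Longrightarrow> C_class (size f) F"
  shows "bdd_above {norm (mderiv F (image_mset v f) (y + z)) | f z. f \<in> B \<and> norm z \<le> \<rho>}"
proof -
  have "{norm (mderiv F (image_mset v f) (y + z)) | f z. f \<in> B \<and> norm z \<le> \<rho>} =
      (\<Union>f\<in>B. {norm (mderiv F (image_mset v f) (y + z)) | z. norm z \<le> \<rho>})" by blast
  moreover have "bdd_above {norm (mderiv F (image_mset v f) (y + z)) | z. norm z \<le> \<rho>}" if "f \<in> B" for f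
  proof (rule bdd_above_continuous_cball)
    have "C_class 0 (mderiv F (image_mset v f))" by (rule C_class_mderiv) (use assms(2)[OF that] in simp)
    then have "continuous_on UNIV (mderiv F (image_mset v f))" by simp
    then show "continuous_on UNIV (\<lambda>z. norm (mderiv F (image_mset v f) (y + z)))"
      by (intro continuous_intros continuous_on_compose2[OF \<open>continuous_on UNIV (mderiv F (image_mset v f))\<close>]) auto
  qed
  ultimately show ?thesis using assms(1) by simp
qed

lemma norm_scaleR_inverse_le: "1 \<le> c \<Longrightarrow> norm ((1 / c) *\<^sub>R x) \<le> norm x"
  by (simp add: divide_le_eq mult_le_cancel_left1)

text \<open>The point \<open>z\<close> reached from \<open>Y\<^sub>s\<close> by the displacement \<open>\<Sum>\<^sub>h \<langle>X\<^sub>s\<^sub>,\<^sub>t, h\<rangle> \<Upsilon>[h](Y\<^sub>s) / symfact h\<close> separates the two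
  sources of error.  The remainder of \<open>Y\<close> at the empty forest is \<open>Y\<^sub>t - z\<close>, and the mean value inequality
  between \<open>z\<close> and \<open>Y\<^sub>t\<close> gives the first supremum.  The distance from
  \<open>G z\<close> to the Taylor polynomial in \<open>remainder_compose_coherent\<close> gives the second one.  Symmetry
  factors are at least \<open>1\<close>, so that \<open>F\<close> and \<open>u\<close>, in terms of which the suprema are stated, dominate
  \<open>G\<close> and \<open>v\<close>, to which the Taylor expansion applies.\<close>

lemma remainder_bound:
  fixes r :: "('d::finite rtree \<times> 'd rtree) set"
    and \<sigma> :: "'d \<Rightarrow> real ^ 'k::finite \<Rightarrow> real ^ 'k"
  assumes r: "linear_order_on (trees_le (N - 1)) r" and X: "rough_path \<alpha> N X"
    and \<sigma>: "\<And>\<mu>. C_class N (\<sigma> \<mu>)" and Y: "tree_path N Y" and coh: "coherent N \<sigma> Y"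
    and f: "fvert f < N" and s: "s \<in> {0<..1}" and t: "t \<in> {0<..1}"
  shows "norm (remainder X (compose_path N (\<sigma> \<mu>) Y) f s t) \<le>
    sup0 {onorm (frechet_derivative (elem_diff \<sigma> (Node \<mu> f)) (at (base Y s + a))) *
        norm (remainder X Y {#} s t) | a. norm a \<le> err N \<sigma> X Y s t + norm (base Y t - base Y s)} +
    real (N + 1) ^ card (trees_le (N - 1) :: 'd rtree set) *
    sup0 {norm (mderiv (elem_diff \<sigma> (Node \<mu> f))
          (image_mset (\<lambda>h. X s t (of_forest {#h#}) *\<^sub>R elem_diff \<sigma> h (base Y s)) f') (base Y s + z)) | f' z.
        f' \<in> bdry N r (forests_le N (N - fvert f - 1)) \<and> norm z \<le> err N \<sigma> X Y s t}"
    (is "_ \<le> sup0 ?S1 + real (N + 1) ^ card ?H * sup0 ?S2")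
proof -
  define y where "y = base Y s"
  define F where "F = elem_diff \<sigma> (Node \<mu> f)"
  define G where "G = tree_coeff \<sigma> (Node \<mu> f)"
  define c where "c = symfact (Node \<mu> f)"
  define x where "x = (\<lambda>h. X s t (of_forest {#h#}))"
  define u where "u = (\<lambda>h. x h *\<^sub>R elem_diff \<sigma> h y)"
  define v where "v = (\<lambda>h. x h *\<^sub>R tree_coeff \<sigma> h y)"
  define E where "E = err N \<sigma> X Y s t"
  define z where "z = y + (\<Sum>h\<in>?H. v h)"
  define A where "A = (forests_le N (N - fvert f - 1) :: 'd forest set)"
  define B where "B = bdry N r A"
  have finH: "finite ?H" unfolding trees_le_def by (rule finite_trees)
  have A: "A = {m. fvert m + fvert f < N}" unfolding A_def using f by (auto simp: forests_le_eq)
  have G: "G = (\<lambda>y. (1 / c) *\<^sub>R F y)" by (auto simp: G_def c_def F_def tree_coeff_def)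
  have c: "1 \<le> c" unfolding c_def by (rule symfact_ge_1)
  have F: "F = (\<lambda>y. c *\<^sub>R G y)" using c by (simp add: G)
  have CG: "C_class (N - fvert f) G"
    unfolding G_def by (rule C_class_mono[OF _ C_class_tree_coeff[OF \<sigma>]]) (use f in auto)
  have CF: "C_class (N - fvert f) F" unfolding F by (rule C_class_scaled[OF CG])
  have vu: "v h = (1 / symfact h) *\<^sub>R u h" for h by (simp add: v_def u_def tree_coeff_def)
  have "norm (v h) \<le> norm (u h)" for h
    unfolding vu by (rule norm_scaleR_inverse_le[OF symfact_ge_1])
  then have vE: "(\<Sum>h\<in>?H. norm (v h)) \<le> E"
    unfolding E_def err_def by (intro sum_mono) (simp add: u_def x_def y_def)
  have char: "X s t \<in> characters N" using X s t by (simp add: rough_path_def)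
  have X1: "X s t 1 = 1" using char by (simp add: characters_def)
  have wH: "vcoeff {#h#} (Y s) = tree_coeff \<sigma> h y" if "h \<in> ?H" for h
    unfolding y_def by (rule coherent_coeff[OF \<sigma> coh s]) (use that f in simp)

  have RY: "remainder X Y {#} s t = base Y t - z"
  proof -
    have "(\<Sum>h\<in>?H. X s t (of_forest {#h#}) *\<^sub>R vcoeff {#h#} (Y s)) = (\<Sum>h\<in>?H. v h)"
      by (rule sum.cong[OF refl]) (simp only: wH v_def x_def)
    then show ?thesis
      using remainder_tree_path[where X = X and s = s and t = t, OF Y _ X1] s by (simp add: z_def y_def)
  qed
  have zy: "norm (z - y) \<le> E" unfolding z_def using order_trans[OF norm_sum vE] by simp
  have E0: "0 \<le> E" using order_trans[OF norm_ge_zero zy] .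

  have R: "remainder X (compose_path N (\<sigma> \<mu>) Y) f s t =
      (G (base Y t) - G z) + (G z - (\<Sum>m\<in>A. (1 / mfact m) *\<^sub>R mderiv G (image_mset v m) y))"
  proof -
    have "X s t (of_forest m) *\<^sub>R taylor_term G (\<lambda>h. tree_coeff \<sigma> h y) m y = (1 / mfact m) *\<^sub>R mderiv G (image_mset v m) y"
      if m: "m \<in> A" for m
    proof -
      have "set_mset m \<subseteq> trees_le N" using m nvert_le_fvert[of _ m] by (fastforce simp: A)
      from character_of_forest[OF char this]
      have "X s t (of_forest m) = (\<Prod>h\<in>#m. x h)" by (simp add: x_def)
      moreover have "C_class (size m) G"
        by (rule C_class_mono[OF _ CG]) (use m size_le_fvert[of m] in \<open>auto simp: A\<close>)
      ultimately show ?thesis unfolding v_def by (simp add: mderiv_scale taylor_term_def)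
    qed
    then show ?thesis
      unfolding remainder_compose_coherent[OF \<sigma> coh s t f] A[symmetric] G_def[symmetric] y_def[symmetric]
      by (simp cong: sum.cong)
  qed

  have first: "norm (G (base Y t) - G z) \<le> sup0 ?S1"
  proof -
    have "G (base Y t) - G z = (1 / c) *\<^sub>R (F (base Y t) - F z)" by (simp add: G scaleR_diff_right)
    then have "norm (G (base Y t) - G z) \<le> norm (F (base Y t) - F z)"
      using norm_scaleR_inverse_le[OF c] by metis
    also have "\<dots> \<le> sup0 {onorm (frechet_derivative F (at (y + a))) * norm (base Y t - z) | a.
        norm a \<le> E + norm (base Y t - y)}"
    proof (rule increment_le_sup0)
      show "C_class (Suc 0) F" by (rule C_class_mono[OF _ CF]) (use f in simp)
    qed (use zy E0 in \<open>auto intro: add_increasing2\<close>)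
    finally show ?thesis by (simp only: F_def y_def E_def RY)
  qed

  have Bprops: "set_mset f' \<subseteq> ?H" "size f' \<le> N - fvert f" if "f' \<in> B" for f'
    using bdry_props[of f' N r "N - fvert f - 1"] that f by (auto simp: B_def A_def)
  have finB: "finite B"
    by (rule finite_subset[OF _ finite_msets_bounded[OF finH, of "N - fvert f"]]) (use Bprops in blast)
  have CFB: "C_class (size f') F" and CGB: "C_class (size f') G" if "f' \<in> B" for f'
    using C_class_mono[OF Bprops(2)[OF that]] CF CG by auto
  have S2: "?S2 = {norm (mderiv F (image_mset u f') (y + z)) | f' z. f' \<in> B \<and> norm z \<le> E}"
    by (simp only: F_def u_def x_def y_def B_def A_def E_def)
  have bdd2: "bdd_above ?S2" unfolding S2 by (rule bdd_above_boundary[OF finB CFB])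
  have M0: "0 \<le> sup0 ?S2" by (rule sup0_nonneg[OF bdd2]) auto
  have MB: "norm (mderiv G (image_mset v f') p) \<le> sup0 ?S2"
    if f': "f' \<in> B" and p: "norm (p - y) \<le> (\<Sum>h\<in>?H. norm (v h))" for f' p
  proof -
    have "mderiv G (image_mset v f') p = (1 / c) *\<^sub>R mderiv F (image_mset v f') p"
      unfolding G by (subst mderiv_scaleR_fun) (use CFB[OF f'] in simp_all)
    also have "mderiv F (image_mset v f') p = (\<Prod>h\<in>#f'. 1 / symfact h) *\<^sub>R mderiv F (image_mset u f') p"
      unfolding vu by (rule mderiv_scale[OF CFB[OF f']])
    also have "(\<Prod>h\<in>#f'. 1 / symfact h) = 1 / (\<Prod>h\<in>#f'. symfact h)" by (induction f') auto
    finally have "norm (mderiv G (image_mset v f') p) \<le> norm (mderiv F (image_mset u f') p)"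
      using order_trans[OF norm_scaleR_inverse_le[OF c] norm_scaleR_inverse_le]
        prod_mset_ge_1[of f' symfact] symfact_ge_1 by metis
    also have "\<dots> \<le> sup0 ?S2"
    proof (rule le_sup0[OF _ bdd2])
      have "norm (p - y) \<le> E" using p vE by simp
      then show "norm (mderiv F (image_mset u f') p) \<in> ?S2"
        unfolding S2 using f' by (intro CollectI exI[of _ f'] exI[of _ "p - y"]) simp
    qed
    finally show ?thesis .
  qed

  have ord: "antisym r" "refl_on ?H r"
    using r by (auto simp: linear_order_on_def partial_order_on_def preorder_on_def)
  obtain hs where hs: "set hs = ?H" "distinct hs" "sorted_wrt (\<lambda>a b. (b, a) \<in> r) hs"
    using ex_sorted_list[OF finH r] by blast
  have "norm (mderiv G (image_mset v {#}) (y + (\<Sum>h\<in>set hs. v h)) -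
      (\<Sum>m | set_mset m \<subseteq> set hs \<and> m + {#} \<in> A. (1 / mfact m) *\<^sub>R mderiv G (image_mset v (m + {#})) y))
    \<le> real (N - fvert f + 1) ^ length hs * sup0 ?S2"
  proof (rule taylor_lower_set[OF CG, where H = ?H and r = r and B = B])
    show "finite A" unfolding A by (rule finite_subset[OF _ finite_forests[of N]]) auto
    show "size m < N - fvert f" if "m \<in> A" for m using that size_le_fvert[of m] by (simp add: A)
    show "m' \<in> A" if "m \<in> A" "m' \<subseteq># m" for m m' using that fvert_mono[of m' m] by (simp add: A)
    show "(h, h) \<in> r" if "h \<in> ?H" for h using ord(2) that by (rule refl_onD)
    show "add_mset h g \<in> B"
      if "g \<in> A" "add_mset h g \<notin> A" "h \<in> ?H" "set_mset g \<subseteq> ?H" "\<And>x. x \<in># g \<Longrightarrow> (h, x) \<in> r" for g h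
    proof -
      have "min_tree r (add_mset h g) = h"
        by (rule min_tree_add_mset[OF ord(1) refl_onD[OF ord(2) that(3)] that(5)])
      then show ?thesis using that by (simp add: B_def bdry_def)
    qed
    show "norm (mderiv G (image_mset v f') p) \<le> sup0 ?S2"
      if "f' \<in> B" "norm (p - y) \<le> (\<Sum>h\<in>?H. norm (v h))" for f' p using MB that .
    show "{#} \<in> A" using f by (simp add: A)
  qed (use finH hs M0 in auto)
  moreover have "{m. set_mset m \<subseteq> set hs \<and> m + {#} \<in> A} = A"
    using nvert_le_fvert by (fastforce simp: hs A)
  moreover have "length hs = card ?H" using distinct_card[OF hs(2)] hs(1) by simp
  ultimately have "norm (G z - (\<Sum>m\<in>A. (1 / mfact m) *\<^sub>R mderiv G (image_mset v m) y))
      \<le> real (N - fvert f + 1) ^ card ?H * sup0 ?S2"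
    by (simp add: z_def hs(1))
  also have "\<dots> \<le> real (N + 1) ^ card ?H * sup0 ?S2"
    using M0 by (intro mult_right_mono power_mono) auto
  finally have second: "norm (G z - (\<Sum>m\<in>A. (1 / mfact m) *\<^sub>R mderiv G (image_mset v m) y))
      \<le> real (N + 1) ^ card ?H * sup0 ?S2" .
  show ?thesis
    unfolding R by (rule order_trans[OF norm_triangle_ineq add_mono[OF first second]])
qed

theorem corollary3p12:
  fixes \<alpha> :: real and N :: nat
  assumes "0 < \<alpha>" and "\<alpha> < 1"
    and "real N * \<alpha> \<le> 1" and "1 < real (N + 1) * \<alpha>"
  shows "\<exists>C::real.
    \<forall>(r :: ('d::finite rtree \<times> 'd rtree) set)
     (X :: real \<Rightarrow> real \<Rightarrow> ('d forest \<Rightarrow>\<^sub>0 real) \<Rightarrow> real)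
     (\<sigma> :: 'd \<Rightarrow> real ^ 'k::finite \<Rightarrow> real ^ 'k)
     (Y :: real \<Rightarrow> ('d forest \<Rightarrow>\<^sub>0 real) ^ 'k).
      linear_order_on (trees_le (N - 1)) r \<longrightarrow>
      rough_path \<alpha> N X \<longrightarrow>
      (\<forall>\<mu>. C_class N (\<sigma> \<mu>)) \<longrightarrow>
      tree_path N Y \<longrightarrow>
      coherent N \<sigma> Y \<longrightarrow>
      (\<forall>\<mu>. \<forall>f\<in>forests_le N (N - 1). \<forall>s\<in>{0<..1}. \<forall>t\<in>{0<..1}.
        norm (remainder X (compose_path N (\<sigma> \<mu>) Y) f s t) \<le>
          C * sup0 {onorm (frechet_derivative (elem_diff \<sigma> (Node \<mu> f)) (at (base Y s + a))) *
                      norm (remainder X Y {#} s t) | a.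
                    norm a \<le> err N \<sigma> X Y s t + norm (base Y t - base Y s)} +
          C * sup0 {norm (mderiv (elem_diff \<sigma> (Node \<mu> f))
                        (image_mset (\<lambda>h. X s t (of_forest {#h#}) *\<^sub>R elem_diff \<sigma> h (base Y s)) f')
                        (base Y s + z)) | f' z.
                    f' \<in> bdry N r (forests_le N (N - fvert f - 1)) \<and>
                    norm z \<le> err N \<sigma> X Y s t})"
proof -
  have N: "0 < N" using assms by (cases N) auto
  let ?C = "real (N + 1) ^ card (trees_le (N - 1) :: 'd rtree set)"
  have C1: "1 \<le> ?C" by (rule one_le_power) simp
  show ?thesis
  proof (intro exI[of _ ?C] allI impI ballI)
    fix r :: "('d rtree \<times> 'd rtree) set" and X :: "real \<Rightarrow> real \<Rightarrow> ('d forest \<Rightarrow>\<^sub>0 real) \<Rightarrow> real"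
      and \<sigma> :: "'d \<Rightarrow> real ^ 'k \<Rightarrow> real ^ 'k"
      and Y :: "real \<Rightarrow> ('d forest \<Rightarrow>\<^sub>0 real) ^ 'k" and \<mu> and f :: "'d forest" and s t :: real
    assume hyps: "linear_order_on (trees_le (N - 1)) r" "rough_path \<alpha> N X" "\<forall>\<mu>. C_class N (\<sigma> \<mu>)"
      "tree_path N Y" "coherent N \<sigma> Y" and f: "f \<in> forests_le N (N - 1)"
      and st: "s \<in> {0<..1}" "t \<in> {0<..1}"
    have fN: "fvert f < N" using f N by (auto simp: forests_le_def)
    let ?S1 = "{onorm (frechet_derivative (elem_diff \<sigma> (Node \<mu> f)) (at (base Y s + a))) *
        norm (remainder X Y {#} s t) | a. norm a \<le> err N \<sigma> X Y s t + norm (base Y t - base Y s)}"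
    let ?S2 = "{norm (mderiv (elem_diff \<sigma> (Node \<mu> f))
        (image_mset (\<lambda>h. X s t (of_forest {#h#}) *\<^sub>R elem_diff \<sigma> h (base Y s)) f') (base Y s + z)) | f' z.
        f' \<in> bdry N r (forests_le N (N - fvert f - 1)) \<and> norm z \<le> err N \<sigma> X Y s t}"
    have "C_class (Suc N - nvert (Node \<mu> f)) (tree_coeff \<sigma> (Node \<mu> f))"
      by (rule C_class_tree_coeff) (use hyps(3) fN in auto)
    then have "C_class (Suc 0) (tree_coeff \<sigma> (Node \<mu> f))"
      by (rule C_class_mono[rotated]) (use fN in simp)
    then have "C_class (Suc 0) (\<lambda>y. symfact (Node \<mu> f) *\<^sub>R tree_coeff \<sigma> (Node \<mu> f) y)"
      by (rule C_class_scaled)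
    moreover have "symfact (Node \<mu> f) \<noteq> 0" using symfact_ge_1[of "Node \<mu> f"] by linarith
    ultimately have CF: "C_class (Suc 0) (elem_diff \<sigma> (Node \<mu> f))"
      by (simp add: tree_coeff_def del: symfact.simps elem_diff.simps)
    from bdd_above_onorm_frechet[OF CF norm_ge_zero] have bdd: "bdd_above ?S1" .
    have "0 \<le> sup0 ?S1"
    proof (rule sup0_nonneg[OF bdd], elim CollectE exE conjE)
      fix p a assume "p = onorm (frechet_derivative (elem_diff \<sigma> (Node \<mu> f)) (at (base Y s + a))) *
        norm (remainder X Y {#} s t)"
      then show "0 \<le> p"
        using onorm_frechet_bounds(1)[OF C_class_imp_differentiable[OF CF]] by simp
    qed
    then have "1 * sup0 ?S1 \<le> ?C * sup0 ?S1" by (intro mult_right_mono C1)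
    then show "norm (remainder X (compose_path N (\<sigma> \<mu>) Y) f s t) \<le> ?C * sup0 ?S1 + ?C * sup0 ?S2"
      using remainder_bound[OF hyps(1,2) _ hyps(4,5) fN st, of \<mu>] hyps(3) by simp
  qed
qed

end
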